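(* Let $G$ be a finite complex reflection group acting on $\mathbb C^d$, let $\Omega_1,\Omega_2\subseteq\mathbb C^d$ be bounded domains, and let $\boldsymbol f:\Omega_1\to\Omega_2$ be a proper holomorphic map with $G$ as the group of deck transformations. Let $\omega:\Omega_1\to(0,\infty)$ be a continuous function of the form $\omega=\widetilde\omega\circ\boldsymbol f$ for a continuous function $\widetilde\omega:\Omega_2\to(0,\infty)$. Then the reproducing kernels $\mathcal B_\omega$ of $\mathbb A^2_\omega(\Omega_1)$ and $\mathcal B_{\widetilde\omega}$ of $\mathbb A^2_{\widetilde\omega}(\Omega_2)$ transform according to $$\mathcal B_{\widetilde\omega}\big(\boldsymbol f(\boldsymbol z),\boldsymbol f(\boldsymbol w)\big)=\frac{1}{J_{\boldsymbol f}(\boldsymbol z)\,\overline{J_{\boldsymbol f}(\boldsymbol w)}}\sum_{\sigma\in G}\det(\sigma)\,\mathcal B_\omega(\sigma^{-1}\cdot\boldsymbol z,\boldsymbol w)\qquad\text{for }\boldsymbol z,\boldsymbol w\in\Omega_1.$$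
   Context: A complex reflection on $\mathbb C^d$ is a linear map $\sigma$ of finite order in $GL(d,\mathbb C)$ such that $\mathrm{id}-\sigma$ has rank $1$. A finite complex reflection group is a finite subgroup $G\subset GL(d,\mathbb C)$ generated by complex reflections. $G$ acts on $\mathbb C^d$ by $\sigma\cdot\boldsymbol z=\sigma^{-1}\boldsymbol z$ (so $\sigma^{-1}\cdot\boldsymbol z=\sigma\boldsymbol z$). A proper holomorphic map $\boldsymbol f:\Omega_1\to\Omega_2$ has $G$ as its group of deck transformations (equivalently, is factored by automorphisms $G$) if $\Omega_1$ is $G$-invariant and $\boldsymbol f^{-1}(\boldsymbol f(\boldsymbol z))=\{\sigma\cdot\boldsymbol z:\sigma\in G\}$ for all $\boldsymbol z\in\Omega_1$. $J_{\boldsymbol f}$ denotes the determinant of the complex Jacobian matrix of $\boldsymbol f$. For a domain $D$ and a continuous weight $\nu:D\to(0,\infty)$, $\mathbb A^2_\nu(D)$ is the Hilbert space of holomorphic $h$ on $D$ with $\int_D|h|^2\nu\,dV<\infty$. $dV$ is Lebesgue measure normalized on $\Omega_1$; the same multiple of Lebesgue measure is used on $\Omega_2$. At critical points of $\boldsymbol f$ (zeros of $J_{\boldsymbol f}$) the quotient on the right is understood as its extension, holomorphic in $\boldsymbol z$ and antiholomorphic in $\boldsymbol w$ (the sum is divisible by $J_{\boldsymbol f}(\boldsymbol z)\overline{J_{\boldsymbol f}(\boldsymbol w)}$). *)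

theory Defs
  imports "HOL-Analysis.Analysis" "HOL-Algebra.Generated_Groups"
begin

definition GL :: "(complex^'n^'n) monoid"
  where "GL = \<lparr>carrier = {A. invertible A}, mult = (**), one = mat 1\<rparr>"

definition complex_reflection :: "complex^'n^'n \<Rightarrow> bool"
  where "complex_reflection \<sigma> \<longleftrightarrow>
    \<sigma> \<in> carrier GL \<and>
    (\<exists>k::nat. k > 0 \<and> \<sigma> [^]\<^bsub>GL\<^esub> k = \<one>\<^bsub>GL\<^esub>) \<and>
    rank (mat 1 - \<sigma>) = 1"

text \<open>The trivial group (empty generating set) is included.\<close>

definition finite_complex_reflection_group :: "(complex^'n^'n) set \<Rightarrow> bool"
  where "finite_complex_reflection_group G \<longleftrightarrow>
    finite G \<and> subgroup G GL \<and>
    (\<exists>R. (\<forall>\<sigma>\<in>R. complex_reflection \<sigma>) \<and> G = generate GL R)"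

definition act :: "complex^'n^'n \<Rightarrow> complex^'n \<Rightarrow> complex^'n"
  where "act \<sigma> z = matrix_inv \<sigma> *v z"

text \<open>
  Holomorphic means Frechet differentiable with complex linear derivative. The definitions
  are intended for open sets \<open>D\<close>; additivity of the derivative is part of
  \<open>has_derivative\<close>, so only complex homogeneity has to be added.
\<close>

definition holomorphic_fun :: "(complex^'n \<Rightarrow> complex) \<Rightarrow> (complex^'n) set \<Rightarrow> bool"
  where "holomorphic_fun h D \<longleftrightarrow>
    (\<forall>z\<in>D. \<exists>h'. (h has_derivative h') (at z within D) \<and> (\<forall>c v. h' (c *s v) = c * h' v))"

definition holomorphic_map :: "(complex^'n \<Rightarrow> complex^'m) \<Rightarrow> (complex^'n) set \<Rightarrow> bool"
  where "holomorphic_map f D \<longleftrightarrow> (\<forall>i. holomorphic_fun (\<lambda>z. f z $ i) D)"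

definition jacobian_det :: "(complex^'n \<Rightarrow> complex^'n) \<Rightarrow> complex^'n \<Rightarrow> complex"
  where "jacobian_det f z = det (\<chi> i j. deriv (\<lambda>t. f (z + t *s axis j 1) $ i) 0)"

definition proper_holomorphic ::
    "(complex^'n \<Rightarrow> complex^'m) \<Rightarrow> (complex^'n) set \<Rightarrow> (complex^'m) set \<Rightarrow> bool"
  where "proper_holomorphic f D E \<longleftrightarrow>
    f ` D \<subseteq> E \<and> holomorphic_map f D \<and> proper_map (top_of_set D) (top_of_set E) f"

definition has_deck_group ::
    "(complex^'n \<Rightarrow> complex^'n) \<Rightarrow> (complex^'n) set \<Rightarrow> (complex^'n^'n) set \<Rightarrow> bool"
  where "has_deck_group f D G \<longleftrightarrow>
    (\<forall>\<sigma>\<in>G. act \<sigma> ` D \<subseteq> D) \<and>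
    (\<forall>z\<in>D. {x \<in> D. f x = f z} = {act \<sigma> z |\<sigma>. \<sigma> \<in> G})"

definition normalized_lebesgue :: "(complex^'n) set \<Rightarrow> (complex^'n) measure"
  where "normalized_lebesgue D = density lborel (\<lambda>_. ennreal (1 / measure lborel D))"

text \<open>
  Elements of the Bergman space are represented by total functions, of which only the values
  on \<open>D\<close> matter. The first argument is the reference measure.
\<close>

definition bergman_space ::
    "(complex^'n) measure \<Rightarrow> (complex^'n) set \<Rightarrow> (complex^'n \<Rightarrow> real) \<Rightarrow> (complex^'n \<Rightarrow> complex) set"
  where "bergman_space V D \<nu> =
    {h. holomorphic_fun h D \<and> set_integrable V D (\<lambda>z. (cmod (h z))\<^sup>2 * \<nu> z)}"

definition bergman_inner ::
    "(complex^'n) measure \<Rightarrow> (complex^'n) set \<Rightarrow> (complex^'n \<Rightarrow> real) \<Rightarrow>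
     (complex^'n \<Rightarrow> complex) \<Rightarrow> (complex^'n \<Rightarrow> complex) \<Rightarrow> complex"
  where "bergman_inner V D \<nu> h k = (LINT z:D|V. h z * cnj (k z) * complex_of_real (\<nu> z))"

definition reproducing_kernel ::
    "(complex^'n) measure \<Rightarrow> (complex^'n) set \<Rightarrow> (complex^'n \<Rightarrow> real) \<Rightarrow>
     (complex^'n \<Rightarrow> complex^'n \<Rightarrow> complex) \<Rightarrow> bool"
  where "reproducing_kernel V D \<nu> K \<longleftrightarrow>
    (\<forall>w\<in>D. (\<lambda>z. K z w) \<in> bergman_space V D \<nu> \<and>
       (\<forall>h \<in> bergman_space V D \<nu>. bergman_inner V D \<nu> h (\<lambda>z. K z w) = h w))"

text \<open>The kernel is set to zero outside \<open>D \<times> D\<close>, so that as a total function it is unique.\<close>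

definition bergman_kernel ::
    "(complex^'n) measure \<Rightarrow> (complex^'n) set \<Rightarrow> (complex^'n \<Rightarrow> real) \<Rightarrow>
     complex^'n \<Rightarrow> complex^'n \<Rightarrow> complex"
  where "bergman_kernel V D \<nu> = (THE K. reproducing_kernel V D \<nu> K \<and>
    (\<forall>z w. z \<notin> D \<or> w \<notin> D \<longrightarrow> K z w = 0))"

text \<open>
  \<open>Q\<close> extends \<open>q\<close>, which is given where \<open>J z\<close> and \<open>J w\<close> are both nonzero, to all of
  \<open>D \<times> D\<close>, holomorphically in the first and antiholomorphically in the second variable.
\<close>

definition sesquiholomorphic_extension ::
    "(complex^'n) set \<Rightarrow> (complex^'n \<Rightarrow> complex) \<Rightarrow>
     (complex^'n \<Rightarrow> complex^'n \<Rightarrow> complex) \<Rightarrow> (complex^'n \<Rightarrow> complex^'n \<Rightarrow> complex) \<Rightarrow> bool"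
  where "sesquiholomorphic_extension D J q Q \<longleftrightarrow>
    (\<forall>w\<in>D. holomorphic_fun (\<lambda>z. Q z w) D) \<and>
    (\<forall>z\<in>D. holomorphic_fun (\<lambda>w. cnj (Q z w)) D) \<and>
    (\<forall>z\<in>D. \<forall>w\<in>D. J z \<noteq> 0 \<longrightarrow> J w \<noteq> 0 \<longrightarrow> Q z w = q z w)"

end

theory Submission
  imports Defs "HOL-Complex_Analysis.Conformal_Mappings" "HOL-Real_Asymp.Real_Asymp"
begin

unbundle no fps_syntax

text \<open>
  Write \<open>D\<close> and \<open>E\<close> for the two domains, \<open>N\<close> for the order of \<open>G\<close> and \<open>J\<close> for the Jacobian
  determinant of \<open>f\<close>. Differentiating \<open>f (\<sigma> z) = f z\<close> gives \<open>J (\<sigma> z) * det \<sigma> = J z\<close>, and off the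
  zeros of \<open>J\<close> the map \<open>f\<close> is \<open>N\<close>-to-one with real Jacobian \<open>\<bar>J\<bar>^2\<close>. Hence \<open>g \<mapsto> J * (g \<circ> f)\<close> carries
  the weighted Bergman space of \<open>E\<close> into that of \<open>D\<close> and multiplies inner products by \<open>N\<close>
  (\<open>pullback_ip\<close>). Its values \<open>H\<close> are equivariant: \<open>H (\<sigma> z) * det \<sigma> = H z\<close>.

  The heart of the proof is the converse (\<open>equivariant_factorization\<close>): every equivariant
  holomorphic \<open>H\<close> on \<open>D\<close> is \<open>J * (k \<circ> f)\<close> with \<open>k\<close> holomorphic on all of \<open>E\<close>. Granting it, the
  function \<open>F z = (\<Sum>\<sigma>\<in>G. det \<sigma> * B1 (\<sigma> z) w)\<close> is equivariant, so \<open>F = J * (k \<circ> f)\<close>. Pairing \<open>F\<close>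
  with \<open>J * (g \<circ> f)\<close>, moving each \<open>\<sigma>\<close> to the other factor and using the reproducing property of
  \<open>B1\<close> shows that the inner product of \<open>g\<close> with \<open>k\<close> is \<open>J w * g (f w)\<close>, up to the normalisation of
  the measure, for every \<open>g\<close> in the Bergman space of \<open>E\<close>. This identifies \<open>k\<close> with
  \<open>cnj (J w) * B2 (-) (f w)\<close>, which is the transformation rule (\<open>kernel_transformation\<close>). Thus
  \<open>B2 (f z) (f w)\<close> is itself the wanted extension of the quotient, and it is the only one because
  the zeros of \<open>J\<close> have empty interior.

  For the factorization, \<open>k\<close> is defined by \<open>k (f z) = H z / J z\<close> off the critical values, which form
  a closed null set by properness and Sard's theorem, and has to be continued across them. By a
  device of Bell, \<open>k\<close> satisfies the Cauchy-Riemann equations weakly on \<open>E\<close>: pulled back to \<open>D\<close>, the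
  integral of \<open>k\<close> against an antiholomorphic derivative of a test function is, up to a constant, the
  conjugate of the integral of \<open>cnj H\<close> times a determinant of gradients
  \<open>det (\<partial>a\<^sub>1, \<dots>, \<partial>\<theta>, \<dots>, \<partial>a\<^sub>n)\<close> with holomorphic \<open>a\<^sub>i\<close> and \<open>\<theta>\<close> compactly supported in \<open>D\<close> by
  properness. Such a determinant is a divergence, and the integral vanishes
  (\<open>null_lagrangian_integral\<close>). Mollification turns the weak equations into holomorphy
  (\<open>weakly_holomorphic_extension\<close>).

  The same argument with \<open>H = J\<close>, where \<open>k\<close> is the indicator function of the image of \<open>f\<close>, yields
  that \<open>f\<close> is onto (\<open>f_surjective\<close>), so that the push-forward of \<open>\<bar>J\<bar>^2\<close> times Lebesgue measure is
  \<open>N\<close> times Lebesgue measure on all of \<open>E\<close>. That \<open>J\<close> vanishes on no open set is a consequence of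
  invariance of domain: \<open>f\<close> is injective near every point with trivial stabilizer, and images of
  critical sets are null (\<open>J_nonzero_dense\<close>).
\<close>

section \<open>Holomorphic functions of several variables\<close>

lemma norm_complex_scale: "norm (s *s v) = cmod s * norm (v :: complex^'n)"
proof -
  have "norm (s *s v) = L2_set (\<lambda>i. cmod s * cmod (v $ i)) UNIV"
    by (simp add: norm_vec_def norm_mult)
  also have "\<dots> = cmod s * norm v"
    by (simp add: norm_vec_def L2_set_right_distrib)
  finally show ?thesis .
qed

lemma scaleR_eq_complex_scale: "c *\<^sub>R (v :: complex^'n) = complex_of_real c *s v"
  by (simp add: vec_eq_iff scaleR_conv_of_real[where 'a = complex])

lemma bounded_linear_complex_scale_left: "bounded_linear (\<lambda>s. s *s (v :: complex^'n))"
  by (rule bounded_linear_intro[where K = "norm v"])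
     (auto simp: vec_eq_iff algebra_simps norm_complex_scale)

lemma bounded_linear_complex_scale_right: "bounded_linear (\<lambda>v. s *s (v :: complex^'n))"
  by (rule bounded_linear_intro[where K = "cmod s"])
     (auto simp: vec_eq_iff algebra_simps norm_complex_scale)

lemma open_line_preimage:
  fixes a v :: "complex^'n"
  assumes "open D"
  shows "open {s. a + s *s v \<in> D}"
proof -
  have "continuous_on UNIV (\<lambda>s. a + s *s v)"
    by (intro continuous_intros linear_continuous_on bounded_linear_complex_scale_left)
  then have "open ((\<lambda>s. a + s *s v) -` D)"
    using assms by (simp add: continuous_on_open_vimage open_vimage)
  then show ?thesis by (simp add: vimage_def)
qed

lemma complex_linear_form:
  fixes L :: "complex^'n \<Rightarrow> complex"
  assumes "linear L" "\<And>c v. L (c *s v) = c * L v"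
  shows "L v = (\<Sum>k\<in>UNIV. L (axis k 1) * v $ k)"
proof -
  have "L v = L (\<Sum>k\<in>UNIV. (v $ k) *s axis k 1)"
    by (simp add: basis_expansion)
  also have "\<dots> = (\<Sum>k\<in>UNIV. L ((v $ k) *s axis k 1))"
    by (simp add: linear_sum[OF assms(1)])
  also have "\<dots> = (\<Sum>k\<in>UNIV. L (axis k 1) * v $ k)"
    by (simp add: assms(2) mult.commute)
  finally show ?thesis .
qed

lemma holomorphic_fun_iff:
  fixes h :: "complex^'n \<Rightarrow> complex"
  assumes "open D"
  shows "holomorphic_fun h D \<longleftrightarrow>
    (\<forall>z\<in>D. \<exists>a :: complex^'n. (h has_derivative (\<lambda>v. \<Sum>k\<in>UNIV. a $ k * v $ k)) (at z))"
    (is "?L \<longleftrightarrow> ?R")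
proof
  assume ?L
  show ?R
  proof
    fix z assume z: "z \<in> D"
    from \<open>?L\<close> z obtain h' where h': "(h has_derivative h') (at z within D)"
      "\<And>c v. h' (c *s v) = c * h' v" unfolding holomorphic_fun_def by blast
    have "(h has_derivative h') (at z)" using h'(1) unfolding at_within_open[OF z assms] .
    define a :: "complex^'n" where "a = (\<chi> k. h' (axis k 1))"
    have "h' v = (\<Sum>k\<in>UNIV. a $ k * v $ k)" for v
      unfolding a_def vec_lambda_beta
      by (rule complex_linear_form[OF has_derivative_linear[OF h'(1)] h'(2)])
    then have "h' = (\<lambda>v. \<Sum>k\<in>UNIV. a $ k * v $ k)" by (rule ext)
    with \<open>(h has_derivative h') (at z)\<close>
    have "(h has_derivative (\<lambda>v. \<Sum>k\<in>UNIV. a $ k * v $ k)) (at z)"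
      by simp
    then show "\<exists>a :: complex^'n. (h has_derivative (\<lambda>v. \<Sum>k\<in>UNIV. a $ k * v $ k)) (at z)" ..
  qed
next
  assume ?R
  show ?L unfolding holomorphic_fun_def
  proof
    fix z assume "z \<in> D"
    with \<open>?R\<close> obtain a :: "complex^'n" where
      a: "(h has_derivative (\<lambda>v. \<Sum>k\<in>UNIV. a $ k * v $ k)) (at z)" by blast
    show "\<exists>h'. (h has_derivative h') (at z within D) \<and> (\<forall>c v. h' (c *s v) = c * h' v)"
      by (rule exI[where x = "\<lambda>v. \<Sum>k\<in>UNIV. a $ k * v $ k"])
         (use a has_derivative_at_withinI in \<open>auto simp: sum_distrib_left mult_ac\<close>)
  qed
qed

lemma holomorphic_funI:
  fixes h :: "complex^'n \<Rightarrow> complex"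
  assumes "\<And>z. z \<in> D \<Longrightarrow> (h has_derivative h' z) (at z)"
    and "\<And>z c v. z \<in> D \<Longrightarrow> h' z (c *s v) = c * h' z v"
  shows "holomorphic_fun h D"
  unfolding holomorphic_fun_def using assms has_derivative_at_withinI by blast

lemma holomorphic_fun_subset:
  "holomorphic_fun h D \<Longrightarrow> D' \<subseteq> D \<Longrightarrow> holomorphic_fun h D'"
  unfolding holomorphic_fun_def by (meson has_derivative_subset in_mono)

lemma holomorphic_fun_imp_continuous_on:
  "holomorphic_fun h D \<Longrightarrow> continuous_on D h"
  unfolding holomorphic_fun_def by (meson continuous_on_eq_continuous_within has_derivative_continuous)

definition dderiv :: "complex^'n \<Rightarrow> (complex^'n \<Rightarrow> complex) \<Rightarrow> complex^'n \<Rightarrow> complex"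
  where "dderiv v h z = deriv (\<lambda>t. h (z + t *s v)) 0"

lemma has_derivative_line:
  fixes h :: "complex^'n \<Rightarrow> complex"
  assumes "(h has_derivative h') (at (a + s *s v))" "\<And>c. h' (c *s v) = c * h' v"
  shows "((\<lambda>s. h (a + s *s v)) has_field_derivative h' v) (at s)"
proof -
  have 1: "((\<lambda>s. a + s *s v) has_derivative (\<lambda>s. s *s v)) (at s)"
    by (rule derivative_eq_intros bounded_linear_imp_has_derivative
          bounded_linear_complex_scale_left refl)+ simp
  have "(h \<circ> (\<lambda>s. a + s *s v) has_derivative h' \<circ> (\<lambda>s. s *s v)) (at s)"
    by (rule diff_chain_at[OF 1 assms(1)])
  moreover have "h' \<circ> (\<lambda>s. s *s v) = (*) (h' v)"
    using assms(2) by (auto simp: fun_eq_iff mult.commute)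
  ultimately show ?thesis
    by (simp add: has_field_derivative_def o_def)
qed

lemma holomorphic_fun_has_derivative:
  fixes h :: "complex^'n \<Rightarrow> complex"
  assumes "holomorphic_fun h D" "open D" "z \<in> D"
  shows "(h has_derivative (\<lambda>v. dderiv v h z)) (at z)"
proof -
  obtain a :: "complex^'n" where a: "(h has_derivative (\<lambda>v. \<Sum>k\<in>UNIV. a $ k * v $ k)) (at z)"
    using assms holomorphic_fun_iff by blast
  have "dderiv v h z = (\<Sum>k\<in>UNIV. a $ k * v $ k)" for v
  proof -
    have "((\<lambda>s. h (z + s *s v)) has_field_derivative (\<Sum>k\<in>UNIV. a $ k * v $ k)) (at 0)"
      by (rule has_derivative_line[where h' = "\<lambda>v. \<Sum>j\<in>UNIV. a $ j * v $ j"])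
         (use a in \<open>auto simp: sum_distrib_left mult_ac\<close>)
    then show ?thesis by (simp add: dderiv_def DERIV_imp_deriv)
  qed
  with a show ?thesis by simp
qed

lemma dderiv_scale_of_line:
  assumes "(\<lambda>s. h (z + s *s v)) field_differentiable at 0"
  shows "dderiv (c *s v) h z = c * dderiv v h z"
proof -
  have "((\<lambda>s. h (z + s *s v)) has_field_derivative dderiv v h z) (at (c * 0))"
    using assms by (simp add: dderiv_def DERIV_deriv_iff_field_differentiable)
  then have "((\<lambda>s. h (z + (c * s) *s v)) has_field_derivative dderiv v h z * c) (at 0)"
    by (rule DERIV_chain2) (auto intro!: derivative_eq_intros)
  then show ?thesis
    by (simp add: dderiv_def DERIV_imp_deriv vector_smult_assoc mult_ac)
qed

lemma holomorphic_fun_dderiv_scale: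
  fixes h :: "complex^'n \<Rightarrow> complex"
  assumes "holomorphic_fun h D" "open D" "z \<in> D"
  shows "dderiv (c *s v) h z = c * dderiv v h z"
proof -
  obtain h' where h': "(h has_derivative h') (at z)" "\<And>c v. h' (c *s v) = c * h' v"
    using assms unfolding holomorphic_fun_def by (metis at_within_open)
  then have "h' = (\<lambda>v. dderiv v h z)"
    using has_derivative_unique holomorphic_fun_has_derivative[OF assms] by blast
  with h'(2) show ?thesis by metis
qed

lemma dderiv_sum_axis:
  fixes h :: "complex^'n \<Rightarrow> complex"
  assumes "holomorphic_fun h D" "open D" "z \<in> D"
  shows "dderiv v h z = (\<Sum>k\<in>UNIV. dderiv (axis k 1) h z * v $ k)"
  by (rule complex_linear_form[of "\<lambda>v. dderiv v h z"])
     (use has_derivative_linear[OF holomorphic_fun_has_derivative[OF assms]]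
        holomorphic_fun_dderiv_scale[OF assms] in auto)

lemma holomorphic_fun_line_derivative:
  fixes h :: "complex^'n \<Rightarrow> complex"
  assumes "holomorphic_fun h D" "open D" "a + s *s v \<in> D"
  shows "((\<lambda>s. h (a + s *s v)) has_field_derivative dderiv v h (a + s *s v)) (at s)"
  by (rule has_derivative_line[OF holomorphic_fun_has_derivative[OF assms]])
     (rule holomorphic_fun_dderiv_scale[OF assms])

lemma holomorphic_fun_on_line:
  fixes h :: "complex^'n \<Rightarrow> complex"
  assumes "holomorphic_fun h D" "open D"
  shows "(\<lambda>s. h (a + s *s v)) holomorphic_on {s. a + s *s v \<in> D}"
proof (rule holomorphic_on_open[THEN iffD2, OF open_line_preimage[OF assms(2)]], intro ballI)
  fix s assume "s \<in> {s. a + s *s v \<in> D}"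
  then show "\<exists>f'. ((\<lambda>s. h (a + s *s v)) has_field_derivative f') (at s)"
    using holomorphic_fun_line_derivative[OF assms, of a s v] by auto
qed

text \<open>
  Cauchy's inequality on discs of radius \<open>R / 2\<close> bounds the second derivative by \<open>8 * M / R^2\<close> on
  the disc of radius \<open>R / 2\<close>, and Taylor's formula applies.
\<close>

lemma holomorphic_quadratic_remainder:
  fixes g :: "complex \<Rightarrow> complex"
  assumes hol: "g holomorphic_on U" "open U" "cball 0 R \<subseteq> U" and R: "R > 0"
    and M: "\<And>s. cmod s \<le> R \<Longrightarrow> cmod (g s) \<le> M" and s: "cmod s \<le> R / 2"
  shows "cmod (g s - g 0 - s * deriv g 0) \<le> 8 * M / R^2 * (cmod s)^2"
proof -
  have U: "x \<in> U" if "x \<in> cball 0 (R/2)" for x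
    using that hol(3) R by (auto simp: subset_eq dist_norm)
  have d0: "(g has_field_derivative deriv g x) (at x)" if "x \<in> cball 0 (R/2)" for x
    by (rule holomorphic_derivI[OF hol(1,2) U[OF that]])
  have d1: "(deriv g has_field_derivative deriv (deriv g) x) (at x)" if "x \<in> cball 0 (R/2)" for x
    by (rule holomorphic_derivI[OF holomorphic_deriv[OF hol(1,2)] hol(2) U[OF that]])
  define f where "f i = (if i = (0::nat) then g else if i = 1 then deriv g else deriv (deriv g))" for i
  have "cmod (f 0 s - (\<Sum>i\<le>1. f i 0 * (s - 0) ^ i / fact i)) \<le> (8 * M / R^2) * cmod (s - 0) ^ Suc 1 / fact 1"
  proof (rule complex_Taylor)
    show "convex (cball (0::complex) (R/2))" by simp
    show "(f i has_field_derivative f (Suc i) x) (at x within cball 0 (R/2))"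
      if "x \<in> cball 0 (R/2)" "i \<le> 1" for i x
    proof -
      have "i = 0 \<or> i = 1" using that by auto
      then show ?thesis
        using d0[OF that(1)] d1[OF that(1)] by (auto simp: f_def intro: has_field_derivative_at_within)
    qed
    show "cmod (f (Suc 1) x) \<le> 8 * M / R^2" if "x \<in> cball 0 (R/2)" for x
    proof -
      have sub: "cball x (R/2) \<subseteq> cball 0 R"
      proof
        fix y assume "y \<in> cball x (R/2)"
        then have "norm (y - x) \<le> R / 2" "norm x \<le> R / 2" using that by (auto simp: dist_norm norm_minus_commute)
        then have "norm y \<le> R" using norm_triangle_ineq[of "y - x" x] by simp
        then show "y \<in> cball 0 R" by simp
      qed
      have "norm ((deriv ^^ 2) g x) \<le> fact 2 * M / (R/2)^2"
      proof (rule Cauchy_inequality)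
        show "g holomorphic_on ball x (R/2)"
          using hol sub ball_subset_cball by (meson holomorphic_on_subset subset_trans)
        show "continuous_on (cball x (R/2)) g"
          using hol sub by (meson holomorphic_on_imp_continuous_on holomorphic_on_subset subset_trans)
        fix y assume "norm (x - y) = R / 2"
        then have "y \<in> cball x (R/2)" by (simp add: dist_norm)
        then show "norm (g y) \<le> M" using sub M by (auto simp: subset_eq)
      qed (use R in auto)
      then show ?thesis
        using R by (simp add: f_def eval_nat_numeral field_simps power2_eq_square)
    qed
  qed (use s R in auto)
  moreover have "f 0 s - (\<Sum>i\<le>1. f i 0 * (s - 0) ^ i / fact i) = g s - g 0 - s * deriv g 0"
    by (simp add: f_def algebra_simps)
  ultimately show ?thesis by (simp add: power2_eq_square)
qed

text \<open>
  On the complex line through \<open>y\<close> in direction \<open>w\<close>, the function is bounded on a disc of radius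
  \<open>2 * r / norm w\<close>. The one-variable remainder at parameter \<open>1\<close> is therefore quadratic in \<open>norm w\<close>,
  uniformly in the direction of \<open>w\<close> and in the base point. This uniformity is what turns
  holomorphy on lines into Frechet differentiability.
\<close>

lemma line_holomorphic_remainder:
  fixes h :: "complex^'n \<Rightarrow> complex"
  assumes D: "open D" and lines: "\<And>a v. (\<lambda>s. h (a + s *s v)) holomorphic_on {s. a + s *s v \<in> D}"
    and r: "r > 0" "cball z (3 * r) \<subseteq> D" and M: "\<And>x. x \<in> cball z (3 * r) \<Longrightarrow> cmod (h x) \<le> M"
    and y: "y \<in> cball z r" and w: "norm w \<le> r"
  shows "cmod (h (y + w) - h y - dderiv w h y) \<le> 2 * M / r^2 * (norm w)^2"
proof (cases "w = 0")
  case True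
  then show ?thesis by (simp add: dderiv_def)
next
  case False
  define R where "R = 2 * r / norm w"
  have inb: "y + s *s w \<in> cball z (3 * r)" if "cmod s \<le> R" for s
  proof -
    have "norm (s *s w) \<le> 2 * r"
      using that False by (simp add: norm_complex_scale R_def field_simps)
    moreover have "norm (y - z) \<le> r" using y by (simp add: dist_norm norm_minus_commute)
    ultimately have "norm ((y - z) + s *s w) \<le> 3 * r"
      using norm_triangle_ineq[of "y - z" "s *s w"] by linarith
    then show ?thesis by (simp add: dist_norm norm_minus_commute algebra_simps)
  qed
  have "cmod (h (y + 1 *s w) - h (y + 0 *s w) - 1 * deriv (\<lambda>s. h (y + s *s w)) 0) \<le> 8 * M / R^2 * (cmod 1)^2"
  proof (rule holomorphic_quadratic_remainder[OF lines open_line_preimage[OF D]])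
    show "cball 0 R \<subseteq> {s. y + s *s w \<in> D}" using inb r by auto
    show "cmod (h (y + s *s w)) \<le> M" if "cmod s \<le> R" for s using inb[OF that] M by blast
    show "R > 0" "cmod 1 \<le> R / 2" using r w False by (auto simp: R_def field_simps)
  qed
  also have "8 * M / R^2 * (cmod 1)^2 = 2 * M / r^2 * (norm w)^2"
    using False r by (simp add: R_def field_simps power2_eq_square)
  finally show ?thesis by (simp add: dderiv_def)
qed

lemma bounded_on_small_cball:
  fixes h :: "complex^'n \<Rightarrow> complex"
  assumes "open D" "continuous_on D h" "z \<in> D"
  obtains r M where "r > 0" "cball z (3 * r) \<subseteq> D" "M \<ge> 0" "\<And>x. x \<in> cball z (3 * r) \<Longrightarrow> cmod (h x) \<le> M"
proof -
  obtain e where e: "e > 0" "cball z e \<subseteq> D" using assms open_contains_cball by blast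
  have "compact (h ` cball z e)"
    using assms e by (intro compact_continuous_image) (auto intro: continuous_on_subset)
  then obtain M where M: "M > 0" "\<And>x. x \<in> cball z e \<Longrightarrow> cmod (h x) \<le> M"
    by (metis bounded_pos compact_imp_bounded image_eqI)
  show ?thesis by (rule that[of "e/3" M]) (use e M in auto)
qed

text \<open>
  Serves twice: it makes directional derivatives continuous, and it exhibits them as locally
  uniform limits of holomorphic functions.
\<close>

lemma dderiv_uniform_difference_quotient:
  fixes h :: "complex^'n \<Rightarrow> complex"
  assumes D: "open D" and cont: "continuous_on D h"
    and lines: "\<And>a v. (\<lambda>s. h (a + s *s v)) holomorphic_on {s. a + s *s v \<in> D}" and z: "z \<in> D"
  obtains r t where "r > 0" "cball z (3 * r) \<subseteq> D" "\<And>n::nat. t n \<noteq> 0" "\<And>n. norm (t n *s v) \<le> r" "t \<longlonglongrightarrow> 0"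
    "uniform_limit (cball z r) (\<lambda>n y. (h (y + t n *s v) - h y) / t n) (dderiv v h) sequentially"
proof -
  obtain r M where r: "r > 0" "cball z (3 * r) \<subseteq> D" "M \<ge> 0"
    and M: "\<And>x. x \<in> cball z (3 * r) \<Longrightarrow> cmod (h x) \<le> M"
    using bounded_on_small_cball[OF D cont z] by blast
  define \<rho> where "\<rho> = r / (1 + norm v)"
  have \<rho>: "\<rho> > 0" "\<rho> * norm v \<le> r" using r by (auto simp: \<rho>_def field_simps add_pos_nonneg)
  define t :: "nat \<Rightarrow> complex" where "t n = of_real (\<rho> / (real n + 1))" for n
  have tn: "cmod (t n) = \<rho> / (real n + 1)" for n
    unfolding t_def norm_of_real using \<rho> by simp
  have tr: "norm (t n *s v) \<le> r" for n
  proof -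
    have "norm (t n *s v) \<le> \<rho> * norm v"
      unfolding norm_complex_scale tn using \<rho> by (intro mult_right_mono) (auto simp: field_simps)
    with \<rho> show ?thesis by simp
  qed
  have t0: "t n \<noteq> 0" for n
    using tn[of n] \<rho> by (metis add_pos_nonneg divide_pos_pos less_irrefl norm_zero of_nat_0_le_iff add.commute zero_less_one)
  have "(\<lambda>n. \<rho> / (real n + 1)) \<longlonglongrightarrow> 0" by real_asymp
  from tendsto_of_real[OF this, where 'a = complex] have tl: "t \<longlonglongrightarrow> 0" unfolding t_def by simp
  define C where "C = 2 * M / r^2 * (norm v)^2"
  have bound: "cmod ((h (y + t n *s v) - h y) / t n - dderiv v h y) \<le> C * cmod (t n)"
    if y: "y \<in> cball z r" for y n
  proof -
    have "y \<in> cball z (3 * r)" using y r by auto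
    then have yD: "y \<in> D" using r by blast
    have "(\<lambda>s. h (y + s *s v)) field_differentiable at 0"
      using lines[of y v] open_line_preimage[OF D, of y v] yD
      by (auto intro!: holomorphic_on_imp_differentiable_at)
    from dderiv_scale_of_line[OF this] have sc: "dderiv (t n *s v) h y = t n * dderiv v h y" .
    have "(h (y + t n *s v) - h y) / t n - dderiv v h y
        = (h (y + t n *s v) - h y - dderiv (t n *s v) h y) / t n"
      using t0 by (simp add: sc field_simps)
    also have "cmod \<dots> \<le> (2 * M / r^2 * (norm (t n *s v))^2) / cmod (t n)"
      unfolding norm_divide
      by (intro divide_right_mono line_holomorphic_remainder[OF D lines r(1,2) M y tr]) auto
    also have "\<dots> = C * cmod (t n)"
      using t0[of n] by (simp add: C_def norm_complex_scale power2_eq_square)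
    finally show ?thesis .
  qed
  have lim: "uniform_limit (cball z r) (\<lambda>n y. (h (y + t n *s v) - h y) / t n) (dderiv v h) sequentially"
  proof (rule uniform_limitI)
    fix e :: real assume "e > 0"
    have "(\<lambda>n. C * cmod (t n)) \<longlonglongrightarrow> C * cmod 0" by (intro tendsto_intros tl)
    then have "\<forall>\<^sub>F n in sequentially. C * cmod (t n) < e"
      using \<open>e > 0\<close> by (auto elim: order_tendstoD)
    then show "\<forall>\<^sub>F n in sequentially. \<forall>y\<in>cball z r. dist ((h (y + t n *s v) - h y) / t n) (dderiv v h y) < e"
    proof eventually_elim
      case (elim n)
      show ?case
      proof
        fix y assume "y \<in> cball z r"
        from bound[OF this, of n] elim
        show "dist ((h (y + t n *s v) - h y) / t n) (dderiv v h y) < e" by (simp add: dist_norm)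
      qed
    qed
  qed
  show ?thesis by (rule that[OF r(1,2) t0 tr tl lim])
qed

lemma line_holomorphic_imp_continuous_dderiv:
  fixes h :: "complex^'n \<Rightarrow> complex"
  assumes D: "open D" and cont: "continuous_on D h"
    and lines: "\<And>a v. (\<lambda>s. h (a + s *s v)) holomorphic_on {s. a + s *s v \<in> D}" and z: "z \<in> D"
  shows "isCont (dderiv v h) z"
proof -
  obtain r t where r: "r > 0" "cball z (3 * r) \<subseteq> D" and "\<And>n::nat. t n \<noteq> 0"
    and tr: "\<And>n. norm (t n *s v) \<le> r" and "t \<longlonglongrightarrow> 0"
    and lim: "uniform_limit (cball z r) (\<lambda>n y. (h (y + t n *s v) - h y) / t n) (dderiv v h) sequentially"
    by (rule dderiv_uniform_difference_quotient[OF assms, of v]) (rule that)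
  have "continuous_on (cball z r) (dderiv v h)"
  proof (rule uniform_limit_theorem[OF _ lim])
    have 1: "y + t n *s v \<in> D" if "y \<in> cball z r" for n y
    proof -
      have "norm ((y - z) + t n *s v) \<le> r + r"
        using that tr[of n] norm_triangle_ineq[of "y - z" "t n *s v"]
        by (simp add: dist_norm norm_minus_commute)
      then have "y + t n *s v \<in> cball z (3 * r)"
        using r by (simp add: dist_norm norm_minus_commute algebra_simps)
      with r show ?thesis by blast
    qed
    have "cball z r \<subseteq> cball z (3 * r)" using r by (intro subset_cball) simp
    then have 2: "cball z r \<subseteq> D" using r(2) by (rule subset_trans)
    show "\<forall>\<^sub>F n in sequentially. continuous_on (cball z r) (\<lambda>y. (h (y + t n *s v) - h y) / t n)"
    proof (rule always_eventually, rule allI)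
      fix n
      have "continuous_on (cball z r) (\<lambda>y. h (y + t n *s v))"
        by (rule continuous_on_compose2[OF cont]) (use 1 in \<open>auto intro!: continuous_intros\<close>)
      moreover have "continuous_on (cball z r) h" using cont 2 continuous_on_subset by blast
      ultimately show "continuous_on (cball z r) (\<lambda>y. (h (y + t n *s v) - h y) / t n)"
        unfolding divide_inverse by (intro continuous_intros)
    qed
  qed simp
  moreover have "z \<in> interior (cball z r)" using r(1) by simp
  ultimately show ?thesis by (rule continuous_on_interior)
qed

text \<open>
  A form of Osgood's lemma. The derivative along lines is homogeneous by the chain rule. It is
  additive because the increment by \<open>s *s (v + w)\<close> splits into one by \<open>s *s v\<close> and one by \<open>s *s w\<close>
  starting at \<open>z + s *s v\<close>, and the derivative in direction \<open>w\<close> is continuous there. The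
  remainder estimate on lines then is the Frechet condition.
\<close>

lemma holomorphic_fun_if_lines:
  fixes h :: "complex^'n \<Rightarrow> complex"
  assumes D: "open D" and cont: "continuous_on D h"
    and diff: "\<And>z v. z \<in> D \<Longrightarrow> (\<lambda>s. h (z + s *s v)) field_differentiable at 0"
  shows "holomorphic_fun h D"
proof -
  have lines: "(\<lambda>s. h (a + s *s v)) holomorphic_on {s. a + s *s v \<in> D}" for a v
    unfolding holomorphic_on_def
  proof
    fix s assume "s \<in> {s. a + s *s v \<in> D}"
    then have "(\<lambda>t. h ((a + s *s v) + t *s v)) field_differentiable at 0" by (intro diff) simp
    then obtain d where "((\<lambda>t. h ((a + s *s v) + t *s v)) has_field_derivative d) (at (s - s))"
      by (auto simp: field_differentiable_def)
    then have "((\<lambda>x. h ((a + s *s v) + (x - s) *s v)) has_field_derivative d * 1) (at s)"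
      by (rule DERIV_chain2) (auto intro!: derivative_eq_intros)
    then have "((\<lambda>x. h (a + x *s v)) has_field_derivative d) (at s)"
      by (simp add: vector_sub_rdistrib)
    then show "(\<lambda>s. h (a + s *s v)) field_differentiable at s within {s. a + s *s v \<in> D}"
      using field_differentiable_at_within field_differentiable_def by blast
  qed
  show ?thesis
  proof (rule holomorphic_funI)
    fix z assume z: "z \<in> D"
    show hom: "dderiv (c *s v) h z = c * dderiv v h z" for c v
      by (rule dderiv_scale_of_line[OF diff[OF z]])
    obtain r M where r: "r > 0" "cball z (3 * r) \<subseteq> D" "M \<ge> 0"
      and M: "\<And>x. x \<in> cball z (3 * r) \<Longrightarrow> cmod (h x) \<le> M"
      using bounded_on_small_cball[OF D cont z] by blast
    have rem: "cmod (h (y + w) - h y - dderiv w h y) \<le> 2 * M / r^2 * (norm w)^2"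
      if "y \<in> cball z r" "norm w \<le> r" for y w
      by (rule line_holomorphic_remainder[OF D lines r(1,2) _ that]) (rule M)
    have add: "dderiv (v + w) h z = dderiv v h z + dderiv w h z" for v w
    proof -
      have derl: "((\<lambda>s. (h (z + s *s u) - h z) / s) \<longlongrightarrow> dderiv u h z) (at 0)" for u
        using diff[OF z, of u] unfolding dderiv_def
        by (simp add: DERIV_deriv_iff_field_differentiable[symmetric] has_field_derivative_iff)
      have ev: "\<forall>\<^sub>F s in at 0. norm (s *s u) < r" for u :: "complex^'n"
      proof -
        have "((\<lambda>s. norm (s *s u)) \<longlongrightarrow> norm (0 *s u)) (at 0)"
          by (intro tendsto_norm bounded_linear.tendsto[OF bounded_linear_complex_scale_left] tendsto_ident_at)
        then show ?thesis using r(1) by (auto elim: order_tendstoD)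
      qed
      have mid: "((\<lambda>s. (h (z + s *s v + s *s w) - h (z + s *s v)) / s - dderiv w h (z + s *s v)) \<longlongrightarrow> 0) (at 0)"
      proof (rule Lim_null_comparison)
        show "((\<lambda>s. (2 * M / r^2 * (norm w)^2) * cmod s) \<longlongrightarrow> 0) (at 0)"
          by (rule tendsto_eq_intros refl)+ simp
        show "\<forall>\<^sub>F s in at 0. norm ((h (z + s *s v + s *s w) - h (z + s *s v)) / s - dderiv w h (z + s *s v))
           \<le> (2 * M / r^2 * (norm w)^2) * cmod s"
          using ev[of v] ev[of w] eventually_neq_at_within[of 0]
        proof eventually_elim
          case (elim s)
          have yr: "z + s *s v \<in> cball z r" using elim by (simp add: dist_norm)
          then have yD: "z + s *s v \<in> D" using r by auto
          have sc: "dderiv (s *s w) h (z + s *s v) = s * dderiv w h (z + s *s v)"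
            by (rule dderiv_scale_of_line[OF diff[OF yD]])
          have "(h (z + s *s v + s *s w) - h (z + s *s v)) / s - dderiv w h (z + s *s v)
            = (h (z + s *s v + s *s w) - h (z + s *s v) - dderiv (s *s w) h (z + s *s v)) / s"
            using elim by (simp add: sc field_simps)
          also have "cmod \<dots> \<le> (2 * M / r^2 * (norm (s *s w))^2) / cmod s"
            unfolding norm_divide using elim
            by (intro divide_right_mono rem[OF yr]) auto
          also have "\<dots> = (2 * M / r^2 * (norm w)^2) * cmod s"
            using elim by (simp add: norm_complex_scale power2_eq_square)
          finally show ?case .
        qed
      qed
      have zl: "((\<lambda>s. z + s *s v) \<longlongrightarrow> z) (at 0)"
        using tendsto_add[OF tendsto_const bounded_linear.tendsto[OF bounded_linear_complex_scale_left tendsto_ident_at], of z v 0 UNIV]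
        by simp
      have cw: "((\<lambda>s. dderiv w h (z + s *s v)) \<longlongrightarrow> dderiv w h z) (at 0)"
        by (rule isCont_tendsto_compose[OF line_holomorphic_imp_continuous_dderiv[OF D cont lines z] zl])
      have "((\<lambda>s. ((h (z + s *s v + s *s w) - h (z + s *s v)) / s - dderiv w h (z + s *s v))
            + dderiv w h (z + s *s v) + (h (z + s *s v) - h z) / s) \<longlongrightarrow> 0 + dderiv w h z + dderiv v h z) (at 0)"
        by (intro tendsto_add mid cw derl)
      moreover have "(\<lambda>s. ((h (z + s *s v + s *s w) - h (z + s *s v)) / s - dderiv w h (z + s *s v))
            + dderiv w h (z + s *s v) + (h (z + s *s v) - h z) / s) = (\<lambda>s. (h (z + s *s (v + w)) - h z) / s)"
        by (simp add: fun_eq_iff diff_divide_distrib vector_add_ldistrib add.assoc)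
      ultimately have "((\<lambda>s. (h (z + s *s (v + w)) - h z) / s) \<longlongrightarrow> dderiv w h z + dderiv v h z) (at 0)"
        by simp
      from tendsto_unique[OF _ derl this] show ?thesis by simp
    qed
    have lin: "linear (\<lambda>v. dderiv v h z)"
    proof (rule linearI)
      fix c :: real and v
      show "dderiv (c *\<^sub>R v) h z = c *\<^sub>R dderiv v h z"
        unfolding scaleR_eq_complex_scale hom by (simp add: scaleR_conv_of_real)
    qed (rule add)
    show "(h has_derivative (\<lambda>v. dderiv v h z)) (at z)"
      unfolding has_derivative_at
    proof
      show "bounded_linear (\<lambda>v. dderiv v h z)" using lin by (simp add: linear_conv_bounded_linear)
      show "((\<lambda>w. norm (h (z + w) - h z - dderiv w h z) / norm w) \<longlongrightarrow> 0) (at 0)"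
      proof (rule Lim_null_comparison)
        show "((\<lambda>w :: complex^'n. 2 * M / r^2 * norm w) \<longlongrightarrow> 0) (at 0)"
          by (rule tendsto_eq_intros refl)+ simp
        have "\<forall>\<^sub>F w :: complex^'n in at 0. norm w < r"
          using order_tendstoD(2)[OF tendsto_norm[OF tendsto_ident_at], of "0 :: complex^'n" r UNIV] r(1) by simp
        then show "\<forall>\<^sub>F w in at 0. norm (norm (h (z + w) - h z - dderiv w h z) / norm w) \<le> 2 * M / r^2 * norm w"
          using eventually_neq_at_within[of 0]
        proof eventually_elim
          case (elim w)
          have "norm (h (z + w) - h z - dderiv w h z) / norm w \<le> (2 * M / r^2 * (norm w)^2) / norm w"
            using elim r by (intro divide_right_mono rem) auto
          then show ?case using elim by (simp add: power2_eq_square)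
        qed
      qed
    qed
  qed
qed

subsection \<open>Closure properties\<close>

lemma holomorphic_fun_local:
  fixes h :: "complex^'n \<Rightarrow> complex"
  assumes "\<And>z. z \<in> D \<Longrightarrow> \<exists>r>0. holomorphic_fun h (ball z r)"
  shows "holomorphic_fun h D"
proof (rule holomorphic_funI)
  fix z assume "z \<in> D"
  then obtain r where r: "r > 0" "holomorphic_fun h (ball z r)" using assms by blast
  then show "(h has_derivative (\<lambda>v. dderiv v h z)) (at z)"
    using holomorphic_fun_has_derivative[of h "ball z r" z] by simp
  show "dderiv (c *s v) h z = c * dderiv v h z" for c v
    using holomorphic_fun_dderiv_scale[of h "ball z r" z] r by simp
qed

lemma holomorphic_fun_cong:
  assumes "holomorphic_fun h D" "\<And>z. z \<in> D \<Longrightarrow> h z = g z"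
  shows "holomorphic_fun g D"
  unfolding holomorphic_fun_def
proof
  fix z assume z: "z \<in> D"
  then obtain h' where "(h has_derivative h') (at z within D)" "\<forall>c v. h' (c *s v) = c * h' v"
    using assms(1) unfolding holomorphic_fun_def by blast
  then show "\<exists>h'. (g has_derivative h') (at z within D) \<and> (\<forall>c v. h' (c *s v) = c * h' v)"
    using has_derivative_transform[OF z, of g h h'] assms(2) by metis
qed

lemma holomorphic_fun_const: "holomorphic_fun (\<lambda>z. c) D"
  unfolding holomorphic_fun_def by (intro ballI exI[of _ "\<lambda>v. 0"]) simp

lemma holomorphic_fun_add:
  assumes "holomorphic_fun g D" "holomorphic_fun h D"
  shows "holomorphic_fun (\<lambda>z. g z + h z) D"
  unfolding holomorphic_fun_def
proof
  fix z assume "z \<in> D"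
  with assms obtain g' h' where
    g: "(g has_derivative g') (at z within D)" "\<And>c v. g' (c *s v) = c * g' v" and
    h: "(h has_derivative h') (at z within D)" "\<And>c v. h' (c *s v) = c * h' v"
    unfolding holomorphic_fun_def by metis
  show "\<exists>h'. ((\<lambda>z. g z + h z) has_derivative h') (at z within D) \<and> (\<forall>c v. h' (c *s v) = c * h' v)"
    by (intro exI[of _ "\<lambda>v. g' v + h' v"] conjI has_derivative_add g h) (simp add: g h algebra_simps)
qed

lemma holomorphic_fun_mult:
  assumes "holomorphic_fun g D" "holomorphic_fun h D"
  shows "holomorphic_fun (\<lambda>z. g z * h z) D"
  unfolding holomorphic_fun_def
proof
  fix z assume "z \<in> D"
  with assms obtain g' h' where
    g: "(g has_derivative g') (at z within D)" "\<And>c v. g' (c *s v) = c * g' v" and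
    h: "(h has_derivative h') (at z within D)" "\<And>c v. h' (c *s v) = c * h' v"
    unfolding holomorphic_fun_def by metis
  show "\<exists>h'. ((\<lambda>z. g z * h z) has_derivative h') (at z within D) \<and> (\<forall>c v. h' (c *s v) = c * h' v)"
    by (intro exI[of _ "\<lambda>v. g z * h' v + g' v * h z"] conjI has_derivative_mult g h) (simp add: g h algebra_simps)
qed

lemma holomorphic_fun_cmult: "holomorphic_fun h D \<Longrightarrow> holomorphic_fun (\<lambda>z. c * h z) D"
  using holomorphic_fun_mult[OF holomorphic_fun_const] .

lemma holomorphic_fun_diff:
  "holomorphic_fun g D \<Longrightarrow> holomorphic_fun h D \<Longrightarrow> holomorphic_fun (\<lambda>z. g z - h z) D"
  using holomorphic_fun_add[OF _ holomorphic_fun_cmult[of h D "-1"], of g] by simp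

lemma holomorphic_fun_sum:
  "(\<And>i. i \<in> I \<Longrightarrow> holomorphic_fun (h i) D) \<Longrightarrow> holomorphic_fun (\<lambda>z. \<Sum>i\<in>I. h i z) D"
  by (induction I rule: infinite_finite_induct) (auto intro: holomorphic_fun_const holomorphic_fun_add)

lemma holomorphic_fun_prod:
  "(\<And>i. i \<in> I \<Longrightarrow> holomorphic_fun (h i) D) \<Longrightarrow> holomorphic_fun (\<lambda>z. \<Prod>i\<in>I. h i z) D"
  by (induction I rule: infinite_finite_induct) (auto intro: holomorphic_fun_const holomorphic_fun_mult)

lemma has_derivative_vec_componentwise:
  fixes f :: "'a::real_normed_vector \<Rightarrow> complex^'m"
  assumes "\<And>i. ((\<lambda>x. f x $ i) has_derivative (\<lambda>v. f' v $ i)) (at x within S)"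
  shows "(f has_derivative f') (at x within S)"
proof (subst has_derivative_componentwise_within, rule ballI)
  fix b :: "complex^'m" assume "b \<in> Basis"
  then obtain i u where b: "b = axis i u" by (auto simp: Basis_vec_def)
  show "((\<lambda>x. f x \<bullet> b) has_derivative (\<lambda>x. f' x \<bullet> b)) (at x within S)"
    unfolding b inner_axis
    by (rule has_derivative_inner_left[OF assms])
qed

definition jacobian :: "(complex^'n \<Rightarrow> complex^'m) \<Rightarrow> complex^'n \<Rightarrow> complex^'n^'m"
  where "jacobian f z = (\<chi> i j. dderiv (axis j 1) (\<lambda>x. f x $ i) z)"

lemma jacobian_det_eq: "jacobian_det f z = det (jacobian f z)"
  by (simp add: jacobian_det_def jacobian_def dderiv_def)

lemma holomorphic_map_has_derivative:
  assumes "holomorphic_map f D" "open D" "z \<in> D"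
  shows "(f has_derivative (*v) (jacobian f z)) (at z)"
proof (rule has_derivative_vec_componentwise)
  fix i
  have hi: "holomorphic_fun (\<lambda>z. f z $ i) D" using assms(1) by (simp add: holomorphic_map_def)
  have "(\<lambda>v. dderiv v (\<lambda>z. f z $ i) z) = (\<lambda>v. (jacobian f z *v v) $ i)"
    by (rule ext, subst dderiv_sum_axis[OF hi assms(2,3)])
       (simp add: matrix_vector_mult_def jacobian_def)
  then show "((\<lambda>x. f x $ i) has_derivative (\<lambda>v. (jacobian f z *v v) $ i)) (at z)"
    using holomorphic_fun_has_derivative[OF hi assms(2,3)] by simp
qed

lemma holomorphic_mapI:
  assumes "\<And>z. z \<in> D \<Longrightarrow> (f has_derivative (*v) (A z)) (at z)"
  shows "holomorphic_map f D"
  unfolding holomorphic_map_def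
proof
  fix i
  show "holomorphic_fun (\<lambda>z. f z $ i) D"
  proof (rule holomorphic_funI)
    fix z assume "z \<in> D"
    then show "((\<lambda>z. f z $ i) has_derivative (\<lambda>v. (A z *v v) $ i)) (at z)"
      by (intro bounded_linear.has_derivative[OF bounded_linear_vec_nth] assms)
    show "(A z *v (c *s v)) $ i = c * (A z *v v) $ i" for c v
      by (simp add: matrix_vector_mult_def sum_distrib_left mult_ac)
  qed
qed

lemma jacobian_unique:
  assumes "open D" "z \<in> D" "(f has_derivative (*v) A) (at z)" "holomorphic_map f D"
  shows "jacobian f z = A"
proof -
  have "(*v) (jacobian f z) = (*v) A"
    using has_derivative_unique assms(3) holomorphic_map_has_derivative[OF assms(4,1,2)] by blast
  then show ?thesis by (simp add: matrix_eq fun_eq_iff)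
qed

lemma holomorphic_map_imp_continuous_on:
  assumes "holomorphic_map f D" shows "continuous_on D f"
proof -
  have "continuous_on D (\<lambda>x. \<chi> i. f x $ i)"
    using assms by (intro continuous_on_vec_lambda holomorphic_fun_imp_continuous_on)
      (simp add: holomorphic_map_def)
  then show ?thesis by simp
qed

lemma holomorphic_fun_compose:
  fixes h :: "complex^'m \<Rightarrow> complex"
  assumes "holomorphic_fun h E" "holomorphic_map f D" "open D" "open E" "f ` D \<subseteq> E"
  shows "holomorphic_fun (\<lambda>z. h (f z)) D"
proof (rule holomorphic_funI)
  fix z assume z: "z \<in> D"
  then have fz: "f z \<in> E" using assms by auto
  show "((\<lambda>z. h (f z)) has_derivative (\<lambda>v. dderiv (jacobian f z *v v) h (f z))) (at z)"
    using diff_chain_at[OF holomorphic_map_has_derivative[OF assms(2,3) z]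
        holomorphic_fun_has_derivative[OF assms(1,4) fz]]
    by (simp add: o_def)
  show "dderiv (jacobian f z *v (c *s v)) h (f z) = c * dderiv (jacobian f z *v v) h (f z)" for c v
    using holomorphic_fun_dderiv_scale[OF assms(1,4) fz] by (simp add: vec.scale)
qed

subsection \<open>Locally uniform limits, partial derivatives, identity theorem\<close>

text \<open>
  Weierstrass' theorem on each complex line gives holomorphy of the limit on lines and convergence
  of the derivatives; continuity of the limit is the remaining hypothesis of \<open>holomorphic_fun_if_lines\<close>.
\<close>

lemma holomorphic_fun_uniform_limit:
  fixes h :: "complex^'n \<Rightarrow> complex"
  assumes D: "open D" and hol: "\<And>n::nat. holomorphic_fun (fs n) D"
    and lim: "\<And>z. z \<in> D \<Longrightarrow> \<exists>r>0. ball z r \<subseteq> D \<and> uniform_limit (ball z r) fs h sequentially"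
  shows "holomorphic_fun h D"
    and "\<And>z v. z \<in> D \<Longrightarrow> (\<lambda>n. dderiv v (fs n) z) \<longlonglongrightarrow> dderiv v h z"
proof -
  have cont: "continuous_on D h"
  proof -
    have "isCont h z" if z: "z \<in> D" for z
    proof -
      from lim[OF z] obtain r where r: "r > 0" "ball z r \<subseteq> D" "uniform_limit (ball z r) fs h sequentially"
        by blast
      have "continuous_on (ball z r) h"
        by (rule uniform_limit_theorem[OF always_eventually r(3)])
           (simp_all add: continuous_on_subset[OF holomorphic_fun_imp_continuous_on[OF hol] r(2)])
      then show ?thesis using r(1) by (simp add: continuous_on_eq_continuous_at)
    qed
    then show ?thesis by (simp add: continuous_at_imp_continuous_on)
  qed
  have key: "(\<lambda>s. h (z + s *s v)) field_differentiable at 0 \<and> (\<lambda>n. dderiv v (fs n) z) \<longlonglongrightarrow> dderiv v h z"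
    if z: "z \<in> D" for z v
  proof -
    from lim[OF z] obtain r where r: "r > 0" "ball z r \<subseteq> D" and ul: "uniform_limit (ball z r) fs h sequentially"
      by blast
    define \<rho> where "\<rho> = r / (2 * (1 + norm v))"
    have np: "1 + norm v > 0" using norm_ge_zero[of v] by linarith
    have \<rho>: "\<rho> > 0" using r np by (simp add: \<rho>_def)
    have inb: "z + s *s v \<in> ball z r" if "s \<in> cball 0 \<rho>" for s
    proof -
      have "norm (s *s v) \<le> \<rho> * norm v"
        using that unfolding norm_complex_scale by (intro mult_right_mono) auto
      also have "\<dots> \<le> \<rho> * (1 + norm v)" using \<rho> by (intro mult_left_mono) auto
      also have "\<dots> = r / 2" unfolding \<rho>_def using np by (simp add: field_simps)
      finally show ?thesis using r by (simp add: dist_norm)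
    qed
    have der: "((\<lambda>s. fs n (z + s *s v)) has_field_derivative dderiv v (fs n) (z + s *s v)) (at s)"
      if "s \<in> cball 0 \<rho>" for s n
      by (rule holomorphic_fun_line_derivative[OF hol D]) (use inb[OF that] r in blast)
    obtain g' where g': "\<And>w. w \<in> ball 0 \<rho> \<Longrightarrow> ((\<lambda>s. h (z + s *s v)) has_field_derivative g' w) (at w) \<and>
        (\<lambda>n. dderiv v (fs n) (z + w *s v)) \<longlonglongrightarrow> g' w"
    proof (rule has_complex_derivative_uniform_limit[where z = 0 and r = \<rho> and F = sequentially
          and f = "\<lambda>n s. fs n (z + s *s v)" and g = "\<lambda>s. h (z + s *s v)"
          and f' = "\<lambda>n s. dderiv v (fs n) (z + s *s v)"])
      show "\<forall>\<^sub>F n in sequentially. continuous_on (cball 0 \<rho>) (\<lambda>s. fs n (z + s *s v)) \<and>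
          (\<forall>w\<in>ball 0 \<rho>. ((\<lambda>s. fs n (z + s *s v)) has_field_derivative dderiv v (fs n) (z + w *s v)) (at w))"
      proof (rule always_eventually, intro allI conjI ballI)
        fix n
        show "continuous_on (cball 0 \<rho>) (\<lambda>s. fs n (z + s *s v))"
          by (rule continuous_at_imp_continuous_on) (use DERIV_isCont[OF der] in blast)
        show "((\<lambda>s. fs n (z + s *s v)) has_field_derivative dderiv v (fs n) (z + w *s v)) (at w)"
          if "w \<in> ball 0 \<rho>" for w using der[of w n] that by simp
      qed
      show "uniform_limit (cball 0 \<rho>) (\<lambda>n s. fs n (z + s *s v)) (\<lambda>s. h (z + s *s v)) sequentially"
        by (rule uniform_limit_compose'[OF ul]) (use inb in auto)
    qed (use \<rho> in auto)
    have "((\<lambda>s. h (z + s *s v)) has_field_derivative g' 0) (at 0)" "(\<lambda>n. dderiv v (fs n) z) \<longlonglongrightarrow> g' 0"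
      using g'[of 0] \<rho> by auto
    moreover from this(1) have "g' 0 = dderiv v h z" by (simp add: dderiv_def DERIV_imp_deriv)
    ultimately show ?thesis by (auto simp: field_differentiable_def)
  qed
  show "holomorphic_fun h D"
    by (rule holomorphic_fun_if_lines[OF D cont]) (use key in blast)
  show "\<And>z v. z \<in> D \<Longrightarrow> (\<lambda>n. dderiv v (fs n) z) \<longlonglongrightarrow> dderiv v h z" using key by blast
qed

lemma holomorphic_fun_translate:
  assumes "holomorphic_fun h D" "open D" "open U" "\<And>z. z \<in> U \<Longrightarrow> z + a \<in> D"
  shows "holomorphic_fun (\<lambda>z. h (z + a)) U"
proof (rule holomorphic_fun_compose[OF assms(1) _ assms(3,2)])
  show "holomorphic_map (\<lambda>z. z + a) U"
    by (rule holomorphic_mapI[where A = "\<lambda>z. mat 1"]) (auto intro!: derivative_eq_intros)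
qed (use assms in auto)

text \<open>
  The difference quotients in direction \<open>v\<close> are holomorphic and converge locally uniformly to the
  derivative in that direction. Their derivatives in direction \<open>w\<close> converge to
  \<open>dderiv w (dderiv v h)\<close>, but they are also difference quotients of \<open>dderiv w h\<close> in direction \<open>v\<close>.
\<close>

lemma
  fixes h :: "complex^'n \<Rightarrow> complex"
  assumes hol: "holomorphic_fun h D" and D: "open D"
  shows holomorphic_fun_dderiv: "holomorphic_fun (dderiv v h) D"
    and dderiv_commute: "z \<in> D \<Longrightarrow> dderiv w (dderiv v h) z = dderiv v (dderiv w h) z"
proof -
  note cont = holomorphic_fun_imp_continuous_on[OF hol]
  note lines = holomorphic_fun_on_line[OF hol D]
  have key: "\<exists>r>0. \<exists>t. (\<forall>n::nat. t n \<noteq> 0) \<and> t \<longlonglongrightarrow> 0 \<and> holomorphic_fun (dderiv v h) (ball z r) \<and>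
      (\<forall>w. (\<lambda>n. (dderiv w h (z + t n *s v) - dderiv w h z) / t n) \<longlonglongrightarrow> dderiv w (dderiv v h) z)"
    if z: "z \<in> D" for z v
  proof -
    obtain r t where r: "r > 0" "cball z (3 * r) \<subseteq> D" and t0: "\<And>n::nat. t n \<noteq> 0"
      and tr: "\<And>n. norm (t n *s v) \<le> r" and tl: "t \<longlonglongrightarrow> 0"
      and lim: "uniform_limit (cball z r) (\<lambda>n y. (h (y + t n *s v) - h y) / t n) (dderiv v h) sequentially"
      by (rule dderiv_uniform_difference_quotient[OF D cont lines z, of v]) (rule that)
    have "cball z r \<subseteq> cball z (3 * r)" using r by (intro subset_cball) simp
    then have sub: "ball z r \<subseteq> D" using r(2) ball_subset_cball by blast
    have sh: "y + t n *s v \<in> D" if "y \<in> ball z r" for y n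
    proof -
      have "norm ((y - z) + t n *s v) \<le> r + r"
        using that tr[of n] norm_triangle_ineq[of "y - z" "t n *s v"]
        by (simp add: dist_norm norm_minus_commute)
      then have "y + t n *s v \<in> cball z (3 * r)"
        using r by (simp add: dist_norm norm_minus_commute algebra_simps)
      with r show ?thesis by blast
    qed
    define q where "q n y = (1 / t n) * (h (y + t n *s v) - h y)" for n y
    have holq: "holomorphic_fun (q n) (ball z r)" for n
      unfolding q_def
      by (intro holomorphic_fun_cmult holomorphic_fun_diff holomorphic_fun_translate[OF hol D]
           holomorphic_fun_subset[OF hol sub] open_ball sh)
    have limq: "uniform_limit (cball z r) q (dderiv v h) sequentially"
      using lim by (simp add: q_def[abs_def])
    have locl: "\<exists>r'>0. ball y r' \<subseteq> ball z r \<and> uniform_limit (ball y r') q (dderiv v h) sequentially"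
      if y: "y \<in> ball z r" for y
    proof -
      obtain r' where "r' > 0" "ball y r' \<subseteq> ball z r"
        using open_ball y open_contains_ball by blast
      then show ?thesis using limq ball_subset_cball uniform_limit_on_subset by (metis subset_trans)
    qed
    have hd: "holomorphic_fun (dderiv v h) (ball z r)"
      by (rule holomorphic_fun_uniform_limit(1)[OF open_ball holq locl])
    have "(\<lambda>n. (dderiv w h (z + t n *s v) - dderiv w h z) / t n) \<longlonglongrightarrow> dderiv w (dderiv v h) z" for w
    proof -
      have zb: "z \<in> ball z r" using r by simp
      have "(\<lambda>n. dderiv w (q n) z) \<longlonglongrightarrow> dderiv w (dderiv v h) z"
        by (rule holomorphic_fun_uniform_limit(2)[OF open_ball holq locl zb])
      moreover have "dderiv w (q n) z = (dderiv w h (z + t n *s v) - dderiv w h z) / t n" for n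
      proof -
        have d1: "((\<lambda>s. h ((z + t n *s v) + s *s w)) has_field_derivative dderiv w h (z + t n *s v)) (at 0)"
          using holomorphic_fun_line_derivative[OF hol D, of "z + t n *s v" 0 w] sh[OF zb] by simp
        have d2: "((\<lambda>s. h (z + s *s w)) has_field_derivative dderiv w h z) (at 0)"
          using holomorphic_fun_line_derivative[OF hol D, of z 0 w] \<open>z \<in> D\<close> by simp
        have "((\<lambda>s. q n (z + s *s w)) has_field_derivative (1 / t n) * (dderiv w h (z + t n *s v) - dderiv w h z)) (at 0)"
          using DERIV_cmult[OF DERIV_diff[OF d1 d2], of "1 / t n"] by (simp add: q_def add_ac)
        then show ?thesis unfolding dderiv_def by (simp add: DERIV_imp_deriv)
      qed
      ultimately show ?thesis by simp
    qed
    with r t0 tl hd show ?thesis by blast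
  qed
  have hold: "holomorphic_fun (dderiv v h) D" for v
    by (rule holomorphic_fun_local) (use key in blast)
  then show "holomorphic_fun (dderiv v h) D" .
  assume z: "z \<in> D"
  from key[OF z, of v] obtain t where t: "\<And>n::nat. t n \<noteq> 0" "t \<longlonglongrightarrow> 0"
    "\<And>w. (\<lambda>n. (dderiv w h (z + t n *s v) - dderiv w h z) / t n) \<longlonglongrightarrow> dderiv w (dderiv v h) z" by blast
  have "((\<lambda>s. dderiv w h (z + s *s v)) has_field_derivative dderiv v (dderiv w h) z) (at 0)"
    using holomorphic_fun_line_derivative[OF hold D, of z 0 v] z by simp
  then have "((\<lambda>s. (dderiv w h (z + s *s v) - dderiv w h z) / s) \<longlongrightarrow> dderiv v (dderiv w h) z) (at 0)"
    by (simp add: has_field_derivative_iff)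
  moreover have "filterlim t (at 0) sequentially"
    using t by (simp add: filterlim_at)
  ultimately have "(\<lambda>n. (dderiv w h (z + t n *s v) - dderiv w h z) / t n) \<longlonglongrightarrow> dderiv v (dderiv w h) z"
    by (rule filterlim_compose)
  with t(3) show "dderiv w (dderiv v h) z = dderiv v (dderiv w h) z"
    using LIMSEQ_unique by blast
qed

lemma holomorphic_fun_det:
  fixes M :: "complex^'n \<Rightarrow> complex^'m^'m"
  assumes "\<And>i j. holomorphic_fun (\<lambda>z. M z $ i $ j) D"
  shows "holomorphic_fun (\<lambda>z. det (M z)) D"
  unfolding det_def by (intro holomorphic_fun_sum holomorphic_fun_cmult holomorphic_fun_prod assms)

lemma holomorphic_fun_jacobian_det:
  assumes "holomorphic_map f D" "open D"
  shows "holomorphic_fun (jacobian_det f) D"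
proof -
  have "holomorphic_fun (\<lambda>z. det (jacobian f z)) D"
    using assms unfolding jacobian_def holomorphic_map_def
    by (intro holomorphic_fun_det) (simp add: holomorphic_fun_dderiv)
  then show ?thesis by (simp add: jacobian_det_eq[abs_def])
qed

text \<open>
  Every point of the ball lies on a complex line through \<open>q\<close>, which meets the ball in a convex set.
\<close>

lemma holomorphic_fun_identity_ball:
  fixes g h :: "complex^'n \<Rightarrow> complex"
  assumes "holomorphic_fun g (ball p R)" "holomorphic_fun h (ball p R)"
    and r: "r > 0" "q \<in> ball p R" "\<And>x. x \<in> ball q r \<Longrightarrow> x \<in> ball p R \<Longrightarrow> g x = h x" and x: "x \<in> ball p R"
  shows "g x = h x"
proof -
  define S where "S = {s. q + s *s (x - q) \<in> ball p R}"
  define S0 where "S0 = {s. q + s *s (x - q) \<in> ball p R \<inter> ball q r}"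
  have "convex S"
  proof (rule convexI)
    fix s t :: complex and u v :: real
    assume a: "s \<in> S" "t \<in> S" "0 \<le> u" "0 \<le> v" "u + v = 1"
    have "u *\<^sub>R (q + s *s (x - q)) + v *\<^sub>R (q + t *s (x - q)) \<in> ball p R"
      using a convex_ball[of p R] unfolding convex_def S_def by blast
    moreover have "u *\<^sub>R (q + s *s (x - q)) + v *\<^sub>R (q + t *s (x - q)) = (u + v) *\<^sub>R q + (u *\<^sub>R s + v *\<^sub>R t) *s (x - q)"
      unfolding scaleR_eq_complex_scale scaleR_conv_of_real by (simp add: vec_eq_iff algebra_simps)
    ultimately show "u *\<^sub>R s + v *\<^sub>R t \<in> S" using a by (simp add: S_def)
  qed
  then have "connected S" by (rule convex_connected)
  have "g (q + 1 *s (x - q)) = h (q + 1 *s (x - q))"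
  proof (rule analytic_continuation_open[of S0 S "\<lambda>s. g (q + s *s (x - q))" "\<lambda>s. h (q + s *s (x - q))" 1])
    show "open S0" unfolding S0_def by (intro open_line_preimage open_Int open_ball)
    show "open S" unfolding S_def by (intro open_line_preimage open_ball)
    show "(\<lambda>s. g (q + s *s (x - q))) holomorphic_on S" "(\<lambda>s. h (q + s *s (x - q))) holomorphic_on S"
      unfolding S_def by (intro holomorphic_fun_on_line assms(1,2) open_ball)+
    have "0 \<in> S0" using r by (simp add: S0_def)
    then show "S0 \<noteq> {}" by blast
    show "1 \<in> S" using x by (simp add: S_def)
    show "S0 \<subseteq> S" by (auto simp: S0_def S_def)
    show "g (q + z *s (x - q)) = h (q + z *s (x - q))" if "z \<in> S0" for z
      using that r(3) by (auto simp: S0_def)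
  qed (rule \<open>connected S\<close>)
  then show ?thesis by simp
qed

section \<open>The real Jacobian of a holomorphic map\<close>

text \<open>
  The change of variables formula and Sard's theorem concern maps of \<open>real^'m\<close> with a well-ordered
  index type \<open>'m\<close>. The type \<open>'n bit0\<close> is well-ordered and has as many elements as \<open>complex^'n\<close> has
  real dimensions, so an enumeration of the standard basis by it identifies the two spaces
  isometrically.
\<close>

definition real_basis :: "'n::finite bit0 \<Rightarrow> complex^'n"
  where "real_basis = (SOME b. bij_betw b UNIV Basis)"

lemma bij_betw_real_basis: "bij_betw (real_basis :: 'n::finite bit0 \<Rightarrow> complex^'n) UNIV Basis"
proof -
  have "card (UNIV :: 'n bit0 set) = card (Basis :: (complex^'n) set)"
    by simp
  then have "\<exists>b :: 'n bit0 \<Rightarrow> complex^'n. bij_betw b UNIV Basis"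
    by (intro finite_same_card_bij) auto
  then show ?thesis unfolding real_basis_def by (rule someI_ex)
qed

definition to_real :: "complex^'n::finite \<Rightarrow> real^'n bit0"
  where "to_real x = (\<chi> i. x \<bullet> real_basis i)"

definition from_real :: "real^'n::finite bit0 \<Rightarrow> complex^'n"
  where "from_real y = (\<Sum>i\<in>UNIV. y $ i *\<^sub>R real_basis i)"

lemma sum_real_basis: "(\<Sum>i\<in>UNIV. g (real_basis i)) = sum g Basis"
  by (rule sum.reindex_bij_betw[OF bij_betw_real_basis])

lemma real_basis_in_Basis: "real_basis i \<in> Basis"
  using bij_betw_real_basis by (auto simp: bij_betw_def)

lemma inner_real_basis: "real_basis i \<bullet> real_basis j = (if i = j then 1 else 0)"
  using bij_betw_real_basis
  by (auto simp: inner_Basis real_basis_in_Basis bij_betw_def inj_on_def)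

lemma from_to_real [simp]: "from_real (to_real x) = x"
  unfolding from_real_def to_real_def using sum_real_basis[of "\<lambda>b. (x \<bullet> b) *\<^sub>R b"]
  by (simp add: euclidean_representation)

lemma to_from_real [simp]: "to_real (from_real y) = y"
  by (simp add: vec_eq_iff to_real_def from_real_def inner_sum_left inner_real_basis if_distrib
      cong: if_cong)

lemma linear_to_real: "linear to_real"
  by (rule linearI) (auto simp: to_real_def vec_eq_iff inner_left_distrib)

lemma linear_from_real: "linear from_real"
  by (rule linearI) (auto simp: from_real_def scaleR_add_left sum.distrib scaleR_sum_right)

lemma bounded_linear_to_real: "bounded_linear to_real"
  using linear_to_real by (simp add: linear_conv_bounded_linear)

lemma bounded_linear_from_real: "bounded_linear from_real"
  using linear_from_real by (simp add: linear_conv_bounded_linear)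

lemma norm_to_real: "norm (to_real x) = norm x"
proof -
  have "to_real x \<bullet> to_real x = x \<bullet> x"
    unfolding inner_vec_def[of "to_real x"] euclidean_inner[of x x]
    using sum_real_basis[of "\<lambda>b. (x \<bullet> b) * (x \<bullet> b)"] by (simp add: to_real_def)
  then show ?thesis by (simp add: norm_eq_sqrt_inner)
qed

lemma norm_from_real: "norm (from_real y) = norm y"
  by (metis norm_to_real to_from_real)

lemma inj_to_real: "inj to_real" by (metis injI from_to_real)
lemma measurable_to_real [measurable]: "to_real \<in> borel_measurable borel"
  by (intro borel_measurable_continuous_onI linear_continuous_on bounded_linear_to_real)

lemma measurable_from_real [measurable]: "from_real \<in> borel_measurable borel"
  by (intro borel_measurable_continuous_onI linear_continuous_on bounded_linear_from_real)

lemma from_real_axis: "from_real (axis i 1) = real_basis i"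
  by (simp add: from_real_def axis_def if_distrib[of "\<lambda>c. c *\<^sub>R _"] cong: if_cong)

lemma distr_to_real: "distr lborel borel (to_real :: complex^'n::finite \<Rightarrow> _) = lborel"
proof (rule lborel_eqI[symmetric])
  fix l u :: "real^'n bit0" assume le: "\<And>b. b \<in> Basis \<Longrightarrow> l \<bullet> b \<le> u \<bullet> b"
  have lu: "l $ i \<le> u $ i" for i using le[of "axis i 1"] by (simp add: inner_axis)
  have B: "from_real y \<bullet> real_basis i = y $ i" for y :: "real^'n bit0" and i
    by (simp add: from_real_def inner_sum_left inner_real_basis if_distrib cong: if_cong)
  have eqB: "(\<forall>b\<in>Basis. P b) \<longleftrightarrow> (\<forall>i. P (real_basis i))" for P :: "complex^'n \<Rightarrow> bool"
    using bij_betw_real_basis by (metis (no_types, lifting) UNIV_I bij_betw_def imageE image_eqI)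
  have pre: "to_real -` box l u = box (from_real l) (from_real u)"
    unfolding box_def eqB B
    by (auto simp: box_def Basis_vec_def inner_axis to_real_def)
  have "emeasure (distr lborel borel (to_real :: complex^'n \<Rightarrow> _)) (box l u) = emeasure lborel (box (from_real l) (from_real u) :: (complex^'n) set)"
    by (subst emeasure_distr) (auto simp: pre)
  also have "\<dots> = (\<Prod>b\<in>Basis. (from_real u - from_real l :: complex^'n) \<bullet> b)"
  proof (rule emeasure_lborel_box)
    show "from_real l \<bullet> b \<le> from_real u \<bullet> b" if "b \<in> Basis" for b :: "complex^'n"
      using that lu eqB[of "\<lambda>b. from_real l \<bullet> b \<le> from_real u \<bullet> b"] B by simp
  qed
  also have "(\<Prod>b\<in>Basis. (from_real u - from_real l :: complex^'n) \<bullet> b) = (\<Prod>i\<in>UNIV. u $ i - l $ i)"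
    by (subst prod.reindex_bij_betw[OF bij_betw_real_basis, symmetric])
       (simp add: inner_diff_left B)
  also have "\<dots> = (\<Prod>b\<in>Basis. (u - l) \<bullet> b)"
  proof -
    have "bij_betw (\<lambda>i. axis i (1::real)) UNIV (Basis :: (real^'n bit0) set)"
      by (auto simp: bij_betw_def inj_on_def axis_eq_axis Basis_vec_def)
    from prod.reindex_bij_betw[OF this, of "\<lambda>b. (u - l) \<bullet> b"] show ?thesis
      by (simp add: inner_axis)
  qed
  finally show "emeasure (distr lborel borel (to_real :: complex^'n \<Rightarrow> _)) (box l u) = (\<Prod>b\<in>Basis. (u - l) \<bullet> b)" .
qed simp

text \<open>
  The factor by which \<open>A\<close>, read as a real linear map, scales volume.
\<close>

definition real_det :: "complex^'n^'n::finite \<Rightarrow> real"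
  where "real_det A = \<bar>det (matrix (to_real \<circ> (*v) A \<circ> from_real))\<bar>"

lemma linear_matrix_vector_mult_complex: "linear ((*v) (A :: complex^'n^'m))"
  by (rule linearI) (auto simp: matrix_vector_right_distrib scaleR_eq_complex_scale vec.scale)

lemma linear_real_conjugate: "linear (to_real \<circ> (*v) A \<circ> from_real)"
  by (intro linear_compose linear_to_real linear_from_real linear_matrix_vector_mult_complex)

lemma real_det_mult: "real_det (A ** B) = real_det A * real_det B"
proof -
  have "to_real \<circ> (*v) (A ** B) \<circ> from_real = (to_real \<circ> (*v) A \<circ> from_real) \<circ> (to_real \<circ> (*v) B \<circ> from_real)"
    by (simp add: fun_eq_iff matrix_vector_mul_assoc)
  then show ?thesis
    unfolding real_det_def by (simp only: matrix_compose[OF linear_real_conjugate linear_real_conjugate] det_mul abs_mult)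
qed

lemma real_det_one [simp]: "real_det (mat 1 :: complex^'n^'n::finite) = 1"
proof -
  have "to_real \<circ> (*v) (mat 1 :: complex^'n^'n) \<circ> from_real = id" by (simp add: fun_eq_iff)
  then show ?thesis unfolding real_det_def by (simp only: matrix_id)
qed

lemma real_det_eq_0: assumes "det A = 0" shows "real_det A = 0"
proof -
  from assms have "\<not> (\<forall>x. A *v x = 0 \<longrightarrow> x = 0)"
    using matrix_left_invertible_ker invertible_det_nz invertible_left_inverse by metis
  then obtain x where x: "A *v x = 0" "x \<noteq> 0" by blast
  have "\<not> inj (to_real \<circ> (*v) A \<circ> from_real)"
  proof
    assume i: "inj (to_real \<circ> (*v) A \<circ> from_real)"
    have "(to_real \<circ> (*v) A \<circ> from_real) (to_real x) = (to_real \<circ> (*v) A \<circ> from_real) (to_real 0)"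
      using x by simp
    then have "to_real x = to_real 0" by (rule injD[OF i])
    with x show False by (metis from_to_real)
  qed
  then show ?thesis unfolding real_det_def using det_nz_iff_inj[OF linear_real_conjugate[of A]] by simp
qed

lemma real_det_nonzero: assumes "det A \<noteq> 0" shows "real_det A \<noteq> 0"
proof -
  from assms obtain B where "A ** B = mat 1"
    using invertible_det_nz unfolding invertible_def by blast
  then have "real_det A * real_det B = 1" by (simp flip: real_det_mult)
  then show ?thesis by auto
qed

text \<open>
  Every invertible matrix is a product of these, so by multiplicativity it suffices to compute
  \<open>real_det\<close> for them.
\<close>

definition elementary_row :: "'n \<Rightarrow> complex^'n \<Rightarrow> complex^'n^'n::finite"
  where "elementary_row k r = (\<chi> i. if i = k then r else axis i 1)"

lemma elementary_row_nth: "elementary_row k r $ i = (if i = k then r else axis i 1)"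
  by (simp add: elementary_row_def)

lemma mat_1_row: "(mat 1 :: complex^'n^'n) $ i = axis i 1"
  by (simp add: mat_def axis_def vec_eq_iff)

lemma matrix_mult_row: "(A ** B) $ i = (\<Sum>m\<in>UNIV. A $ i $ m *s B $ m)"
  by (simp add: matrix_matrix_mult_def vec_eq_iff)

lemma matrix_mult_row_cong: "A $ i = A' $ i \<Longrightarrow> (A ** B) $ i = (A' ** B) $ i"
  by (simp add: matrix_mult_row)

lemma matrix_mult_axis_row: "A $ i = axis m 1 \<Longrightarrow> (A ** B) $ i = B $ m"
  by (simp add: matrix_mult_row axis_def if_distrib[of "\<lambda>c. c *s _"] cong: if_cong)

lemma row_mat_1: "row i (mat 1 :: complex^'n^'n) = axis i 1"
  by (simp add: row_def mat_1_row)

lemma det_elementary_row: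
  fixes r :: "complex^'n::finite"
  shows "det (elementary_row k r) = r $ k"
  using cramer_lemma_transpose[of k r "mat 1"]
  unfolding row_mat_1 basis_expansion elementary_row_def by simp

lemma elementary_row_mult:
  "elementary_row k r ** elementary_row k t = elementary_row k (r + (r $ k) *s (t - axis k 1))"
proof -
  have "(\<Sum>m\<in>UNIV. r $ m *s elementary_row k t $ m)
      = (\<Sum>m\<in>UNIV. r $ m *s axis m 1 + (if m = k then r $ k *s (t - axis k 1) else 0))"
    by (intro sum.cong) (auto simp: elementary_row_nth vector_ssub_ldistrib)
  also have "\<dots> = r + r $ k *s (t - axis k 1)"
    by (simp add: sum.distrib basis_expansion)
  finally have k: "(elementary_row k r ** elementary_row k t) $ k = r + (r $ k) *s (t - axis k 1)"
    by (simp add: matrix_mult_row elementary_row_nth)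
  have "(elementary_row k r ** elementary_row k t) $ i = axis i 1" if "i \<noteq> k" for i
    using that by (subst matrix_mult_axis_row[where m = i]) (auto simp: elementary_row_nth)
  with k show ?thesis by (subst vec_eq_iff) (auto simp: elementary_row_nth)
qed

lemma elementary_row_axis_mult_vec:
  "(elementary_row k (axis k c) *v x) $ i = (if i = k then c * x $ k else x $ i)"
  by (simp add: matrix_vector_mult_def elementary_row_nth axis_def if_distrib[of "\<lambda>c. c * _"] cong: if_cong)

lemma real_det_scale_row_unit:
  assumes "cmod u = 1" shows "real_det (elementary_row k (axis k u)) = 1"
proof -
  let ?A = "elementary_row k (axis k u)"
  have "norm (?A *v x) = norm x" for x
    unfolding norm_vec_def elementary_row_axis_mult_vec
    by (intro arg_cong2[where f = L2_set] ext) (auto simp: norm_mult assms)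
  then have "orthogonal_transformation (to_real \<circ> (*v) ?A \<circ> from_real)"
    unfolding orthogonal_transformation using linear_real_conjugate[of ?A]
    by (auto simp: norm_to_real norm_from_real)
  then show ?thesis unfolding real_det_def by (rule orthogonal_transformation_det)
qed

lemma real_det_scale_row_pos:
  fixes k :: "'n::finite"
  assumes "\<rho> > 0" shows "real_det (elementary_row k (axis k (complex_of_real \<rho>))) = \<rho>^2"
proof -
  let ?A = "elementary_row k (axis k (complex_of_real \<rho>))"
  let ?M = "matrix (to_real \<circ> (*v) ?A \<circ> from_real)"
  define c where "c b = (if b $ k = 0 then 1 else \<rho>)" for b :: "complex^'n"
  have act: "?A *v b = c b *\<^sub>R b" if b: "b \<in> Basis" for b
  proof -
    from b obtain m u where mu: "b = axis m u" "u \<in> Basis" by (auto simp: Basis_vec_def)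
    then have "u \<noteq> 0" by auto
    show ?thesis
      unfolding vec_eq_iff elementary_row_axis_mult_vec c_def mu(1) using \<open>u \<noteq> 0\<close>
      by (auto simp: axis_def scaleR_conv_of_real[where 'a = complex])
  qed
  have ent: "?M $ i $ j = c (real_basis j) * (if i = j then 1 else 0)" for i j
  proof -
    have "?M $ i $ j = (?A *v real_basis j) \<bullet> real_basis i"
      by (simp add: matrix_def from_real_axis to_real_def)
    also have "\<dots> = c (real_basis j) * (if i = j then 1 else 0)"
      by (auto simp: act real_basis_in_Basis inner_real_basis)
    finally show ?thesis .
  qed
  have "det ?M = (\<Prod>i\<in>UNIV. c (real_basis i))"
    by (subst det_diagonal) (auto simp: ent)
  also have "\<dots> = (\<Prod>b\<in>Basis. c b)"
    by (rule prod.reindex_bij_betw[OF bij_betw_real_basis])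
  also have "\<dots> = (\<Prod>b\<in>{axis k 1, axis k \<i>}. c b)"
  proof (rule prod.mono_neutral_right)
    show "\<forall>i\<in>Basis - {axis k 1, axis k \<i>}. c i = 1"
      by (auto simp: Basis_vec_def c_def axis_def Basis_complex_def split: if_splits)
  qed auto
  also have "\<dots> = \<rho>^2"
    by (simp add: c_def axis_eq_axis power2_eq_square)
  finally show ?thesis using assms by (simp add: real_det_def)
qed

lemma real_det_elementary_row:
  fixes r :: "complex^'n::finite"
  assumes "r $ k \<noteq> 0" shows "real_det (elementary_row k r) = (cmod (r $ k))^2"
proof -
  \<comment> \<open>Conjugating a shear by the doubling of coordinate \<open>k\<close> gives its square, so its factor \<open>x\<close> satisfies \<open>x = x^2\<close>.\<close>
  have shear: "real_det (elementary_row k t) = 1" if t: "t $ k = 1" for t :: "complex^'n"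
  proof -
    let ?D = "elementary_row k (axis k 2)" and ?T = "elementary_row k t"
    have "?D ** ?T = (?T ** ?T) ** ?D"
      unfolding elementary_row_mult using t
      by (intro arg_cong[where f = "elementary_row k"]) (simp add: vec_eq_iff axis_def)
    then have "real_det ?D * real_det ?T = real_det ?T * real_det ?T * real_det ?D"
      by (metis real_det_mult)
    moreover have "real_det ?D \<noteq> 0" "real_det ?T \<noteq> 0"
      using t by (auto intro!: real_det_nonzero simp: det_elementary_row)
    ultimately show ?thesis by simp
  qed
  have pol: "real_det (elementary_row k (axis k c)) = (cmod c)^2" if c: "c \<noteq> 0" for c
  proof -
    have "elementary_row k (axis k c)
        = elementary_row k (axis k (complex_of_real (cmod c))) ** elementary_row k (axis k (c / of_real (cmod c)))"
      unfolding elementary_row_mult using c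
      by (intro arg_cong[where f = "elementary_row k"]) (auto simp: vec_eq_iff axis_def field_simps)
    then show ?thesis
      using c by (simp add: real_det_mult real_det_scale_row_pos real_det_scale_row_unit norm_divide)
  qed
  have "elementary_row k r = elementary_row k (axis k (r $ k)) ** elementary_row k ((1 / r $ k) *s r)"
    unfolding elementary_row_mult using assms
    by (intro arg_cong[where f = "elementary_row k"]) (auto simp: vec_eq_iff axis_def field_simps)
  then show ?thesis using assms pol by (simp add: real_det_mult shear)
qed

text \<open>
  Gaussian elimination as an induction on the set of rows in which \<open>A\<close> differs from the identity
  matrix. A row \<open>k\<close> with \<open>A $ k $ k \<noteq> 0\<close> is split off as an elementary factor on the right, after
  which row \<open>k\<close> has become standard as well.
\<close>

lemma real_det_eq:
  fixes A :: "complex^'n^'n::finite"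
  shows "real_det A = (cmod (det A))^2"
proof -
  have "real_det A = (cmod (det A))^2" if "finite S" "\<And>i. i \<notin> S \<Longrightarrow> A $ i = axis i 1" for S and A :: "complex^'n^'n"
    using that
  proof (induction S arbitrary: A rule: finite_induct)
    case empty
    then have "A = mat 1" by (simp add: vec_eq_iff mat_1_row)
    then show ?case by simp
  next
    case (insert k S)
    have main: "real_det A = (cmod (det A))^2"
      if rows: "\<And>i. i \<notin> insert k S \<Longrightarrow> A $ i = axis i 1" and nz: "A $ k $ k \<noteq> 0" for A :: "complex^'n^'n"
    proof -
      let ?E = "elementary_row k (A $ k)"
      have "det ?E \<noteq> 0" using nz by (simp add: det_elementary_row)
      then obtain E' where E': "?E ** E' = mat 1" "E' ** ?E = mat 1"
        using invertible_det_nz unfolding invertible_def by blast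
      define B where "B = A ** E'"
      have AB: "A = B ** ?E"
        by (simp add: B_def E' flip: matrix_mul_assoc)
      have "B $ i = axis i 1" if "i \<notin> S" for i
      proof -
        have "A $ i = ?E $ i" using rows[of i] that by (auto simp: elementary_row_nth)
        then have "B $ i = (?E ** E') $ i" unfolding B_def by (rule matrix_mult_row_cong)
        then show ?thesis by (simp add: E' mat_1_row)
      qed
      then have "real_det B = (cmod (det B))^2" by (rule insert.IH)
      then show ?thesis
        by (subst (1 2) AB)
           (simp add: real_det_mult det_mul real_det_elementary_row[OF nz] det_elementary_row norm_mult power_mult_distrib)
    qed
    show ?case
    proof (cases "det A = 0 \<or> A $ k $ k \<noteq> 0")
      case True
      then show ?thesis using main[OF insert.prems] real_det_eq_0[of A] by auto
    next
      case False
      \<comment> \<open>If all such entries vanished, row \<open>k\<close> would be a combination of standard rows of \<open>A\<close>.\<close>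
      have "\<exists>j\<in>S. A $ k $ j \<noteq> 0"
      proof (rule ccontr)
        assume "\<not> (\<exists>j\<in>S. A $ k $ j \<noteq> 0)"
        then have z: "A $ k $ j = 0" if "j \<in> insert k S" for j using False that by auto
        have "- (A $ k) = (\<Sum>j\<in>UNIV. (- A $ k $ j) *s axis j 1)"
          using basis_expansion[of "- (A $ k)"] by simp
        also have "\<dots> \<in> vec.span {row j A |j. j \<noteq> k}"
        proof (rule vec.span_sum)
          fix j
          show "(- A $ k $ j) *s axis j 1 \<in> vec.span {row j A |j. j \<noteq> k}"
          proof (cases "j \<in> insert k S")
            case True
            then show ?thesis by (simp add: z vec.span_zero)
          next
            case False
            then have "axis j 1 = row j A" "j \<noteq> k" using insert.prems[of j] by (auto simp: row_def)
            then show ?thesis by (intro vec.span_scale vec.span_base) blast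
          qed
        qed
        finally have "det (\<chi> m. if m = k then row k A + (- (A $ k)) else row m A) = det A"
          by (rule det_row_span)
        moreover have "det (\<chi> m. if m = k then row k A + (- (A $ k)) else row m A) = 0"
          by (rule det_zero_row(1)[where i = k]) (simp add: row_def vec_eq_iff)
        ultimately show False using False by simp
      qed
      then obtain j where j: "j \<in> S" "A $ k $ j \<noteq> 0" by blast
      with insert.hyps have jk: "j \<noteq> k" by auto
      \<comment> \<open>Adding column \<open>j\<close> to column \<open>k\<close> keeps the standard rows because \<open>j\<close> is not the index of one.\<close>
      let ?E = "elementary_row j (axis j 1 + axis k 1)"
      have Ej: "(axis j 1 + axis k 1 :: complex^'n) $ j = 1" using jk by (simp add: axis_def)
      have "real_det (A ** ?E) = (cmod (det (A ** ?E)))^2"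
      proof (rule main)
        fix i assume "i \<notin> insert k S"
        then show "(A ** ?E) $ i = axis i 1"
          using insert.prems[of i] j by (subst matrix_mult_axis_row[where m = i]) (auto simp: elementary_row_nth)
      next
        have "(A ** ?E) $ k $ k = (\<Sum>m\<in>UNIV. A $ k $ m * ?E $ m $ k)"
          by (simp add: matrix_matrix_mult_def)
        also have "\<dots> = (\<Sum>m\<in>UNIV. if m = j then A $ k $ j else 0)"
          using False jk by (intro sum.cong) (auto simp: elementary_row_nth axis_def)
        finally show "(A ** ?E) $ k $ k \<noteq> 0" using j by simp
      qed
      then show ?thesis
        using Ej by (simp add: real_det_mult det_mul real_det_elementary_row det_elementary_row)
    qed
  qed
  from this[of UNIV A] show ?thesis by simp
qed

subsection \<open>Change of variables and Sard's theorem\<close>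

lemma has_derivative_real_conjugate:
  fixes f :: "complex^'n::finite \<Rightarrow> complex^'n"
  assumes "(f has_derivative f') (at (from_real y) within S)"
  shows "((to_real \<circ> f \<circ> from_real) has_derivative (to_real \<circ> f' \<circ> from_real)) (at y within to_real ` S)"
proof -
  have im: "from_real ` to_real ` S = S" by (simp add: image_image)
  have "(from_real has_derivative from_real) (at y within to_real ` S)"
    by (rule bounded_linear_imp_has_derivative[OF bounded_linear_from_real])
  then have "((f \<circ> from_real) has_derivative (f' \<circ> from_real)) (at y within to_real ` S)"
    by (rule diff_chain_within) (simp add: im assms)
  then have "((\<lambda>x. to_real ((f \<circ> from_real) x)) has_derivative (\<lambda>x. to_real ((f' \<circ> from_real) x))) (at y within to_real ` S)"
    by (rule bounded_linear.has_derivative[OF bounded_linear_to_real])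
  then show ?thesis by (simp add: o_def)
qed

lemma to_real_image: "to_real ` S = from_real -` S"
  by (auto simp: image_iff) (metis to_from_real)

lemma to_real_image_borel: "S \<in> sets borel \<Longrightarrow> to_real ` S \<in> sets borel"
  unfolding to_real_image using measurable_sets[OF measurable_from_real] by simp

lemma emeasure_to_real_image:
  assumes "S \<in> sets borel" shows "emeasure lborel (to_real ` S) = emeasure lborel S"
proof -
  have "emeasure lborel (to_real ` S) = emeasure (distr lborel borel to_real) (to_real ` S)"
    by (simp add: distr_to_real)
  also have "\<dots> = emeasure lborel (to_real -` (to_real ` S))"
    using to_real_image_borel[OF assms] by (subst emeasure_distr) auto
  also have "to_real -` (to_real ` S) = S" by (rule inj_vimage_image_eq[OF inj_to_real])
  finally show ?thesis .
qed

text \<open>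
  The change of variables formula for volumes, transported along the isometry \<open>to_real\<close>. The image
  is assumed bounded so that its measure is finite.
\<close>

lemma emeasure_holomorphic_image:
  fixes f :: "complex^'n::finite \<Rightarrow> complex^'n"
  assumes S: "S \<in> sets borel" and der: "\<And>x. x \<in> S \<Longrightarrow> (f has_derivative (*v) (A x)) (at x)"
    and inj: "inj_on f S" and meas: "(\<lambda>x. indicator S x * det (A x)) \<in> borel_measurable borel"
    and fS: "f ` S \<in> sets borel" "bounded (f ` S)"
  shows "emeasure lborel (f ` S) = (\<integral>\<^sup>+x. ennreal ((cmod (det (A x)))^2) * indicator S x \<partial>lborel)"
proof -
  let ?f = "to_real \<circ> f \<circ> from_real" and ?S = "to_real ` S"
  let ?d = "\<lambda>y. \<bar>det (matrix (to_real \<circ> (*v) (A (from_real y)) \<circ> from_real))\<bar>"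
  have d: "?d y = (cmod (det (A (from_real y))))^2" for y
    using real_det_eq[of "A (from_real y)"] by (simp add: real_det_def)
  have fim: "?f ` ?S = to_real ` (f ` S)" by (simp add: image_comp o_def)
  have b: "to_real ` (f ` S) \<in> sets borel" by (rule to_real_image_borel[OF fS(1)])
  have "bounded (to_real ` (f ` S))"
    by (rule bounded_linear_image[OF fS(2) bounded_linear_to_real])
  with b have lm: "?f ` ?S \<in> lmeasurable" unfolding fim
    by (intro bounded_set_imp_lmeasurable) auto
  have "(?d has_integral measure lebesgue (?f ` ?S)) ?S"
  proof (rule has_measure_differentiable_image[THEN iffD1])
    show "?S \<in> sets lebesgue" using to_real_image_borel[OF S] by auto
    show "(?f has_derivative (to_real \<circ> (*v) (A (from_real y)) \<circ> from_real)) (at y within ?S)" if "y \<in> ?S" for y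
    proof (rule has_derivative_real_conjugate)
      have "from_real y \<in> S" using that by auto
      then show "(f has_derivative (*v) (A (from_real y))) (at (from_real y) within S)"
        using der has_derivative_at_withinI by blast
    qed
    show "inj_on ?f ?S"
      using inj inj_to_real by (auto simp: inj_on_def)
  qed (use lm in auto)
  then have "(\<integral>\<^sup>+y. ennreal (?d y) * indicator ?S y \<partial>lborel) = ennreal (measure lebesgue (?f ` ?S))"
    by (intro nn_integral_has_integral_lebesgue') auto
  also have "\<dots> = emeasure lebesgue (?f ` ?S)" by (rule emeasure_eq_measure2[symmetric, OF lm])
  also have "\<dots> = emeasure lborel (f ` S)" unfolding fim using b emeasure_to_real_image[OF fS(1)] by simp
  also have "(\<integral>\<^sup>+y. ennreal (?d y) * indicator ?S y \<partial>lborel)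
    = (\<integral>\<^sup>+y. ennreal ((cmod (indicator S (from_real y) * det (A (from_real y))))^2) \<partial>distr lborel borel to_real)"
    unfolding distr_to_real d
    by (intro nn_integral_cong) (auto simp: to_real_image split: split_indicator)
  also have "\<dots> = (\<integral>\<^sup>+x. ennreal ((cmod (indicator S x * det (A x)))^2) \<partial>lborel)"
    using meas by (subst nn_integral_distr) (auto intro!: measurable_compose[OF measurable_from_real])
  also have "\<dots> = (\<integral>\<^sup>+x. ennreal ((cmod (det (A x)))^2) * indicator S x \<partial>lborel)"
    by (intro nn_integral_cong) (auto simp: indicator_def)
  finally show ?thesis by simp
qed

lemma negligible_critical_values:
  fixes f :: "complex^'n::finite \<Rightarrow> complex^'n"
  assumes der: "\<And>x. x \<in> S \<Longrightarrow> (f has_derivative (*v) (A x)) (at x)"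
    and "\<And>x. x \<in> S \<Longrightarrow> det (A x) = 0"
  shows "negligible (f ` S)"
proof -
  let ?f = "to_real \<circ> f \<circ> from_real" and ?S = "to_real ` S"
  have "negligible (?f ` ?S)"
  proof (rule baby_Sard)
    fix y assume "y \<in> ?S"
    then have y: "from_real y \<in> S" by auto
    show "(?f has_derivative (to_real \<circ> (*v) (A (from_real y)) \<circ> from_real)) (at y within ?S)"
      by (rule has_derivative_real_conjugate) (use der[OF y] has_derivative_at_withinI in blast)
    have "real_det (A (from_real y)) = 0" by (simp add: real_det_eq assms(2)[OF y])
    then show "rank (matrix (to_real \<circ> (*v) (A (from_real y)) \<circ> from_real)) < CARD('n bit0)"
      unfolding real_det_def
      using det_eq_0_rank[of "matrix (to_real \<circ> (*v) (A (from_real y)) \<circ> from_real)"] by simp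
  qed simp
  then have "negligible (from_real ` (?f ` ?S))"
    by (rule negligible_differentiable_image_negligible[rotated, OF _ linear_imp_differentiable_on[OF linear_from_real]]) simp
  then show ?thesis by (simp add: image_comp o_def)
qed

text \<open>
  Both measures agree on boxes: the preimage of a box is its bounded image under the inverse of
  \<open>A\<close>, whose volume is given by the previous formula.
\<close>

lemma lborel_distr_unimodular:
  fixes A :: "complex^'n^'n::finite"
  assumes "cmod (det A) = 1"
  shows "distr lborel borel ((*v) A) = lborel"
proof -
  have "det A \<noteq> 0" using assms by auto
  then obtain B where B: "A ** B = mat 1" "B ** A = mat 1"
    using invertible_det_nz unfolding invertible_def by blast
  have "cmod (det A) * cmod (det B) = 1" using B(1) by (metis det_I det_mul norm_mult norm_one)
  then have dB: "cmod (det B) = 1" using assms by simp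
  have AB: "A *v (B *v x) = x" "B *v (A *v x) = x" for x
    by (simp_all add: matrix_vector_mul_assoc B)
  have bl: "bounded_linear ((*v) C)" for C :: "complex^'n^'n"
    using linear_matrix_vector_mult_complex by (simp add: linear_conv_bounded_linear)
  have m [measurable]: "(*v) C \<in> borel_measurable borel" for C :: "complex^'n^'n"
    by (intro borel_measurable_continuous_onI linear_continuous_on bl)
  show ?thesis
  proof (rule lborel_eqI[symmetric])
    fix l u :: "complex^'n" assume le: "\<And>b. b \<in> Basis \<Longrightarrow> l \<bullet> b \<le> u \<bullet> b"
    have pre: "(*v) A -` box l u = (*v) B ` box l u"
      by (auto simp: image_iff AB) (metis AB(2))
    have "emeasure (distr lborel borel ((*v) A)) (box l u) = emeasure lborel ((*v) B ` box l u)"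
      by (subst emeasure_distr) (auto simp: pre)
    also have "\<dots> = (\<integral>\<^sup>+x. ennreal ((cmod (det B))^2) * indicator (box l u) x \<partial>lborel)"
    proof (rule emeasure_holomorphic_image)
      show "((*v) B has_derivative (*v) B) (at x)" for x
        by (rule bounded_linear_imp_has_derivative[OF bl])
      show "inj_on ((*v) B) (box l u)" by (metis AB(1) inj_onI)
      show "(*v) B ` box l u \<in> sets borel"
        unfolding pre[symmetric] using measurable_sets[OF m, of "box l u" A] by simp
      show "bounded ((*v) B ` box l u)" by (rule bounded_linear_image[OF bounded_box bl])
    qed auto
    also have "\<dots> = emeasure lborel (box l u)" by (simp add: dB)
    also have "\<dots> = (\<Prod>b\<in>Basis. (u - l) \<bullet> b)" using le by (subst emeasure_lborel_box) auto
    finally show "emeasure (distr lborel borel ((*v) A)) (box l u) = (\<Prod>b\<in>Basis. (u - l) \<bullet> b)" .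
  qed simp
qed

section \<open>Integral identities\<close>

lemma norm_directional_difference_le:
  fixes \<psi> :: "'a::euclidean_space \<Rightarrow> complex"
  assumes der: "\<And>x. (\<psi> has_derivative \<psi>' x) (at x)" and C: "\<And>x. norm (\<psi>' x v) \<le> C" and t: "t \<ge> 0"
  shows "norm (\<psi> (x + t *\<^sub>R v) - \<psi> x) \<le> C * t"
proof -
  have "norm (\<psi> (x + t *\<^sub>R v) - \<psi> (x + 0 *\<^sub>R v)) \<le> C * norm (t - 0)"
  proof (rule differentiable_bound[where S = "{0..t}" and f = "\<lambda>s. \<psi> (x + s *\<^sub>R v)"
        and f' = "\<lambda>s h. \<psi>' (x + s *\<^sub>R v) (h *\<^sub>R v)"])
    fix s assume "s \<in> {0..t}"
    have 1: "((\<lambda>s. x + s *\<^sub>R v) has_derivative (\<lambda>h. h *\<^sub>R v)) (at s within {0..t})"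
      by (auto intro!: derivative_eq_intros)
    show "((\<lambda>s. \<psi> (x + s *\<^sub>R v)) has_derivative (\<lambda>h. \<psi>' (x + s *\<^sub>R v) (h *\<^sub>R v))) (at s within {0..t})"
      using has_derivative_compose[OF 1 der] .
    show "onorm (\<lambda>h. \<psi>' (x + s *\<^sub>R v) (h *\<^sub>R v)) \<le> C"
    proof (rule onorm_le)
      fix h :: real
      have "\<psi>' (x + s *\<^sub>R v) (h *\<^sub>R v) = h *\<^sub>R \<psi>' (x + s *\<^sub>R v) v"
        by (rule linear_cmul[OF has_derivative_linear[OF der]])
      then show "norm (\<psi>' (x + s *\<^sub>R v) (h *\<^sub>R v)) \<le> C * norm h"
        using mult_left_mono[OF C[of "x + s *\<^sub>R v"], of "\<bar>h\<bar>"] by (simp add: mult.commute)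
    qed
  qed (use t in auto)
  with t show ?thesis by simp
qed

lemma integral_lborel_translate:
  fixes g :: "'a::euclidean_space \<Rightarrow> 'b::{banach, second_countable_topology}"
  assumes "g \<in> borel_measurable borel"
  shows "(LINT x|lborel. g (a + x)) = (LINT x|lborel. g x)"
  using integral_distr[of "\<lambda>x. a + x" lborel borel g] assms by (simp add: lborel_distr_plus)

text \<open>
  By translation invariance the difference quotients of \<open>\<psi>\<close> in direction \<open>v\<close> have integral zero.
  They are bounded by a constant and vanish off a common compact set, so the limit may be taken
  under the integral.
\<close>

lemma integral_directional_derivative_eq_0:
  fixes \<psi> :: "'a::euclidean_space \<Rightarrow> complex"
  assumes der: "\<And>x. (\<psi> has_derivative \<psi>' x) (at x)" and cont: "continuous_on UNIV (\<lambda>x. \<psi>' x v)"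
    and K: "compact K" "\<And>x. x \<notin> K \<Longrightarrow> \<psi> x = 0"
  shows "integrable lborel (\<lambda>x. \<psi>' x v)" and "(LINT x|lborel. \<psi>' x v) = 0"
proof -
  have out: "\<psi>' x v = 0" if "x \<notin> K" for x
  proof -
    have "(\<psi> has_derivative (\<lambda>_. 0)) (at x)"
    proof (rule has_derivative_transform_within_open[where s = "- K" and f = "\<lambda>_. 0"])
      show "open (- K)" using K by (simp add: compact_imp_closed open_Compl)
    qed (use that K in auto)
    then have "\<psi>' x = (\<lambda>_. 0)" using der has_derivative_unique by blast
    then show ?thesis by simp
  qed
  have "bounded ((\<lambda>x. \<psi>' x v) ` K)"
    using K cont by (intro compact_imp_bounded compact_continuous_image) (auto intro: continuous_on_subset)
  then obtain C where C0: "C > 0" and "\<And>x. x \<in> K \<Longrightarrow> norm (\<psi>' x v) \<le> C"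
    by (auto simp: bounded_pos)
  then have C: "norm (\<psi>' x v) \<le> C" for x using out[of x] by (cases "x \<in> K") auto
  have eq: "(\<lambda>x. indicator K x *\<^sub>R \<psi>' x v) = (\<lambda>x. \<psi>' x v)"
    using out by (auto simp: fun_eq_iff split: split_indicator)
  show int: "integrable lborel (\<lambda>x. \<psi>' x v)"
    using borel_integrable_compact[OF K(1), of "\<lambda>x. \<psi>' x v"] cont unfolding eq
    by (auto intro: continuous_on_subset)
  have cpsi: "continuous_on UNIV \<psi>"
    using der by (meson continuous_at_imp_continuous_on has_derivative_continuous)
  have eq2: "(\<lambda>x. indicator K x *\<^sub>R \<psi> x) = \<psi>"
    using K(2) by (auto simp: fun_eq_iff split: split_indicator)
  have ipsi: "integrable lborel \<psi>"
    using borel_integrable_compact[OF K(1), of \<psi>] cpsi unfolding eq2 by (auto intro: continuous_on_subset)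
  define t where "t n = 1 / (real n + 1)" for n
  have t: "t n > 0" "t n \<le> 1" for n by (auto simp: t_def)
  have tl: "t \<longlonglongrightarrow> 0" unfolding t_def by real_asymp
  define q where "q n x = (\<psi> (x + t n *\<^sub>R v) - \<psi> x) /\<^sub>R t n" for n x
  have int0: "(LINT x|lborel. q n x) = 0" for n
  proof -
    have d: "distr lborel borel (\<lambda>x. t n *\<^sub>R v + x) = lborel"
      by (rule lborel_distr_plus)
    have mp: "\<psi> \<in> borel_measurable borel" using cpsi by (rule borel_measurable_continuous_onI)
    have i1: "integrable lborel (\<lambda>x. \<psi> (x + t n *\<^sub>R v))"
      using ipsi d mp integrable_distr_eq[of "\<lambda>x. t n *\<^sub>R v + x" lborel borel \<psi>]
      by (simp add: add.commute)
    have i2: "(LINT x|lborel. \<psi> (x + t n *\<^sub>R v)) = (LINT x|lborel. \<psi> x)"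
      using integral_lborel_translate[OF mp, of "t n *\<^sub>R v"] by (simp add: add.commute)
    show ?thesis unfolding q_def
      using i1 i2 ipsi by simp
  qed
  define K' where "K' = (\<lambda>(x, s). x - s *\<^sub>R v) ` (K \<times> {0..1::real})"
  have cK': "compact K'" unfolding K'_def
    by (intro compact_continuous_image compact_Times K compact_Icc)
       (auto simp: case_prod_unfold intro!: continuous_intros)
  have qout: "q n x = 0" if "x \<notin> K'" for n x
  proof -
    have "x \<notin> K"
      using that unfolding K'_def by (force intro: image_eqI[of _ _ "(x, 0)"])
    moreover have "x + t n *\<^sub>R v \<notin> K"
    proof
      assume "x + t n *\<^sub>R v \<in> K"
      then have "x \<in> K'" unfolding K'_def using t[of n]
        by (intro image_eqI[of _ _ "(x + t n *\<^sub>R v, t n)"]) auto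
      with that show False by blast
    qed
    ultimately show ?thesis by (simp add: q_def K)
  qed
  have "(\<lambda>n. LINT x|lborel. q n x) \<longlonglongrightarrow> (LINT x|lborel. \<psi>' x v)"
  proof (rule integral_dominated_convergence[where w = "\<lambda>x. indicator K' x *\<^sub>R C"])
    show "integrable lborel (\<lambda>x. indicator K' x *\<^sub>R C)"
      by (rule borel_integrable_compact[OF cK']) auto
    show "(\<lambda>x. \<psi>' x v) \<in> borel_measurable lborel" using cont borel_measurable_continuous_onI by auto
    show "q n \<in> borel_measurable lborel" for n
    proof -
      have "continuous_on UNIV (q n)" unfolding q_def
        by (intro continuous_intros continuous_on_compose2[OF cpsi]) auto
      then show ?thesis using borel_measurable_continuous_onI by auto
    qed
    show "AE x in lborel. norm (q n x) \<le> indicator K' x *\<^sub>R C" for n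
    proof (rule AE_I2)
      fix x
      show "norm (q n x) \<le> indicator K' x *\<^sub>R C"
      proof (cases "x \<in> K'")
        case True
        have "norm (q n x) = norm (\<psi> (x + t n *\<^sub>R v) - \<psi> x) / t n"
          using t[of n] by (simp add: q_def divide_inverse mult.commute)
        also have "\<dots> \<le> C * t n / t n"
          using t[of n] by (intro divide_right_mono norm_directional_difference_le[OF der C]) auto
        finally show ?thesis using True t[of n] by simp
      qed (simp add: qout)
    qed
    show "AE x in lborel. (\<lambda>n. q n x) \<longlonglongrightarrow> \<psi>' x v"
    proof (rule AE_I2)
      fix x
      have 1: "((\<lambda>s::real. x + s *\<^sub>R v) has_derivative (\<lambda>h. h *\<^sub>R v)) (at 0)"
        by (auto intro!: derivative_eq_intros)
      have d: "(\<psi> has_derivative \<psi>' x) (at (x + 0 *\<^sub>R v))" using der by simp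
      have "((\<lambda>s. \<psi> (x + s *\<^sub>R v)) has_derivative (\<lambda>h. \<psi>' x (h *\<^sub>R v))) (at 0)"
        by (rule has_derivative_compose[OF 1 d])
      then have "((\<lambda>s. \<psi> (x + s *\<^sub>R v)) has_vector_derivative \<psi>' x v) (at 0)"
        by (simp add: has_vector_derivative_def linear_cmul[OF has_derivative_linear[OF der]])
      then have "((\<lambda>s. norm (\<psi> (x + s *\<^sub>R v) - \<psi> x - s *\<^sub>R \<psi>' x v) / norm s) \<longlongrightarrow> 0) (at 0)"
        by (simp add: has_vector_derivative_def has_derivative_at)
      moreover have "\<forall>\<^sub>F s in at 0. norm (\<psi> (x + s *\<^sub>R v) - \<psi> x - s *\<^sub>R \<psi>' x v) / norm s
          = norm ((\<psi> (x + s *\<^sub>R v) - \<psi> x) /\<^sub>R s - \<psi>' x v)"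
        using eventually_neq_at_within[of "0::real"]
      proof eventually_elim
        case (elim s)
        have "\<psi> (x + s *\<^sub>R v) - \<psi> x - s *\<^sub>R \<psi>' x v = s *\<^sub>R ((\<psi> (x + s *\<^sub>R v) - \<psi> x) /\<^sub>R s - \<psi>' x v)"
          using elim by (simp add: scaleR_diff_right)
        then show ?case using elim by (metis norm_scaleR nonzero_mult_div_cancel_left norm_eq_zero real_norm_def)
      qed
      ultimately have "((\<lambda>s. norm ((\<psi> (x + s *\<^sub>R v) - \<psi> x) /\<^sub>R s - \<psi>' x v)) \<longlongrightarrow> 0) (at 0)"
        by (rule Lim_transform_eventually)
      then have lim: "((\<lambda>s. (\<psi> (x + s *\<^sub>R v) - \<psi> x) /\<^sub>R s) \<longlongrightarrow> \<psi>' x v) (at 0)"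
        using LIM_zero_cancel tendsto_norm_zero_iff by blast
      have "filterlim t (at 0) sequentially"
        unfolding filterlim_at using tl t(1) by (auto simp: less_imp_neq[THEN not_sym])
      from filterlim_compose[OF lim this] show "(\<lambda>n. q n x) \<longlonglongrightarrow> \<psi>' x v" by (simp add: q_def)
    qed
  qed
  then show "(LINT x|lborel. \<psi>' x v) = 0" by (simp add: int0 LIMSEQ_const_iff)
qed

lemma mat_vector_mult: "mat c *v x = c *s (x :: complex^'n)"
  by (simp add: matrix_vector_mult_def mat_def vec_eq_iff if_distrib[of "\<lambda>c. c * _"] cong: if_cong)

lemma lborel_distr_phase:
  assumes "cmod c = 1"
  shows "distr lborel borel (\<lambda>x :: complex^'n::finite. c *s x) = lborel"
proof -
  have "det (mat c :: complex^'n^'n) = c ^ CARD('n)"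
    by (subst det_diagonal) (auto simp: mat_def)
  then have "cmod (det (mat c :: complex^'n^'n)) = 1" by (simp add: norm_power assms)
  from lborel_distr_unimodular[OF this] show ?thesis by (simp add: mat_vector_mult[abs_def])
qed

lemma bounded_bilinear_complex_scale: "bounded_bilinear (\<lambda>s (v :: complex^'n). s *s v)"
  by (rule bounded_bilinear.intro)
     (auto simp: vec_eq_iff algebra_simps norm_complex_scale intro!: exI[of _ 1])

lemma circle_mean_value:
  assumes "f holomorphic_on U" "open U" "cball 0 1 \<subseteq> U"
  shows "integral {0..1} (\<lambda>t. f (exp (2 * of_real pi * \<i> * of_real t))) = f 0"
proof -
  have "((\<lambda>u. f u / (u - 0)) has_contour_integral 2 * of_real pi * \<i> * f 0) (circlepath 0 1)"
    using assms
    by (intro Cauchy_integral_circlepath_simple) (auto intro: holomorphic_on_subset)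
  then have "((\<lambda>t. f (circlepath 0 1 t) / (circlepath 0 1 t - 0) * vector_derivative (circlepath 0 1) (at t within {0..1}))
      has_integral 2 * of_real pi * \<i> * f 0) {0..1}"
    by (simp add: has_contour_integral_def)
  then have "((\<lambda>t. (2 * of_real pi * \<i>) * f (exp (2 * of_real pi * \<i> * of_real t))) has_integral (2 * of_real pi * \<i>) * f 0) {0..1}"
  proof (rule has_integral_eq[rotated])
    fix t :: real assume "t \<in> {0..1}"
    then show "f (circlepath 0 1 t) / (circlepath 0 1 t - 0) * vector_derivative (circlepath 0 1) (at t within {0..1})
      = (2 * of_real pi * \<i>) * f (exp (2 * of_real pi * \<i> * of_real t))"
      by (subst vector_derivative_circlepath01) (auto simp: circlepath)
  qed
  then have "((\<lambda>t. f (exp (2 * of_real pi * \<i> * of_real t))) has_integral f 0) {0..1}"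
    by (subst (asm) has_integral_mult_right_iff) auto
  then show ?thesis by (rule integral_unique)
qed

text \<open>
  The rotations \<open>x \<mapsto> exp (2 * pi * \<i> * t) *s x\<close> preserve Lebesgue measure and the weight. Averaging
  over \<open>t\<close> and exchanging the integrals reduces the claim to the mean value property on circles
  in the complex lines through \<open>p\<close>.
\<close>

lemma radial_mean_value:
  fixes h :: "complex^'n::finite \<Rightarrow> complex" and w :: "real \<Rightarrow> real"
  assumes h: "holomorphic_fun h D" "open D" and ball: "cball p \<epsilon> \<subseteq> D"
    and w: "continuous_on UNIV w"
  shows "(LINT x:cball p \<epsilon>|lborel. h x * of_real (w (norm (x - p)))) =
    h p * of_real (LINT x:cball (0::complex^'n) \<epsilon>|lborel. w (norm x))"
proof -
  let ?B = "cball (0::complex^'n) \<epsilon>"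
  have inD: "p + y \<in> D" if "norm y \<le> \<epsilon>" for y using subsetD[OF ball, of "p + y"] that by (simp add: dist_norm)
  define g where "g x = indicator ?B x *\<^sub>R (h (p + x) * of_real (w (norm x)))" for x
  have conth: "continuous_on D h" using h(1) by (rule holomorphic_fun_imp_continuous_on)
  have cg: "continuous_on ?B (\<lambda>x. h (p + x) * of_real (w (norm x)))"
    by (intro continuous_intros continuous_on_compose2[OF conth] continuous_on_compose2[OF w])
       (use ball in auto)
  have gi: "integrable lborel g" unfolding g_def by (rule borel_integrable_compact[OF compact_cball cg])
  have gm: "g \<in> borel_measurable borel" using gi by auto
  define e where "e t = exp (2 * of_real pi * \<i> * of_real t)" for t :: real
  have e1: "cmod (e t) = 1" for t by (simp add: e_def)
  have ce: "continuous_on S e" for S unfolding e_def by (intro continuous_intros)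
  have rot: "(LINT x|lborel. g (e t *s x)) = (LINT x|lborel. g x)" for t
  proof -
    have m: "(\<lambda>x :: complex^'n. e t *s x) \<in> borel_measurable borel"
      by (intro borel_measurable_continuous_onI linear_continuous_on bounded_linear_complex_scale_right)
    show ?thesis
      using integral_distr[of "\<lambda>x. e t *s x" lborel borel g] gm m by (simp add: lborel_distr_phase[OF e1])
  qed
  define F where "F = (\<lambda>(t, x). h (p + e t *s x) * complex_of_real (w (norm x)))"
  have Fc: "continuous_on ({0..1} \<times> ?B) F"
  proof -
    have "continuous_on ({0..1} \<times> ?B) (\<lambda>z. e (fst z) *s (snd z :: complex^'n))"
      by (intro bounded_bilinear.continuous_on[OF bounded_bilinear_complex_scale] continuous_on_compose2[OF ce] continuous_intros) auto
    then show ?thesis unfolding F_def case_prod_unfold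
      by (intro continuous_intros continuous_on_compose2[OF conth] continuous_on_compose2[OF w])
         (auto intro!: inD simp: norm_complex_scale e1)
  qed
  define \<Phi> where "\<Phi> = (\<lambda>(t, x). indicator ({0..1} \<times> ?B) (t, x) *\<^sub>R F (t, x))"
  have \<Phi>i: "integrable (lborel \<Otimes>\<^sub>M lborel) \<Phi>"
    unfolding lborel_prod \<Phi>_def using borel_integrable_compact[OF compact_Times[OF compact_Icc compact_cball] Fc]
    by (simp add: case_prod_unfold)
  have \<Phi>1: "\<Phi> (t, x) = indicator {0..1} t *\<^sub>R g (e t *s x)" for t x
    by (auto simp: \<Phi>_def F_def g_def norm_complex_scale e1 indicator_def)
  have "(LINT t|lborel. LINT x|lborel. \<Phi> (t, x)) = (LINT x|lborel. g x)"
  proof -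
    have "(LINT x|lborel. \<Phi> (t, x)) = indicator {0..1} t *\<^sub>R (LINT x|lborel. g x)" for t
      unfolding \<Phi>1 by (simp add: rot)
    then show ?thesis by simp
  qed
  moreover have "(LINT x|lborel. LINT t|lborel. \<Phi> (t, x)) = h p * of_real (LINT x:?B|lborel. w (norm x))"
  proof -
    have "(\<lambda>x. LINT t|lborel. \<Phi> (t, x)) = (\<lambda>x. indicator ?B x *\<^sub>R (h p * of_real (w (norm x))))"
    proof (rule ext)
      fix x
      show "(LINT t|lborel. \<Phi> (t, x)) = indicator ?B x *\<^sub>R (h p * of_real (w (norm x)))"
      proof (cases "x \<in> ?B")
        case True
        have sx: "cmod s * norm x \<le> \<epsilon>" if "cmod s \<le> 1" for s
          using mult_right_mono[OF that norm_ge_zero[of x]] True by simp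
        have c: "continuous_on {0..1} (\<lambda>t. h (p + e t *s x))"
          by (intro continuous_on_compose2[OF conth] continuous_intros bounded_linear.continuous_on[OF bounded_linear_complex_scale_left] ce)
             (use True in \<open>auto intro!: inD simp: norm_complex_scale e1\<close>)
        have "(LINT t|lborel. \<Phi> (t, x)) = (LINT t:{0..1}|lborel. h (p + e t *s x)) * of_real (w (norm x))"
          using True by (simp add: \<Phi>_def F_def set_lebesgue_integral_def indicator_def if_distrib cong: if_cong flip: integral_mult_left_zero) 
        also have "(LINT t:{0..1}|lborel. h (p + e t *s x)) = integral {0..1} (\<lambda>t. h (p + e t *s x))"
          by (rule set_borel_integral_eq_integral(2)) (rule borel_integrable_atLeastAtMost'[OF c])
        also have "\<dots> = h (p + 0 *s x)"
          unfolding e_def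
          by (rule circle_mean_value[OF holomorphic_fun_on_line[OF h] open_line_preimage[OF h(2)]])
             (auto intro!: inD sx simp: norm_complex_scale)
        finally show ?thesis using True by simp
      qed (simp add: \<Phi>_def)
    qed
    also have "(\<lambda>x. indicator ?B x *\<^sub>R (h p * complex_of_real (w (norm x))))
        = (\<lambda>x. h p * complex_of_real (indicator ?B x * w (norm x)))"
      by (auto simp: fun_eq_iff split: split_indicator)
    finally show ?thesis
      unfolding set_lebesgue_integral_def real_scaleR_def
      by (simp only: integral_mult_right_zero integral_complex_of_real)
  qed
  moreover have "(LINT x|lborel. LINT t|lborel. \<Phi> (t, x)) = (LINT t|lborel. LINT x|lborel. \<Phi> (t, x))"
    using lborel_pair.Fubini_integral[of "\<lambda>t x. \<Phi> (t, x)"] \<Phi>i by simp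
  moreover have "(LINT x|lborel. g x) = (LINT x:cball p \<epsilon>|lborel. h x * of_real (w (norm (x - p))))"
  proof -
    have m: "(\<lambda>x. indicator (cball p \<epsilon>) x *\<^sub>R (h x * of_real (w (norm (x - p))))) \<in> borel_measurable borel"
    proof -
      have "integrable lborel (\<lambda>x. indicator (cball p \<epsilon>) x *\<^sub>R (h x * of_real (w (norm (x - p)))))"
        by (intro borel_integrable_compact compact_cball continuous_intros continuous_on_subset[OF conth ball]
            continuous_on_compose2[OF w]) auto
      then show ?thesis by auto
    qed
    show ?thesis
      unfolding set_lebesgue_integral_def
      by (subst integral_lborel_translate[OF m, of p, symmetric])
         (auto simp: g_def indicator_def dist_norm intro!: Bochner_Integration.integral_cong)
  qed
  ultimately show ?thesis by simp
qed

section \<open>Weighted Bergman spaces\<close>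

text \<open>
  Lebesgue measure itself is used throughout; a constant factor in the reference measure enters
  only when the kernels are compared with their definition.
\<close>

locale weighted_domain =
  fixes D :: "(complex^'n::finite) set" and \<nu> :: "complex^'n \<Rightarrow> real"
  assumes open_D: "open D" and cont_weight: "continuous_on D \<nu>" and weight_pos: "\<And>z. z \<in> D \<Longrightarrow> \<nu> z > 0"
begin

definition A2 :: "(complex^'n \<Rightarrow> complex) set"
  where "A2 = {h. holomorphic_fun h D \<and> set_integrable lborel D (\<lambda>z. (cmod (h z))\<^sup>2 * \<nu> z)}"

definition ip :: "(complex^'n \<Rightarrow> complex) \<Rightarrow> (complex^'n \<Rightarrow> complex) \<Rightarrow> complex"
  where "ip g h = (LINT z:D|lborel. g z * cnj (h z) * complex_of_real (\<nu> z))"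

definition nsq :: "(complex^'n \<Rightarrow> complex) \<Rightarrow> real"
  where "nsq h = (LINT z:D|lborel. (cmod (h z))\<^sup>2 * \<nu> z)"

lemma A2_holomorphic: "h \<in> A2 \<Longrightarrow> holomorphic_fun h D" by (simp add: A2_def)
lemma A2_continuous: "h \<in> A2 \<Longrightarrow> continuous_on D h"
  using A2_holomorphic holomorphic_fun_imp_continuous_on by blast
lemma A2_integrable: "h \<in> A2 \<Longrightarrow> set_integrable lborel D (\<lambda>z. (cmod (h z))\<^sup>2 * \<nu> z)"
  by (simp add: A2_def)

lemma measurable_on_D:
  fixes g :: "complex^'n \<Rightarrow> 'b::real_normed_vector"
  shows "continuous_on D g \<Longrightarrow> (\<lambda>z. indicator D z *\<^sub>R g z) \<in> borel_measurable borel"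
  using borel_measurable_continuous_on_indicator[of D g] open_D by simp

lemma measurable_on_D_real:
  fixes g :: "complex^'n \<Rightarrow> real"
  shows "continuous_on D g \<Longrightarrow> (\<lambda>z. indicator D z * g z) \<in> borel_measurable borel"
  using measurable_on_D[of g] by simp

lemma measurable_square_on_D:
  fixes g :: "complex^'n \<Rightarrow> complex"
  assumes "continuous_on D g"
  shows "(\<lambda>z. indicator D z * ((cmod (g z))\<^sup>2 * \<nu> z)) \<in> borel_measurable lborel"
  by (simp, intro measurable_on_D_real continuous_intros assms cont_weight)

lemma set_integrable_product:
  assumes "g \<in> A2" "h \<in> A2"
  shows "set_integrable lborel D (\<lambda>z. g z * cnj (h z) * complex_of_real (\<nu> z))"
proof (rule set_integrable_bound)
  show "set_integrable lborel D (\<lambda>z. (cmod (g z))\<^sup>2 * \<nu> z + (cmod (h z))\<^sup>2 * \<nu> z)"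
    using assms by (intro set_integral_add A2_integrable)
  show "set_borel_measurable lborel D (\<lambda>z. g z * cnj (h z) * complex_of_real (\<nu> z))"
    unfolding set_borel_measurable_def using assms
    by (simp, intro measurable_on_D continuous_intros A2_continuous[OF assms(1)] A2_continuous[OF assms(2)] cont_weight)
  show "AE x in lborel. x \<in> D \<longrightarrow> norm (g x * cnj (h x) * complex_of_real (\<nu> x))
      \<le> norm ((cmod (g x))\<^sup>2 * \<nu> x + (cmod (h x))\<^sup>2 * \<nu> x)"
  proof (intro AE_I2 impI)
    fix x assume "x \<in> D"
    then have p: "\<nu> x > 0" by (rule weight_pos)
    have "cmod (g x) * cmod (h x) \<le> (cmod (g x))\<^sup>2 + (cmod (h x))\<^sup>2"
      using sum_squares_bound[of "cmod (g x)" "cmod (h x)"]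
        mult_nonneg_nonneg[OF norm_ge_zero[of "g x"] norm_ge_zero[of "h x"]]
      unfolding mult.assoc by linarith
    then have "cmod (g x) * cmod (h x) * \<nu> x \<le> ((cmod (g x))\<^sup>2 + (cmod (h x))\<^sup>2) * \<nu> x"
      using p by (intro mult_right_mono) auto
    then show "norm (g x * cnj (h x) * complex_of_real (\<nu> x)) \<le> norm ((cmod (g x))\<^sup>2 * \<nu> x + (cmod (h x))\<^sup>2 * \<nu> x)"
      using p by (simp add: norm_mult algebra_simps)
  qed
qed

lemma A2_cmult: "h \<in> A2 \<Longrightarrow> (\<lambda>z. c * h z) \<in> A2"
  unfolding A2_def
  by (auto intro: holomorphic_fun_cmult simp: norm_mult power_mult_distrib mult.assoc)

lemma A2_add: assumes "g \<in> A2" "h \<in> A2" shows "(\<lambda>z. g z + h z) \<in> A2"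
proof -
  have "set_integrable lborel D (\<lambda>z. (cmod (g z + h z))\<^sup>2 * \<nu> z)"
  proof (rule set_integrable_bound)
    show "set_integrable lborel D (\<lambda>z. 2 * ((cmod (g z))\<^sup>2 * \<nu> z + (cmod (h z))\<^sup>2 * \<nu> z))"
      using assms by (intro set_integrable_mult_right set_integral_add A2_integrable) auto
    show "set_borel_measurable lborel D (\<lambda>z. (cmod (g z + h z))\<^sup>2 * \<nu> z)"
      unfolding set_borel_measurable_def using assms
      by (simp, intro measurable_on_D_real continuous_intros A2_continuous[OF assms(1)] A2_continuous[OF assms(2)] cont_weight)
    show "AE x in lborel. x \<in> D \<longrightarrow> norm ((cmod (g x + h x))\<^sup>2 * \<nu> x)
      \<le> norm (2 * ((cmod (g x))\<^sup>2 * \<nu> x + (cmod (h x))\<^sup>2 * \<nu> x))"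
    proof (intro AE_I2 impI)
      fix x assume "x \<in> D"
      then have p: "\<nu> x > 0" by (rule weight_pos)
      have "(cmod (g x + h x))\<^sup>2 \<le> (cmod (g x) + cmod (h x))\<^sup>2"
        by (intro power_mono norm_triangle_ineq) simp
      also have "\<dots> \<le> 2 * ((cmod (g x))\<^sup>2 + (cmod (h x))\<^sup>2)"
        using sum_squares_bound[of "cmod (g x)" "cmod (h x)"] by (simp add: power2_sum)
      finally have "(cmod (g x + h x))\<^sup>2 * \<nu> x \<le> (2 * ((cmod (g x))\<^sup>2 + (cmod (h x))\<^sup>2)) * \<nu> x"
        using p by (intro mult_right_mono) auto
      then show "norm ((cmod (g x + h x))\<^sup>2 * \<nu> x) \<le> norm (2 * ((cmod (g x))\<^sup>2 * \<nu> x + (cmod (h x))\<^sup>2 * \<nu> x))"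
        using p by (simp add: algebra_simps abs_of_nonneg)
    qed
  qed
  then show ?thesis using assms by (simp add: A2_def holomorphic_fun_add)
qed

lemma A2_zero: "(\<lambda>z. 0) \<in> A2"
  by (simp add: A2_def holomorphic_fun_const set_integrable_def)

lemma A2_diff: assumes "g \<in> A2" "h \<in> A2" shows "(\<lambda>z. g z - h z) \<in> A2"
  using A2_add[OF assms(1) A2_cmult[OF assms(2), of "-1"]] by simp

lemma A2_sum: "(\<And>i. i \<in> I \<Longrightarrow> h i \<in> A2) \<Longrightarrow> (\<lambda>z. \<Sum>i\<in>I. h i z) \<in> A2"
  by (induction I rule: infinite_finite_induct) (auto intro: A2_zero A2_add)

lemma A2_cong: "h \<in> A2 \<Longrightarrow> (\<And>z. z \<in> D \<Longrightarrow> h z = k z) \<Longrightarrow> k \<in> A2"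
  unfolding A2_def using open_D
  by (auto intro: holomorphic_fun_cong elim!: set_integrable_cong[THEN iffD1, rotated -1])

lemma ip_cong: "(\<And>z. z \<in> D \<Longrightarrow> g z = g' z) \<Longrightarrow> (\<And>z. z \<in> D \<Longrightarrow> h z = h' z) \<Longrightarrow> ip g h = ip g' h'"
  unfolding ip_def using open_D by (intro set_lebesgue_integral_cong) auto

lemma ip_add_left: "g \<in> A2 \<Longrightarrow> g' \<in> A2 \<Longrightarrow> h \<in> A2 \<Longrightarrow> ip (\<lambda>z. g z + g' z) h = ip g h + ip g' h"
  using set_integral_add(2)[OF set_integrable_product[of g h] set_integrable_product[of g' h]]
  by (simp add: ip_def distrib_right)

lemma ip_cmult_left: "ip (\<lambda>z. c * g z) h = c * ip g h"
  unfolding ip_def by (subst set_integral_mult_right[symmetric]) (simp add: mult_ac)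

lemma ip_hermitian: "ip h g = cnj (ip g h)"
proof -
  have "(\<lambda>x. indicat_real D x *\<^sub>R (h x * cnj (g x) * complex_of_real (\<nu> x)))
      = (\<lambda>x. cnj (indicat_real D x *\<^sub>R (g x * cnj (h x) * complex_of_real (\<nu> x))))"
    by (simp add: fun_eq_iff mult_ac)
  then show ?thesis
    unfolding ip_def set_lebesgue_integral_def by (simp only: Bochner_Integration.integral_cnj)
qed

lemma ip_cmult_right: "ip g (\<lambda>z. c * h z) = cnj c * ip g h"
  using ip_hermitian[of g] ip_cmult_left[of c h g] by (metis complex_cnj_mult)

lemma ip_add_right: "g \<in> A2 \<Longrightarrow> h \<in> A2 \<Longrightarrow> h' \<in> A2 \<Longrightarrow> ip g (\<lambda>z. h z + h' z) = ip g h + ip g h'"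
  using ip_add_left[of h h' g] ip_hermitian[of g] by (metis complex_cnj_add)

lemma ip_zero_right: "ip g (\<lambda>z. 0) = 0"
  by (simp add: ip_def)

lemma ip_sum_right:
  "g \<in> A2 \<Longrightarrow> (\<And>i. i \<in> I \<Longrightarrow> h i \<in> A2) \<Longrightarrow> ip g (\<lambda>z. \<Sum>i\<in>I. h i z) = (\<Sum>i\<in>I. ip g (h i))"
  by (induction I rule: infinite_finite_induct) (auto simp: ip_zero_right ip_add_right A2_sum)

lemma ip_self: "ip h h = of_real (nsq h)"
  unfolding ip_def nsq_def set_lebesgue_integral_def
  by (subst integral_complex_of_real[symmetric], intro Bochner_Integration.integral_cong)
     (auto simp: complex_norm_square[symmetric] split: split_indicator)

lemma nsq_nonneg: "nsq h \<ge> 0"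
  unfolding nsq_def set_lebesgue_integral_def
  by (intro integral_nonneg_AE) (auto simp: weight_pos less_imp_le split: split_indicator)

lemma nsq_add:
  assumes "g \<in> A2" "h \<in> A2"
  shows "nsq (\<lambda>z. g z + h z) = nsq g + nsq h + 2 * Re (ip h g)"
proof -
  have "complex_of_real (nsq (\<lambda>z. g z + h z)) = ip g g + ip h h + (ip h g + cnj (ip h g))"
    unfolding ip_self[symmetric] using assms ip_hermitian[of g h]
    by (simp add: ip_add_left ip_add_right A2_add)
  also have "\<dots> = complex_of_real (nsq g + nsq h + 2 * Re (ip h g))"
    by (simp only: ip_self complex_add_cnj of_real_add)
  finally show ?thesis using of_real_eq_iff by blast
qed

lemma nsq_cmult: "nsq (\<lambda>z. c * h z) = (cmod c)\<^sup>2 * nsq h"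
  unfolding nsq_def by (simp add: norm_mult power_mult_distrib mult.assoc)

lemma nsq_parallelogram:
  assumes "g \<in> A2" "h \<in> A2"
  shows "nsq (\<lambda>z. g z - h z) = 2 * nsq g + 2 * nsq h - nsq (\<lambda>z. g z + h z)"
proof -
  have "nsq (\<lambda>z. g z + (- 1) * h z) = nsq g + nsq (\<lambda>z. (- 1) * h z) + 2 * Re (ip (\<lambda>z. (- 1) * h z) g)"
    by (rule nsq_add[OF assms(1) A2_cmult[OF assms(2)]])
  then show ?thesis unfolding nsq_cmult ip_cmult_left using nsq_add[OF assms] by simp
qed

text \<open>
  The mean value property for \<open>h^2\<close> on a ball of fixed radius, together with a positive lower bound
  of the weight near \<open>p\<close>.
\<close>

lemma evaluation_bound:
  assumes "p \<in> D"
  obtains r C where "r > 0" "cball p r \<subseteq> D" "C \<ge> 0"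
    "\<And>q h. q \<in> cball p r \<Longrightarrow> h \<in> A2 \<Longrightarrow> (cmod (h q))\<^sup>2 \<le> C * nsq h"
proof -
  obtain e where e: "e > 0" "cball p e \<subseteq> D" using open_D assms open_contains_cball by blast
  define r where "r = e / 2"
  have r: "r > 0" using e by (simp add: r_def)
  have "continuous_on (cball p e) \<nu>" using cont_weight e(2) by (rule continuous_on_subset)
  then obtain x where x: "x \<in> cball p e" "\<And>y. y \<in> cball p e \<Longrightarrow> \<nu> x \<le> \<nu> y"
    using continuous_attains_inf[of "cball p e" \<nu>] e(1) by auto
  define m where "m = \<nu> x"
  have m: "m \<le> \<nu> y" if "y \<in> cball p e" for y using x(2)[OF that] by (simp add: m_def)
  have m0: "m > 0" unfolding m_def using x(1) e(2) by (intro weight_pos) blast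
  define v where "v = measure lborel (cball (0::complex^'n) r)"
  have v: "v > 0" unfolding v_def using r by (simp add: content_cball_pos)
  show ?thesis
  proof (rule that[of r "1 / (v * m)"])
    show "cball p r \<subseteq> D" using e by (auto simp: r_def)
    fix q h assume q: "q \<in> cball p r" and h: "h \<in> A2"
    have sub: "cball q r \<subseteq> cball p e"
    proof
      fix x assume "x \<in> cball q r"
      then show "x \<in> cball p e"
        using q dist_triangle[of p x q] by (simp add: r_def)
    qed
    have subD: "cball q r \<subseteq> D" using sub e by blast
    have hol: "holomorphic_fun (\<lambda>z. h z * h z) D"
      using h by (intro holomorphic_fun_mult A2_holomorphic)
    have "(LINT x:cball q r|lborel. (h x * h x) * of_real 1) = (h q * h q) * of_real (LINT x:cball (0::complex^'n) r|lborel. 1)"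
      by (rule radial_mean_value[OF hol open_D subD]) auto
    moreover have "(LINT x:cball (0::complex^'n) r|lborel. (1::real)) = v"
      unfolding v_def set_lebesgue_integral_def by simp
    ultimately have eq: "(LINT x:cball q r|lborel. h x * h x) = (h q * h q) * of_real v" by simp
    have i1: "set_integrable lborel (cball q r) (\<lambda>x. (cmod (h x))\<^sup>2)"
      unfolding set_integrable_def
      by (intro borel_integrable_compact compact_cball continuous_intros continuous_on_subset[OF A2_continuous[OF h] subD])
    have "(cmod (h q))\<^sup>2 * v = cmod (LINT x:cball q r|lborel. h x * h x)"
      using v by (simp add: eq norm_mult power2_eq_square)
    also have "\<dots> \<le> (LINT x:cball q r|lborel. (cmod (h x))\<^sup>2)"
    proof -
      have "cmod (LINT x:cball q r|lborel. h x * h x) \<le> (LINT x|lborel. norm (indicator (cball q r) x *\<^sub>R (h x * h x)))"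
        unfolding set_lebesgue_integral_def by (rule integral_norm_bound)
      also have "\<dots> = (LINT x:cball q r|lborel. (cmod (h x))\<^sup>2)"
        unfolding set_lebesgue_integral_def
        by (intro Bochner_Integration.integral_cong) (auto simp: norm_mult power2_eq_square)
      finally show ?thesis .
    qed
    finally have "m * ((cmod (h q))\<^sup>2 * v) \<le> m * (LINT x:cball q r|lborel. (cmod (h x))\<^sup>2)"
      using m0 by (intro mult_left_mono) auto
    also have "\<dots> = (LINT x:cball q r|lborel. m * (cmod (h x))\<^sup>2)"
      by (simp add: set_integral_mult_right)
    also have "\<dots> \<le> nsq h"
      unfolding nsq_def set_lebesgue_integral_def
    proof (rule integral_mono)
      show "integrable lborel (\<lambda>x. indicat_real (cball q r) x *\<^sub>R (m * (cmod (h x))\<^sup>2))"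
        using i1 unfolding set_integrable_def by (auto simp: mult.left_commute[of _ m])
      show "integrable lborel (\<lambda>x. indicat_real D x *\<^sub>R ((cmod (h x))\<^sup>2 * \<nu> x))"
        using A2_integrable[OF h] by (simp add: set_integrable_def)
      fix x
      show "indicat_real (cball q r) x *\<^sub>R (m * (cmod (h x))\<^sup>2) \<le> indicat_real D x *\<^sub>R ((cmod (h x))\<^sup>2 * \<nu> x)"
      proof (cases "x \<in> cball q r")
        case True
        then have "m \<le> \<nu> x" "x \<in> D" using sub subD m by auto
        then have "m * (cmod (h x))\<^sup>2 \<le> \<nu> x * (cmod (h x))\<^sup>2" by (intro mult_right_mono) auto
        then show ?thesis using True \<open>x \<in> D\<close> by (simp add: mult.commute)
      next
        case False
        then show ?thesis using weight_pos[of x] by (auto simp: indicator_def less_imp_le)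
      qed
    qed
    finally show "(cmod (h q))\<^sup>2 \<le> 1 / (v * m) * nsq h"
      using v m0 by (simp add: field_simps)
  qed (use r v m0 in auto)
qed

lemma nsq_eq_0: assumes "h \<in> A2" "nsq h = 0" "z \<in> D" shows "h z = 0"
proof -
  obtain r C where "r > 0" "cball z r \<subseteq> D" "C \<ge> 0"
    and b: "\<And>q h. q \<in> cball z r \<Longrightarrow> h \<in> A2 \<Longrightarrow> (cmod (h q))\<^sup>2 \<le> C * nsq h"
    by (rule evaluation_bound[OF assms(3)]) (rule that)
  from b[of z h] \<open>r > 0\<close> assms show ?thesis by simp
qed

lemma reproducing_unique:
  assumes "k \<in> A2" "k' \<in> A2" "\<And>h. h \<in> A2 \<Longrightarrow> ip h k = ip h k'" "z \<in> D"
  shows "k z = k' z"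
proof -
  let ?d = "\<lambda>z. k z - k' z"
  have d: "?d \<in> A2" using assms by (intro A2_diff)
  have "ip ?d ?d = ip ?d k + ip ?d (\<lambda>z. (-1) * k' z)"
    using ip_add_right[OF d assms(1) A2_cmult[OF assms(2), of "-1"]] by simp
  also have "\<dots> = 0" unfolding ip_cmult_right using assms(3)[OF d] by simp
  finally have "nsq ?d = 0" unfolding ip_self by simp
  from nsq_eq_0[OF d this assms(4)] show ?thesis by simp
qed

text \<open>
  If some element of the space does not vanish at \<open>w\<close>, let \<open>h\<close> have minimal norm among those with
  \<open>h w = 1\<close>. Comparing \<open>h\<close> with \<open>h + c * g\<close> shows that \<open>h\<close> is orthogonal to every \<open>g\<close> vanishing at
  \<open>w\<close>, so \<open>h\<close> divided by its squared norm represents the evaluation at \<open>w\<close>. A minimizing sequence is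
  Cauchy by the parallelogram law and converges locally uniformly by the evaluation bound.
\<close>

lemma reproducing_exists:
  assumes w: "w \<in> D"
  obtains k where "k \<in> A2" "\<And>h. h \<in> A2 \<Longrightarrow> ip h k = h w"
proof (cases "\<forall>h\<in>A2. h w = 0")
  case True
  then show ?thesis using that[OF A2_zero] by (simp add: ip_zero_right)
next
  case False
  then obtain h0 where h0: "h0 \<in> A2" "h0 w \<noteq> 0" by blast
  define S where "S = {h \<in> A2. h w = 1}"
  have Sne: "S \<noteq> {}" using A2_cmult[OF h0(1), of "1 / h0 w"] h0(2) by (auto simp: S_def)
  define m where "m = (INF h\<in>S. nsq h)"
  have bdd: "bdd_below (nsq ` S)" using nsq_nonneg by (intro bdd_belowI[of _ 0]) auto
  have mle: "m \<le> nsq h" if "h \<in> S" for h unfolding m_def by (rule cINF_lower[OF bdd that])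
  have "\<exists>h\<in>S. nsq h < m + 1 / (real n + 1)" for n
    using cINF_less_iff[OF Sne bdd, of "m + 1 / (real n + 1)"] by (simp add: m_def)
  then obtain hs where hs: "\<And>n. hs n \<in> S" and hm: "\<And>n. nsq (hs n) < m + 1 / (real n + 1)" by metis
  have hA: "hs n \<in> A2" and hw: "hs n w = 1" for n using hs[of n] by (auto simp: S_def)
  have cau: "nsq (\<lambda>z. hs n z - hs k z) \<le> 2 / (real n + 1) + 2 / (real k + 1)" for n k
  proof -
    have "(\<lambda>z. (1/2) * (hs n z + hs k z)) \<in> S"
      unfolding S_def using A2_cmult[OF A2_add[OF hA[of n] hA[of k]], of "1/2"] hw by simp
    from mle[OF this] have "4 * m \<le> nsq (\<lambda>z. hs n z + hs k z)"
      unfolding nsq_cmult by (simp add: power2_eq_square)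
    moreover have two: "2 / (real i + 1) = 2 * (1 / (real i + 1))" for i by simp
    ultimately show ?thesis unfolding two
      using nsq_parallelogram[OF hA[of n] hA[of k]] hm[of n] hm[of k] by linarith
  qed
  define h where "h z = lim (\<lambda>n. hs n z)" for z
  have ul: "\<exists>r>0. ball p r \<subseteq> D \<and> uniform_limit (ball p r) hs h sequentially" if p: "p \<in> D" for p
  proof -
    obtain r C where r: "r > 0" "cball p r \<subseteq> D" "C \<ge> 0"
      and b: "\<And>q h. q \<in> cball p r \<Longrightarrow> h \<in> A2 \<Longrightarrow> (cmod (h q))\<^sup>2 \<le> C * nsq h"
      by (rule evaluation_bound[OF p]) (rule that)
    have "uniformly_Cauchy_on (ball p r) hs"
    proof (rule uniformly_Cauchy_onI)
      fix e :: real assume e: "e > 0"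
      have "(\<lambda>n. C * (4 / (real n + 1))) \<longlonglongrightarrow> 0" by real_asymp
      then have "\<forall>\<^sub>F n in sequentially. C * (4 / (real n + 1)) < e\<^sup>2"
        using e by (intro order_tendstoD(2)) auto
      then obtain M where M: "C * (4 / (real M + 1)) < e\<^sup>2"
        unfolding eventually_sequentially by blast
      show "\<exists>M. \<forall>x\<in>ball p r. \<forall>m\<ge>M. \<forall>n\<ge>M. dist (hs m x) (hs n x) < e"
      proof (intro exI[of _ M] ballI allI impI)
        fix x m n assume x: "x \<in> ball p r" and mn: "M \<le> m" "M \<le> n"
        have "(cmod (hs m x - hs n x))\<^sup>2 \<le> C * nsq (\<lambda>z. hs m z - hs n z)"
          using b[of x "\<lambda>z. hs m z - hs n z"] x A2_diff[OF hA hA] by simp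
        also have "\<dots> \<le> C * (2 / (real m + 1) + 2 / (real n + 1))"
          using cau r(3) by (intro mult_left_mono)
        also have "\<dots> \<le> C * (2 / (real M + 1) + 2 / (real M + 1))"
          using mn r(3) by (intro mult_left_mono add_mono divide_left_mono) auto
        also have "\<dots> < e\<^sup>2" using M by simp
        finally have "cmod (hs m x - hs n x) < e" using e by (rule_tac power2_less_imp_less) auto
        then show "dist (hs m x) (hs n x) < e" by (simp add: dist_norm)
      qed
    qed
    then have "uniformly_convergent_on (ball p r) hs" by (rule Cauchy_uniformly_convergent)
    then have "uniform_limit (ball p r) hs h sequentially"
      by (simp add: uniformly_convergent_uniform_limit_iff h_def[abs_def])
    then show ?thesis using r ball_subset_cball by (metis subset_trans)
  qed
  have holh: "holomorphic_fun h D"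
    by (rule holomorphic_fun_uniform_limit(1)[OF open_D A2_holomorphic[OF hA] ul])
  have lim: "(\<lambda>n. hs n z) \<longlonglongrightarrow> h z" if "z \<in> D" for z
    using ul[OF that] tendsto_uniform_limitI centre_in_ball by metis
  have hw1: "h w = 1" using lim[OF w] by (simp add: hw LIMSEQ_const_iff)
  \<comment> \<open>By Fatou's lemma, the norm does not increase in the limit.\<close>
  have meas: "(\<lambda>z. ennreal (indicator D z * ((cmod (g z))\<^sup>2 * \<nu> z))) \<in> borel_measurable lborel" if "continuous_on D g" for g :: "complex^'n \<Rightarrow> complex"
    by (rule measurable_compose[OF measurable_square_on_D[OF that] measurable_ennreal])
  have nn: "(\<integral>\<^sup>+z. ennreal (indicator D z * ((cmod (hs n z))\<^sup>2 * \<nu> z)) \<partial>lborel) = ennreal (nsq (hs n))" for n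
  proof -
    have "(\<integral>\<^sup>+z. ennreal (indicator D z * ((cmod (hs n z))\<^sup>2 * \<nu> z)) \<partial>lborel) = ennreal (LINT z|lborel. indicator D z * ((cmod (hs n z))\<^sup>2 * \<nu> z))"
      using A2_integrable[OF hA[of n]]
      by (intro nn_integral_eq_integral) (auto simp: set_integrable_def weight_pos less_imp_le split: split_indicator)
    then show ?thesis by (simp add: nsq_def set_lebesgue_integral_def)
  qed
  have "(\<integral>\<^sup>+z. ennreal (indicator D z * ((cmod (h z))\<^sup>2 * \<nu> z)) \<partial>lborel)
      = (\<integral>\<^sup>+z. liminf (\<lambda>n. ennreal (indicator D z * ((cmod (hs n z))\<^sup>2 * \<nu> z))) \<partial>lborel)"
  proof (intro nn_integral_cong)
    fix z
    have "(\<lambda>n. ennreal (indicator D z * ((cmod (hs n z))\<^sup>2 * \<nu> z))) \<longlonglongrightarrow> ennreal (indicator D z * ((cmod (h z))\<^sup>2 * \<nu> z))"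
      by (cases "z \<in> D") (auto intro!: tendsto_intros tendsto_ennrealI lim)
    then show "ennreal (indicator D z * ((cmod (h z))\<^sup>2 * \<nu> z)) = liminf (\<lambda>n. ennreal (indicator D z * ((cmod (hs n z))\<^sup>2 * \<nu> z)))"
      by (rule lim_imp_Liminf[OF sequentially_bot, symmetric])
  qed
  also have "\<dots> \<le> liminf (\<lambda>n. \<integral>\<^sup>+z. ennreal (indicator D z * ((cmod (hs n z))\<^sup>2 * \<nu> z)) \<partial>lborel)"
    by (intro nn_integral_liminf meas A2_continuous[OF hA])
  also have "\<dots> = liminf (\<lambda>n. ennreal (nsq (hs n)))" by (simp add: nn)
  also have "\<dots> \<le> liminf (\<lambda>n. ennreal (m + 1 / (real n + 1)))"
    by (intro Liminf_mono always_eventually allI ennreal_leI less_imp_le hm)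
  also have "\<dots> = ennreal m"
  proof -
    have "(\<lambda>n. m + 1 / (real n + 1)) \<longlonglongrightarrow> m" by real_asymp
    then show ?thesis by (intro lim_imp_Liminf[OF sequentially_bot] tendsto_ennrealI)
  qed
  finally have fat: "(\<integral>\<^sup>+z. ennreal (indicator D z * ((cmod (h z))\<^sup>2 * \<nu> z)) \<partial>lborel) \<le> ennreal m" .
  have m_nonneg: "m \<ge> 0" unfolding m_def using Sne nsq_nonneg by (intro cINF_greatest) auto
  have hA2: "h \<in> A2"
  proof -
    have "integrable lborel (\<lambda>z. indicator D z * ((cmod (h z))\<^sup>2 * \<nu> z))"
    proof (rule integrableI_bounded)
      show "(\<lambda>z. indicator D z * ((cmod (h z))\<^sup>2 * \<nu> z)) \<in> borel_measurable lborel"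
        by (rule measurable_square_on_D[OF holomorphic_fun_imp_continuous_on[OF holh]])
      have "(\<integral>\<^sup>+z. ennreal (norm (indicator D z * ((cmod (h z))\<^sup>2 * \<nu> z))) \<partial>lborel) = (\<integral>\<^sup>+z. ennreal (indicator D z * ((cmod (h z))\<^sup>2 * \<nu> z)) \<partial>lborel)"
        by (intro nn_integral_cong) (auto simp: weight_pos less_imp_le split: split_indicator)
      with fat show "(\<integral>\<^sup>+z. ennreal (norm (indicator D z * ((cmod (h z))\<^sup>2 * \<nu> z))) \<partial>lborel) < \<infinity>"
        using le_less_trans[OF fat] by simp
    qed
    then show ?thesis using holh by (simp add: A2_def set_integrable_def)
  qed
  have "ennreal (nsq h) \<le> ennreal m"
  proof -
    have "(\<integral>\<^sup>+z. ennreal (indicator D z * ((cmod (h z))\<^sup>2 * \<nu> z)) \<partial>lborel) = ennreal (LINT z|lborel. indicator D z * ((cmod (h z))\<^sup>2 * \<nu> z))"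
      using A2_integrable[OF hA2]
      by (intro nn_integral_eq_integral) (auto simp: set_integrable_def weight_pos less_imp_le split: split_indicator)
    then show ?thesis using fat by (simp add: nsq_def set_lebesgue_integral_def)
  qed
  then have "nsq h \<le> m" using m_nonneg by (simp add: ennreal_le_iff)
  have min: "nsq h \<le> nsq g" if "g \<in> S" for g using mle[OF that] \<open>nsq h \<le> m\<close> by simp
  have nh: "nsq h > 0"
    using nsq_eq_0[OF hA2 _ w] hw1 nsq_nonneg[of h] by fastforce
  have orth: "ip g h = 0" if g: "g \<in> A2" "g w = 0" for g
  proof -
    define \<epsilon> where "\<epsilon> = 1 / (1 + nsq g)"
    have ge: "1 + nsq g > 0" using nsq_nonneg[of g] by simp
    have \<epsilon>: "\<epsilon> > 0" "\<epsilon> * nsq g < 1" using ge by (auto simp: \<epsilon>_def field_simps)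
    define c where "c = - (of_real \<epsilon> * cnj (ip g h))"
    have "(\<lambda>z. h z + c * g z) \<in> S"
      unfolding S_def using A2_add[OF hA2 A2_cmult[OF g(1)]] hw1 g(2) by simp
    from min[OF this] have ineq: "0 \<le> (cmod c)\<^sup>2 * nsq g + 2 * Re (c * ip g h)"
      using nsq_add[OF hA2 A2_cmult[OF g(1), of c]] by (simp add: nsq_cmult ip_cmult_left)
    have "c * ip g h = - of_real (\<epsilon> * (cmod (ip g h))\<^sup>2)"
      unfolding c_def using complex_norm_square[of "ip g h"] by (simp add: mult_ac)
    then have re: "Re (c * ip g h) = - (\<epsilon> * (cmod (ip g h))\<^sup>2)"
      by (metis Re_complex_of_real uminus_complex.simps(1))
    have nc: "(cmod c)\<^sup>2 = \<epsilon>\<^sup>2 * (cmod (ip g h))\<^sup>2"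
      by (simp add: c_def norm_mult power_mult_distrib)
    have "0 \<le> \<epsilon> * (cmod (ip g h))\<^sup>2 * (\<epsilon> * nsq g - 2)"
      using ineq unfolding re nc by (simp add: algebra_simps power2_eq_square)
    moreover have "\<epsilon> * nsq g - 2 < 0" using \<epsilon> by simp
    ultimately have "\<epsilon> * (cmod (ip g h))\<^sup>2 \<le> 0"
      by (simp add: zero_le_mult_iff)
    then show ?thesis using \<epsilon>(1) by (simp add: mult_le_0_iff)
  qed
  show ?thesis
  proof (rule that[of "\<lambda>z. of_real (1 / nsq h) * h z"])
    show "(\<lambda>z. of_real (1 / nsq h) * h z) \<in> A2" by (rule A2_cmult[OF hA2])
    fix g assume g: "g \<in> A2"
    have g': "(\<lambda>z. g z - g w * h z) \<in> A2" by (intro A2_diff g A2_cmult hA2)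
    have "ip g h = ip (\<lambda>z. (g z - g w * h z) + g w * h z) h" by simp
    also have "\<dots> = ip (\<lambda>z. g z - g w * h z) h + g w * ip h h"
      using ip_add_left[OF g' A2_cmult[OF hA2] hA2, of "g w"] ip_cmult_left by simp
    also have "\<dots> = g w * of_real (nsq h)" using orth[OF g'] hw1 by (simp add: ip_self)
    finally show "ip g (\<lambda>z. of_real (1 / nsq h) * h z) = g w"
      unfolding ip_cmult_right using nh by simp
  qed
qed

text \<open>
  A factor \<open>c\<close> in the reference measure multiplies inner products by \<open>c\<close> and the kernel by \<open>1 / c\<close>.
\<close>

context
  fixes V :: "(complex^'n) measure" and c :: real
  assumes V: "V = density lborel (\<lambda>_. ennreal c)" and c: "c > 0"
begin

lemma bergman_space_eq: "bergman_space V D \<nu> = A2"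
proof -
  have "set_integrable V D (\<lambda>z. (cmod (h z))\<^sup>2 * \<nu> z) \<longleftrightarrow> set_integrable lborel D (\<lambda>z. (cmod (h z))\<^sup>2 * \<nu> z)"
    if "holomorphic_fun h D" for h
  proof -
    have m: "(\<lambda>z. indicat_real D z * ((cmod (h z))\<^sup>2 * \<nu> z)) \<in> borel_measurable lborel"
      by (rule measurable_square_on_D[OF holomorphic_fun_imp_continuous_on[OF that]])
    show ?thesis
      unfolding set_integrable_def V using c m by (subst integrable_density) auto
  qed
  then show ?thesis unfolding bergman_space_def A2_def by blast
qed

lemma bergman_inner_eq:
  assumes "g \<in> A2" "h \<in> A2" shows "bergman_inner V D \<nu> g h = of_real c * ip g h"
proof -
  have m: "(\<lambda>z. indicat_real D z *\<^sub>R (g z * cnj (h z) * complex_of_real (\<nu> z))) \<in> borel_measurable lborel"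
    using set_integrable_product[OF assms] by (auto simp: set_integrable_def)
  show ?thesis
    unfolding bergman_inner_def ip_def set_lebesgue_integral_def V using c m
    by (subst integral_density) (auto simp: scaleR_conv_of_real)
qed

lemma reproducing_kernelD:
  assumes "reproducing_kernel V D \<nu> K" "w \<in> D"
  shows "(\<lambda>z. K z w) \<in> A2" "h \<in> A2 \<Longrightarrow> of_real c * ip h (\<lambda>z. K z w) = h w"
proof -
  show A: "(\<lambda>z. K z w) \<in> A2"
    using assms unfolding reproducing_kernel_def bergman_space_eq by blast
  assume h: "h \<in> A2"
  with assms have "bergman_inner V D \<nu> h (\<lambda>z. K z w) = h w"
    unfolding reproducing_kernel_def bergman_space_eq by blast
  then show "of_real c * ip h (\<lambda>z. K z w) = h w" by (simp only: bergman_inner_eq[OF h A])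
qed

text \<open>
  The definite description in \<open>bergman_kernel\<close> is proper: existence is the representation of
  evaluations, and two kernels agree because they have the same inner products with the space.
\<close>

lemma bergman_kernel_reproducing: "reproducing_kernel V D \<nu> (bergman_kernel V D \<nu>)"
proof -
  have "\<exists>K. reproducing_kernel V D \<nu> K \<and> (\<forall>z w. z \<notin> D \<or> w \<notin> D \<longrightarrow> K z w = 0)"
  proof -
    have "\<exists>k. k \<in> A2 \<and> (\<forall>h\<in>A2. ip h k = h w)" if "w \<in> D" for w
      by (rule reproducing_exists[OF that]) blast
    then obtain k where k: "\<And>w. w \<in> D \<Longrightarrow> k w \<in> A2" "\<And>w h. w \<in> D \<Longrightarrow> h \<in> A2 \<Longrightarrow> ip h (k w) = h w"
      by metis
    define K where "K z w = (if z \<in> D \<and> w \<in> D then of_real (1 / c) * k w z else 0)" for z w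
    have KA: "(\<lambda>z. K z w) \<in> A2" if "w \<in> D" for w
      by (rule A2_cong[OF A2_cmult[OF k(1)[OF that], of "of_real (1 / c)"]]) (simp add: K_def that)
    have "of_real c * ip h (\<lambda>z. K z w) = h w" if "w \<in> D" "h \<in> A2" for w h
    proof -
      have "ip h (\<lambda>z. K z w) = ip h (\<lambda>z. of_real (1 / c) * k w z)"
        by (rule ip_cong) (auto simp: K_def that)
      also have "\<dots> = of_real (1 / c) * h w" unfolding ip_cmult_right using k(2)[OF that] by simp
      finally show ?thesis using c by simp
    qed
    then have "reproducing_kernel V D \<nu> K"
      unfolding reproducing_kernel_def bergman_space_eq using KA by (auto simp: bergman_inner_eq)
    moreover have "\<forall>z w. z \<notin> D \<or> w \<notin> D \<longrightarrow> K z w = 0" by (simp add: K_def)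
    ultimately show ?thesis by blast
  qed
  moreover have "K = K'"
    if K: "reproducing_kernel V D \<nu> K" "\<forall>z w. z \<notin> D \<or> w \<notin> D \<longrightarrow> K z w = 0"
      and K': "reproducing_kernel V D \<nu> K'" "\<forall>z w. z \<notin> D \<or> w \<notin> D \<longrightarrow> K' z w = 0" for K K'
  proof (intro ext)
    fix z w
    show "K z w = K' z w"
    proof (cases "z \<in> D \<and> w \<in> D")
      case True
      have A: "(\<lambda>z. K z w) \<in> A2" "(\<lambda>z. K' z w) \<in> A2"
        using reproducing_kernelD(1)[OF K(1)] reproducing_kernelD(1)[OF K'(1)] True by auto
      show ?thesis
      proof (rule reproducing_unique[OF A])
        fix h assume h: "h \<in> A2"
        have "of_real c * ip h (\<lambda>z. K z w) = of_real c * ip h (\<lambda>z. K' z w)"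
          using reproducing_kernelD(2)[OF K(1) _ h] reproducing_kernelD(2)[OF K'(1) _ h] True by simp
        then show "ip h (\<lambda>z. K z w) = ip h (\<lambda>z. K' z w)" using c by simp
      qed (use True in auto)
    qed (use K K' in auto)
  qed
  ultimately have "\<exists>!K. reproducing_kernel V D \<nu> K \<and> (\<forall>z w. z \<notin> D \<or> w \<notin> D \<longrightarrow> K z w = 0)" by blast
  from theI'[OF this] show ?thesis unfolding bergman_kernel_def by blast
qed

lemmas bergman_kernel_in_A2 = reproducing_kernelD(1)[OF bergman_kernel_reproducing]
lemmas bergman_kernel_ip = reproducing_kernelD(2)[OF bergman_kernel_reproducing]

lemma bergman_kernel_hermitian:
  assumes "z \<in> D" "w \<in> D"
  shows "bergman_kernel V D \<nu> z w = cnj (bergman_kernel V D \<nu> w z)"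
proof -
  let ?B = "bergman_kernel V D \<nu>"
  have "?B z w = of_real c * ip (\<lambda>x. ?B x w) (\<lambda>x. ?B x z)"
    using bergman_kernel_ip[OF assms(1) bergman_kernel_in_A2[OF assms(2)]] by simp
  also have "\<dots> = cnj (of_real c * ip (\<lambda>x. ?B x z) (\<lambda>x. ?B x w))"
    using ip_hermitian[of "\<lambda>x. ?B x w" "\<lambda>x. ?B x z"] by simp
  also have "of_real c * ip (\<lambda>x. ?B x z) (\<lambda>x. ?B x w) = ?B w z"
    by (rule bergman_kernel_ip[OF assms(2) bergman_kernel_in_A2[OF assms(1)]])
  finally show ?thesis .
qed

end

end

section \<open>Proper maps factored by a finite linear group\<close>

lemma carrier_GL: "A \<in> carrier GL \<longleftrightarrow> invertible A" by (simp add: GL_def)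
lemma mult_GL: "A \<otimes>\<^bsub>GL\<^esub> B = A ** B" by (simp add: GL_def)
lemma one_GL: "\<one>\<^bsub>GL\<^esub> = mat 1" by (simp add: GL_def)

lemma group_GL: "group (GL :: (complex^'n^'n) monoid)"
proof (rule groupI)
  fix A :: "complex^'n^'n" assume "A \<in> carrier GL"
  then obtain B where "A ** B = mat 1" "B ** A = mat 1" by (auto simp: carrier_GL invertible_def)
  then show "\<exists>B\<in>carrier GL. B \<otimes>\<^bsub>GL\<^esub> A = \<one>\<^bsub>GL\<^esub>"
    by (intro bexI[of _ B]) (auto simp: carrier_GL invertible_def mult_GL one_GL)
qed (auto simp: carrier_GL mult_GL one_GL invertible_mult matrix_mul_assoc invertible_def[of "mat 1"])

lemma matrix_inv_mult:
  fixes A :: "complex^'n^'n"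
  assumes "invertible A" shows "A ** matrix_inv A = mat 1" "matrix_inv A ** A = mat 1"
  using someI_ex[of "\<lambda>A'. A ** A' = mat 1 \<and> A' ** A = mat 1"] assms
  by (auto simp: invertible_def matrix_inv_def)

lemma inv_GL:
  fixes A :: "complex^'n^'n"
  assumes "invertible A" shows "inv\<^bsub>GL\<^esub> A = matrix_inv A"
proof -
  have "invertible (matrix_inv A)" using matrix_inv_mult[OF assms] by (auto simp: invertible_def)
  then show ?thesis
    using matrix_inv_mult[OF assms] assms
    by (intro group.inv_equality[OF group_GL]) (auto simp: carrier_GL mult_GL one_GL)
qed

lemma bounded_linear_matrix_vector_complex: "bounded_linear ((*v) (A :: complex^'n^'m))"
  using linear_matrix_vector_mult_complex by (simp add: linear_conv_bounded_linear)

lemma measurable_matrix_vector_complex [measurable]: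
  "(*v) (A :: complex^'n^'m) \<in> borel_measurable borel"
  by (intro borel_measurable_continuous_onI linear_continuous_on bounded_linear_matrix_vector_complex)

locale deck_map =
  fixes D E :: "(complex^'n::finite) set" and f :: "complex^'n \<Rightarrow> complex^'n" and G :: "(complex^'n^'n) set"
  assumes open_D: "open D" and D_nonempty: "D \<noteq> {}"
    and open_E: "open E" and connected_E: "connected E" and bounded_E: "bounded E"
    and finite_G: "finite G" and subgroup_G: "subgroup G GL"
    and proper: "proper_holomorphic f D E" and deck: "has_deck_group f D G"
begin

lemma hol_f: "holomorphic_map f D" and f_in_E: "z \<in> D \<Longrightarrow> f z \<in> E"
  and proper_f: "proper_map (top_of_set D) (top_of_set E) f"
  using proper by (auto simp: proper_holomorphic_def)

lemma cont_f: "continuous_on D f" by (rule holomorphic_map_imp_continuous_on[OF hol_f])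

lemma G_one: "mat 1 \<in> G" using subgroup.one_closed[OF subgroup_G] by (simp add: one_GL)
lemma G_invertible: "\<sigma> \<in> G \<Longrightarrow> invertible \<sigma>"
  using subgroup.subset[OF subgroup_G] carrier_GL by blast
lemma G_mult: "\<sigma> \<in> G \<Longrightarrow> \<tau> \<in> G \<Longrightarrow> \<sigma> ** \<tau> \<in> G"
  using subgroup.m_closed[OF subgroup_G] by (simp add: mult_GL)
lemma G_inv: "\<sigma> \<in> G \<Longrightarrow> matrix_inv \<sigma> \<in> G"
  using subgroup.m_inv_closed[OF subgroup_G] inv_GL[OF G_invertible] by metis

lemma G_inv_mult: "\<sigma> \<in> G \<Longrightarrow> matrix_inv \<sigma> *v (\<sigma> *v z) = z" "\<sigma> \<in> G \<Longrightarrow> \<sigma> *v (matrix_inv \<sigma> *v z) = z"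
  by (simp_all add: matrix_vector_mul_assoc matrix_inv_mult[OF G_invertible])

lemma G_inv_inv: "\<sigma> \<in> G \<Longrightarrow> matrix_inv (matrix_inv \<sigma>) = \<sigma>"
proof -
  assume \<sigma>: "\<sigma> \<in> G"
  have "matrix_inv (matrix_inv \<sigma>) *v (matrix_inv \<sigma> *v (\<sigma> *v z)) = \<sigma> *v z" for z
    by (rule G_inv_mult(1)[OF G_inv[OF \<sigma>]])
  then show ?thesis by (simp add: G_inv_mult(1)[OF \<sigma>] matrix_eq)
qed

lemma act_inv: "\<sigma> \<in> G \<Longrightarrow> act (matrix_inv \<sigma>) z = \<sigma> *v z"
  by (simp add: act_def G_inv_inv)

lemma card_G: "card G > 0" using finite_G G_one by (auto simp: card_gt_0_iff)

lemma det_G_nonzero: "\<sigma> \<in> G \<Longrightarrow> det \<sigma> \<noteq> 0"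
  using G_invertible invertible_det_nz by blast

text \<open>
  Multiplication by \<open>\<sigma>\<close> cannot increase the largest modulus of a determinant in the finite group;
  the same holds for the inverse of \<open>\<sigma>\<close>.
\<close>

lemma cmod_det_G: assumes "\<sigma> \<in> G" shows "cmod (det \<sigma>) = 1"
proof -
  have le: "cmod (det \<sigma>) \<le> 1" if "\<sigma> \<in> G" for \<sigma>
  proof -
    define M where "M = Max ((\<lambda>\<tau>. cmod (det \<tau>)) ` G)"
    have fin: "finite ((\<lambda>\<tau>. cmod (det \<tau>)) ` G)" "(\<lambda>\<tau>. cmod (det \<tau>)) ` G \<noteq> {}"
      using finite_G G_one by auto
    obtain \<tau> where \<tau>: "\<tau> \<in> G" "M = cmod (det \<tau>)" using Max_in[OF fin] by (auto simp: M_def)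
    have "M > 0" using \<tau> det_G_nonzero by simp
    have "cmod (det (\<sigma> ** \<tau>)) \<le> M"
      unfolding M_def using fin G_mult[OF that \<tau>(1)] by (intro Max_ge) auto
    then have "cmod (det \<sigma>) * M \<le> 1 * M" by (simp add: det_mul norm_mult \<tau>(2))
    with \<open>M > 0\<close> show ?thesis by (simp only: mult_le_cancel_right_pos)
  qed
  have "cmod (det \<sigma>) * cmod (det (matrix_inv \<sigma>)) = 1"
    using matrix_inv_mult(1)[OF G_invertible[OF assms]] by (metis det_I det_mul norm_mult norm_one)
  moreover have "cmod (det \<sigma>) \<le> 1" "cmod (det (matrix_inv \<sigma>)) \<le> 1"
    using le assms G_inv by auto
  ultimately show ?thesis
    by (smt (verit) mult_left_le norm_ge_zero)
qed

lemma G_invariant: assumes "\<sigma> \<in> G" "z \<in> D" shows "\<sigma> *v z \<in> D"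
proof -
  have "act (matrix_inv \<sigma>) z \<in> D"
    using deck G_inv[OF assms(1)] assms(2) by (auto simp: has_deck_group_def)
  then show ?thesis by (simp add: act_inv assms)
qed

lemma G_invariant_iff: "\<sigma> \<in> G \<Longrightarrow> \<sigma> *v z \<in> D \<longleftrightarrow> z \<in> D"
  using G_invariant G_inv_mult(1) G_inv by metis

lemma fibre: "z \<in> D \<Longrightarrow> x \<in> D \<Longrightarrow> f x = f z \<longleftrightarrow> (\<exists>\<sigma>\<in>G. x = \<sigma> *v z)"
proof -
  assume z: "z \<in> D" and x: "x \<in> D"
  have eq: "{x \<in> D. f x = f z} = {act \<sigma> z |\<sigma>. \<sigma> \<in> G}" using deck z by (simp add: has_deck_group_def)
  have "f x = f z \<longleftrightarrow> x \<in> {act \<sigma> z |\<sigma>. \<sigma> \<in> G}" using x eq by blast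
  also have "\<dots> \<longleftrightarrow> (\<exists>\<sigma>\<in>G. x = matrix_inv \<sigma> *v z)" by (auto simp: act_def)
  also have "\<dots> \<longleftrightarrow> (\<exists>\<sigma>\<in>G. x = \<sigma> *v z)" using G_inv G_inv_inv by metis
  finally show ?thesis .
qed

lemma f_invariant: "\<sigma> \<in> G \<Longrightarrow> z \<in> D \<Longrightarrow> f (\<sigma> *v z) = f z"
  using fibre[of z "\<sigma> *v z"] G_invariant by blast

abbreviation "A \<equiv> jacobian f"
abbreviation "J \<equiv> jacobian_det f"

lemma der_f: "z \<in> D \<Longrightarrow> (f has_derivative (*v) (A z)) (at z)"
  by (rule holomorphic_map_has_derivative[OF hol_f open_D])

lemma hol_J: "holomorphic_fun J D" by (rule holomorphic_fun_jacobian_det[OF hol_f open_D])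
lemma cont_J: "continuous_on D J" by (rule holomorphic_fun_imp_continuous_on[OF hol_J])

lemma jacobian_equivariant:
  assumes "\<sigma> \<in> G" "z \<in> D" shows "A (\<sigma> *v z) ** \<sigma> = A z"
proof -
  have d: "((*v) \<sigma> has_derivative (*v) \<sigma>) (at z)"
    by (rule bounded_linear_imp_has_derivative[OF bounded_linear_matrix_vector_complex])
  have "(f \<circ> (*v) \<sigma> has_derivative (*v) (A (\<sigma> *v z)) \<circ> (*v) \<sigma>) (at z)"
    by (rule diff_chain_at[OF d der_f[OF G_invariant[OF assms]]])
  then have "((\<lambda>x. f (\<sigma> *v x)) has_derivative (*v) (A (\<sigma> *v z) ** \<sigma>)) (at z)"
    by (simp add: o_def matrix_vector_mul_assoc)
  then have "(f has_derivative (*v) (A (\<sigma> *v z) ** \<sigma>)) (at z)"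
    by (rule has_derivative_transform_within_open[OF _ open_D assms(2)]) (simp add: f_invariant assms)
  from jacobian_unique[OF open_D assms(2) this hol_f] show ?thesis by simp
qed

lemma J_equivariant: "\<sigma> \<in> G \<Longrightarrow> z \<in> D \<Longrightarrow> J (\<sigma> *v z) * det \<sigma> = J z"
  using jacobian_equivariant[of \<sigma> z] by (metis det_mul jacobian_det_eq)

lemma cmod_J_invariant: "\<sigma> \<in> G \<Longrightarrow> z \<in> D \<Longrightarrow> cmod (J (\<sigma> *v z)) = cmod (J z)"
  using J_equivariant[of \<sigma> z] cmod_det_G[of \<sigma>] by (metis mult.right_neutral norm_mult)

text \<open>
  Points of a fibre differ by an element of \<open>G\<close>, and a small ball around \<open>z\<close> is disjoint from its
  images under the finitely many nontrivial elements.
\<close>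

lemma locally_injective:
  assumes z: "z \<in> D" and free: "\<And>\<sigma>. \<sigma> \<in> G \<Longrightarrow> \<sigma> *v z = z \<Longrightarrow> \<sigma> = mat 1" and U: "open U" "z \<in> U"
  obtains r where "r > 0" "ball z r \<subseteq> D \<inter> U" "inj_on f (ball z r)"
proof -
  have ev: "\<forall>\<^sub>F r in at_right 0. \<forall>x\<in>ball z r. \<sigma> *v x \<notin> ball z r" if "\<sigma> \<in> G - {mat 1}" for \<sigma>
  proof -
    define d where "d = norm (\<sigma> *v z - z)"
    have d: "d > 0" using free that by (auto simp: d_def)
    have "continuous_on UNIV ((*v) \<sigma>)" by (intro linear_continuous_on bounded_linear_matrix_vector_complex)
    then obtain \<delta> where \<delta>: "\<delta> > 0" "\<And>x. dist x z < \<delta> \<Longrightarrow> dist (\<sigma> *v x) (\<sigma> *v z) < d / 2"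
      using d unfolding continuous_on_iff by (metis UNIV_I half_gt_zero)
    have "\<forall>x\<in>ball z r. \<sigma> *v x \<notin> ball z r" if r: "0 < r" "r < min \<delta> (d / 2)" for r
    proof
      fix x assume "x \<in> ball z r"
      then have "dist (\<sigma> *v x) (\<sigma> *v z) < d / 2" using r by (intro \<delta>) (auto simp: dist_commute)
      then have "dist (\<sigma> *v x) z > d / 2"
        using dist_triangle[of "\<sigma> *v z" z "\<sigma> *v x"] by (simp add: d_def dist_norm norm_minus_commute)
      then show "\<sigma> *v x \<notin> ball z r" using r by (simp add: dist_commute)
    qed
    then show ?thesis unfolding eventually_at_right_field
      using \<delta>(1) d by (intro exI[of _ "min \<delta> (d / 2)"]) auto
  qed
  have "\<forall>\<^sub>F r in at_right 0. \<forall>\<sigma>\<in>G - {mat 1}. \<forall>x\<in>ball z r. \<sigma> *v x \<notin> ball z r"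
    using finite_G ev by (intro eventually_ball_finite) auto
  then obtain b where b: "b > 0" "\<And>r. 0 < r \<Longrightarrow> r < b \<Longrightarrow> \<forall>\<sigma>\<in>G - {mat 1}. \<forall>x\<in>ball z r. \<sigma> *v x \<notin> ball z r"
    unfolding eventually_at_right_field by blast
  obtain e where e: "e > 0" "ball z e \<subseteq> D \<inter> U"
    using open_Int[OF open_D U(1)] z U(2) open_contains_ball by blast
  define r where "r = min (b / 2) e"
  have r: "0 < r" "r < b" "r \<le> e" using b(1) e(1) by (auto simp: r_def)
  have sub: "ball z r \<subseteq> D \<inter> U" using e(2) subset_ball[OF r(3)] by blast
  have "inj_on f (ball z r)"
  proof (rule inj_onI)
    fix x y assume xy: "x \<in> ball z r" "y \<in> ball z r" "f x = f y"
    then obtain \<sigma> where \<sigma>: "\<sigma> \<in> G" "x = \<sigma> *v y" using fibre[of y x] sub by blast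
    then have "\<sigma> = mat 1" using b(2)[OF r(1,2)] xy by blast
    then show "x = y" using \<sigma> by simp
  qed
  with r(1) sub show ?thesis by (rule that)
qed

text \<open>
  The points with nontrivial stabilizer lie in finitely many proper subspaces, so \<open>U\<close> contains a
  ball on which \<open>f\<close> is injective. By invariance of domain the image of this ball is open. If \<open>J\<close>
  vanished on the ball, that image would be null by Sard's theorem.
\<close>

lemma J_nonzero_dense:
  assumes U: "open U" "U \<subseteq> D" "U \<noteq> {}"
  obtains z where "z \<in> U" "J z \<noteq> 0"
proof -
  have negl: "negligible {z. \<sigma> *v z = z}" if "\<sigma> \<noteq> mat 1" for \<sigma> :: "complex^'n^'n"
  proof (rule negligible_lowdim)
    have sub: "subspace {z. \<sigma> *v z = z}"
      using linear_add[OF linear_matrix_vector_mult_complex[of \<sigma>]] linear_cmul[OF linear_matrix_vector_mult_complex[of \<sigma>]]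
      by (auto simp: subspace_def)
    have "{z. \<sigma> *v z = z} \<noteq> UNIV"
    proof
      assume "{z. \<sigma> *v z = z} = UNIV"
      then have "\<sigma> *v z = mat 1 *v z" for z by auto
      then have "\<sigma> = mat 1" by (simp add: matrix_eq)
      with that show False by simp
    qed
    then have "dim {z. \<sigma> *v z = z} \<noteq> DIM(complex^'n)"
      using dim_eq_full[of "{z. \<sigma> *v z = z}"] span_eq_iff[THEN iffD2, OF sub] by simp
    then show "dim {z. \<sigma> *v z = z} < DIM(complex^'n)"
      using dim_subset_UNIV[of "{z. \<sigma> *v z = z}"] by linarith
  qed
  have "negligible (\<Union>\<sigma>\<in>G - {mat 1}. {z. \<sigma> *v z = z})"
    using finite_G negl by (intro negligible_Union) auto
  moreover have "\<not> negligible U" using U open_not_negligible by blast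
  ultimately have "\<not> U \<subseteq> (\<Union>\<sigma>\<in>G - {mat 1}. {z. \<sigma> *v z = z})"
    using negligible_subset by blast
  then obtain z where z: "z \<in> U" "\<And>\<sigma>. \<sigma> \<in> G \<Longrightarrow> \<sigma> *v z = z \<Longrightarrow> \<sigma> = mat 1" by blast
  have zD: "z \<in> D" using z U by blast
  obtain r where r: "r > 0" "ball z r \<subseteq> D \<inter> U" and inj: "inj_on f (ball z r)"
    by (rule locally_injective[OF zD z(2) U(1) z(1)]) (assumption | rule that)+
  have "open (f ` ball z r)"
    using r by (intro invariance_of_domain inj open_ball continuous_on_subset[OF cont_f]) auto
  then have "\<not> negligible (f ` ball z r)" using open_not_negligible r(1) by (metis centre_in_ball empty_iff image_is_empty)
  moreover have "negligible (f ` ball z r)" if "\<And>x. x \<in> ball z r \<Longrightarrow> J x = 0"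
    using that r(2) der_f by (intro negligible_critical_values[of _ f A]) (auto simp: jacobian_det_eq)
  ultimately obtain x where "x \<in> ball z r" "J x \<noteq> 0" by blast
  with r show ?thesis by (intro that[of x]) auto
qed

definition Reg :: "(complex^'n) set" where "Reg = {z \<in> D. J z \<noteq> 0}"
definition Crit :: "(complex^'n) set" where "Crit = {z \<in> D. J z = 0}"

lemma open_Reg: "open Reg"
proof -
  have "open (D \<inter> J -` (- {0}))" by (intro continuous_open_preimage cont_J open_D) auto
  moreover have "D \<inter> J -` (- {0}) = Reg" by (auto simp: Reg_def)
  ultimately show ?thesis by simp
qed

lemma Reg_subset: "Reg \<subseteq> D" by (auto simp: Reg_def)

lemma Reg_nonempty: "Reg \<noteq> {}"
  using J_nonzero_dense[OF open_D subset_refl D_nonempty] by (auto simp: Reg_def)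

lemma Reg_invariant: "\<sigma> \<in> G \<Longrightarrow> \<sigma> *v z \<in> Reg \<longleftrightarrow> z \<in> Reg"
  using G_invariant_iff cmod_J_invariant by (auto simp: Reg_def) (metis norm_eq_zero)+

lemma Reg_free: assumes "z \<in> Reg" "\<sigma> \<in> G" "\<sigma> *v z = z" shows "\<sigma> = mat 1"
proof -
  have "invertible (A z)" using assms(1) by (simp add: Reg_def jacobian_det_eq invertible_det_nz)
  moreover have "A z ** \<sigma> = A z" using jacobian_equivariant[OF assms(2), of z] assms Reg_subset by auto
  ultimately show ?thesis by (metis invertible_def matrix_mul_assoc matrix_mul_lid)
qed

lemma Reg_locally_injective:
  assumes "z \<in> Reg" obtains r where "r > 0" "ball z r \<subseteq> Reg" "inj_on f (ball z r)"
proof -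
  have zD: "z \<in> D" using assms Reg_subset by blast
  obtain r where "r > 0" "ball z r \<subseteq> D \<inter> Reg" "inj_on f (ball z r)"
    by (rule locally_injective[OF zD Reg_free[OF assms] open_Reg assms]) (assumption | rule that)+
  then show ?thesis by (intro that[of r]) auto
qed

lemma open_f_Reg: "open (f ` Reg)"
proof (subst open_subopen, intro ballI)
  fix y assume "y \<in> f ` Reg"
  then obtain z where z: "z \<in> Reg" "y = f z" by blast
  obtain r where r: "r > 0" "ball z r \<subseteq> Reg" "inj_on f (ball z r)" by (rule Reg_locally_injective[OF z(1)]) (rule that)
  have "open (f ` ball z r)"
    using r Reg_subset by (intro invariance_of_domain r(3) open_ball continuous_on_subset[OF cont_f]) auto
  then show "\<exists>T. open T \<and> y \<in> T \<and> T \<subseteq> f ` Reg"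
    using r z by (intro exI[of _ "f ` ball z r"]) auto
qed

lemma closed_map_f: "closedin (top_of_set D) S \<Longrightarrow> closedin (top_of_set E) (f ` S)"
  using proper_imp_closed_map[OF proper_f] by (auto simp: closed_map_def)

lemma negligible_f_Crit: "negligible (f ` Crit)"
  by (rule negligible_critical_values[of _ f A]) (auto simp: Crit_def der_f jacobian_det_eq)

lemma closedin_f_Crit: "closedin (top_of_set E) (f ` Crit)"
proof (rule closed_map_f)
  have "closedin (top_of_set D) (D \<inter> J -` {0})"
    by (intro continuous_closedin_preimage cont_J) auto
  moreover have "D \<inter> J -` {0} = Crit" by (auto simp: Crit_def)
  ultimately show "closedin (top_of_set D) Crit" by simp
qed

lemma f_Reg_disjoint_f_Crit: "f ` Reg \<inter> f ` Crit = {}"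
proof -
  have "f z \<noteq> f x" if "z \<in> Reg" "x \<in> Crit" for z x
  proof
    assume "f z = f x"
    moreover have "x \<in> D" "z \<in> D" using that by (auto simp: Reg_def Crit_def)
    ultimately obtain \<sigma> where "\<sigma> \<in> G" "z = \<sigma> *v x" using fibre by blast
    with that show False using Reg_invariant[of \<sigma> x] by (auto simp: Reg_def Crit_def)
  qed
  then show ?thesis by blast
qed

lemma f_D_split: "f ` D = f ` Reg \<union> f ` Crit" by (auto simp: Reg_def Crit_def)

subsection \<open>A fundamental domain and the push-forward of Lebesgue measure\<close>

text \<open>
  Regular points are covered by countably many open sets \<open>U i\<close> on which \<open>f\<close> is injective. From each
  orbit, \<open>S\<close> keeps the point in the first \<open>U i\<close> that the orbit meets. The last conclusion says that
  the translates of \<open>S\<close> partition the regular points.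
\<close>

lemma fundamental_set:
  obtains S where "S \<in> sets borel" "S \<subseteq> Reg" "inj_on f S" "f ` S = f ` Reg"
    "\<And>x. (\<Sum>\<sigma>\<in>G. indicator S (\<sigma> *v x) :: ennreal) = indicator Reg x"
proof -
  define F where "F = {U. open U \<and> U \<subseteq> Reg \<and> inj_on f U}"
  have cov: "\<Union>F = Reg"
  proof
    show "Reg \<subseteq> \<Union>F"
    proof
      fix z assume z: "z \<in> Reg"
      obtain r where "r > 0" "ball z r \<subseteq> Reg" "inj_on f (ball z r)" by (rule Reg_locally_injective[OF z]) (rule that)
      then show "z \<in> \<Union>F" by (auto simp: F_def intro!: exI[of _ "ball z r"])
    qed
  qed (auto simp: F_def)
  obtain F' where F': "F' \<subseteq> F" "countable F'" "\<Union>F' = \<Union>F"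
    by (rule Lindelof[of F]) (auto simp: F_def)
  have "F' \<noteq> {}" using F'(3) cov Reg_nonempty by auto
  define U where "U = from_nat_into F'"
  have UF: "U i \<in> F" for i using F'(1) from_nat_into[OF \<open>F' \<noteq> {}\<close>] by (auto simp: U_def)
  have U: "open (U i)" "U i \<subseteq> Reg" "inj_on f (U i)" for i using UF[of i] by (auto simp: F_def)
  have Ucov: "(\<Union>i. U i) = Reg"
    unfolding U_def using range_from_nat_into[OF \<open>F' \<noteq> {}\<close> F'(2)] F'(3) cov by simp
  define T where "T k = (\<Union>\<sigma>\<in>G. (*v) \<sigma> -` U k)" for k
  have openT: "open (T k)" for k
    unfolding T_def
    by (intro open_UN ballI open_vimage U linear_continuous_on bounded_linear_matrix_vector_complex)
  define P where "P i = U i - (\<Union>k<i. T k)" for i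
  define S where "S = (\<Union>i. P i)"
  have SD1: "S \<subseteq> Reg" using U(2) by (auto simp: S_def P_def)
  have inj: "inj_on f S"
  proof (rule inj_onI)
    fix x y assume xy: "x \<in> S" "y \<in> S" "f x = f y"
    then obtain i j where ij: "x \<in> P i" "y \<in> P j" by (auto simp: S_def)
    have D: "x \<in> D" "y \<in> D" using xy SD1 Reg_subset by auto
    obtain \<sigma> where \<sigma>: "\<sigma> \<in> G" "x = \<sigma> *v y" using fibre[of y x] D xy by blast
    have y: "y = matrix_inv \<sigma> *v x" using \<sigma> by (simp add: G_inv_mult)
    have "\<not> i < j"
    proof
      assume "i < j"
      have "y \<in> T i" unfolding T_def using \<sigma> ij(1) by (auto simp: P_def)
      with \<open>i < j\<close> ij(2) show False by (auto simp: P_def)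
    qed
    moreover have "\<not> j < i"
    proof
      assume "j < i"
      have "x \<in> T j" unfolding T_def using y ij(2) G_inv[OF \<sigma>(1)] by (auto simp: P_def)
      with \<open>j < i\<close> ij(1) show False by (auto simp: P_def)
    qed
    ultimately have "i = j" by simp
    then show "x = y" using U(3)[of i] ij xy(3) by (auto simp: P_def inj_on_def)
  qed
  have ex: "\<exists>\<sigma>\<in>G. \<sigma> *v x \<in> S" if x: "x \<in> Reg" for x
  proof -
    obtain i0 where "x \<in> U i0" using x Ucov by auto
    then have "\<exists>i. x \<in> T i" unfolding T_def using G_one by (intro exI[of _ i0]) force
    define i where "i = (LEAST i. x \<in> T i)"
    have "x \<in> T i" unfolding i_def using \<open>\<exists>i. x \<in> T i\<close> by (rule LeastI_ex)
    then obtain \<sigma> where \<sigma>: "\<sigma> \<in> G" "\<sigma> *v x \<in> U i" by (auto simp: T_def)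
    have "\<sigma> *v x \<notin> T k" if "k < i" for k
    proof
      assume "\<sigma> *v x \<in> T k"
      then obtain \<tau> where "\<tau> \<in> G" "\<tau> *v (\<sigma> *v x) \<in> U k" by (auto simp: T_def)
      then have "x \<in> T k" unfolding T_def using G_mult[OF _ \<sigma>(1)] by (auto simp: matrix_vector_mul_assoc)
      with \<open>k < i\<close> show False using not_less_Least by (auto simp: i_def)
    qed
    then have "\<sigma> *v x \<in> P i" using \<sigma> by (auto simp: P_def)
    then show ?thesis using \<sigma> by (auto simp: S_def)
  qed
  have uniq: "\<sigma> = \<tau>" if "\<sigma> \<in> G" "\<tau> \<in> G" "\<sigma> *v x \<in> S" "\<tau> *v x \<in> S" for \<sigma> \<tau> x
  proof -
    have xD1: "x \<in> Reg" using SD1 that Reg_invariant by blast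
    have "f (\<sigma> *v x) = f (\<tau> *v x)" using that f_invariant xD1 Reg_subset by (metis subsetD)
    then have eq: "\<sigma> *v x = \<tau> *v x" using inj that by (auto simp: inj_on_def)
    have "(matrix_inv \<tau> ** \<sigma>) *v x = x"
      using eq that by (simp add: G_inv_mult flip: matrix_vector_mul_assoc)
    then have "matrix_inv \<tau> ** \<sigma> = mat 1" using Reg_free[OF xD1] G_mult G_inv that by blast
    then have "\<tau> ** (matrix_inv \<tau> ** \<sigma>) = \<tau> ** mat 1" by simp
    then show ?thesis by (simp add: matrix_mul_assoc matrix_inv_mult G_invertible that)
  qed
  show ?thesis
  proof (rule that[of S])
    have "P i \<in> sets borel" for i
      unfolding P_def using openT by (intro sets.Diff borel_open U open_UN) auto
    then show "S \<in> sets borel" unfolding S_def by auto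
    show "f ` S = f ` Reg"
    proof
      show "f ` Reg \<subseteq> f ` S"
      proof
        fix y assume "y \<in> f ` Reg"
        then obtain x where x: "x \<in> Reg" "y = f x" by blast
        obtain \<sigma> where "\<sigma> \<in> G" "\<sigma> *v x \<in> S" using ex[OF x(1)] by blast
        then show "y \<in> f ` S" using f_invariant[of \<sigma> x] x Reg_subset by (metis image_eqI subsetD)
      qed
    qed (use SD1 in auto)
    fix x
    show "(\<Sum>\<sigma>\<in>G. indicator S (\<sigma> *v x) :: ennreal) = indicator Reg x"
    proof (cases "x \<in> Reg")
      case True
      then obtain \<sigma> where \<sigma>: "\<sigma> \<in> G" "\<sigma> *v x \<in> S" using ex by blast
      have "(\<Sum>\<tau>\<in>G. indicator S (\<tau> *v x) :: ennreal) = (\<Sum>\<tau>\<in>G. if \<tau> = \<sigma> then 1 else 0)"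
        using \<sigma> uniq by (intro sum.cong) (auto simp: indicator_def)
      then show ?thesis using True \<sigma> finite_G by simp
    next
      case False
      then have "\<tau> *v x \<notin> S" if "\<tau> \<in> G" for \<tau> using that SD1 Reg_invariant by blast
      then show ?thesis using False by simp
    qed
  qed (use SD1 inj in auto)
qed

lemma measurable_f: "(\<lambda>x. indicator D x *\<^sub>R f x) \<in> borel_measurable borel"
  using borel_measurable_continuous_on_indicator[OF _ cont_f] open_D by simp

lemma measurable_J: "(\<lambda>x. indicator D x *\<^sub>R J x) \<in> borel_measurable borel"
  using borel_measurable_continuous_on_indicator[OF _ cont_J] open_D by simp

lemma preimage_borel:
  assumes "B \<in> sets borel" shows "{x \<in> D. f x \<in> B} \<in> sets borel"
proof -
  have "{x \<in> D. f x \<in> B} = D \<inter> (\<lambda>x. indicator D x *\<^sub>R f x) -` B" by auto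
  then show ?thesis
    using measurable_sets[OF measurable_f assms] open_D by (auto intro!: sets.Int)
qed

text \<open>
  On the fundamental set the change of variables formula applies, and each of the \<open>card G\<close>
  translates contributes the same since \<open>\<bar>J\<bar>\<close> is invariant and \<open>G\<close> preserves volume.
\<close>

lemma emeasure_pushforward:
  assumes B: "B \<in> sets borel"
  shows "(\<integral>\<^sup>+x. ennreal ((cmod (J x))\<^sup>2) * indicator {x \<in> D. f x \<in> B} x \<partial>lborel)
    = of_nat (card G) * emeasure lborel (B \<inter> f ` Reg)"
proof -
  obtain S where S: "S \<in> sets borel" "S \<subseteq> Reg" "inj_on f S" "f ` S = f ` Reg"
    and sum: "\<And>x. (\<Sum>\<sigma>\<in>G. indicator S (\<sigma> *v x) :: ennreal) = indicator Reg x"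
    by (rule fundamental_set) (rule that)
  define T where "T = S \<inter> {x \<in> D. f x \<in> B}"
  have T: "T \<in> sets borel" unfolding T_def by (intro sets.Int S preimage_borel B)
  have "f ` T = B \<inter> f ` S" using S(2) Reg_subset by (auto simp: T_def)
  then have fT: "f ` T = B \<inter> f ` Reg" by (simp only: S(4))
  define k where "k x = ennreal ((cmod (J x))\<^sup>2) * indicator T x" for x
  have km: "k \<in> borel_measurable borel"
  proof -
    have "(\<lambda>x. ennreal ((cmod (indicator D x *\<^sub>R J x))\<^sup>2) * indicator T x) \<in> borel_measurable borel"
      using measurable_J T by measurable
    moreover have "(\<lambda>x. ennreal ((cmod (indicator D x *\<^sub>R J x))\<^sup>2) * indicator T x) = k"
      by (auto simp: k_def T_def fun_eq_iff indicator_def)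
    ultimately show ?thesis by simp
  qed
  have "ennreal ((cmod (J x))\<^sup>2) * indicator {x \<in> D. f x \<in> B} x = (\<Sum>\<sigma>\<in>G. k (\<sigma> *v x))" for x
  proof (cases "x \<in> D \<and> f x \<in> B")
    case True
    have "(\<Sum>\<sigma>\<in>G. k (\<sigma> *v x)) = (\<Sum>\<sigma>\<in>G. ennreal ((cmod (J x))\<^sup>2) * indicator S (\<sigma> *v x))"
      using True by (intro sum.cong refl)
        (auto simp: k_def T_def indicator_def f_invariant G_invariant cmod_J_invariant)
    also have "\<dots> = ennreal ((cmod (J x))\<^sup>2) * indicator Reg x"
      by (simp add: sum flip: sum_distrib_left)
    also have "\<dots> = ennreal ((cmod (J x))\<^sup>2) * indicator {x \<in> D. f x \<in> B} x"
      using True by (auto simp: indicator_def Reg_def)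
    finally show ?thesis by simp
  next
    case False
    then have "\<sigma> *v x \<notin> T" if "\<sigma> \<in> G" for \<sigma>
      using that f_invariant[OF that] G_invariant_iff[OF that] by (auto simp: T_def)
    then show ?thesis using False by (simp add: k_def)
  qed
  then have "(\<integral>\<^sup>+x. ennreal ((cmod (J x))\<^sup>2) * indicator {x \<in> D. f x \<in> B} x \<partial>lborel)
      = (\<integral>\<^sup>+x. (\<Sum>\<sigma>\<in>G. k (\<sigma> *v x)) \<partial>lborel)" by simp
  also have "\<dots> = (\<Sum>\<sigma>\<in>G. \<integral>\<^sup>+x. k (\<sigma> *v x) \<partial>lborel)"
    using km by (intro nn_integral_sum) (auto intro!: measurable_compose[OF measurable_matrix_vector_complex])
  also have "\<dots> = (\<Sum>\<sigma>\<in>G. \<integral>\<^sup>+x. k x \<partial>lborel)"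
  proof (intro sum.cong refl)
    fix \<sigma> assume "\<sigma> \<in> G"
    have "(\<integral>\<^sup>+x. k x \<partial>lborel) = (\<integral>\<^sup>+x. k x \<partial>distr lborel borel ((*v) \<sigma>))"
      by (simp add: lborel_distr_unimodular cmod_det_G \<open>\<sigma> \<in> G\<close>)
    also have "\<dots> = (\<integral>\<^sup>+x. k (\<sigma> *v x) \<partial>lborel)"
      using km by (intro nn_integral_distr) auto
    finally show "(\<integral>\<^sup>+x. k (\<sigma> *v x) \<partial>lborel) = (\<integral>\<^sup>+x. k x \<partial>lborel)" by simp
  qed
  also have "\<dots> = of_nat (card G) * (\<integral>\<^sup>+x. k x \<partial>lborel)" by simp
  also have "(\<integral>\<^sup>+x. k x \<partial>lborel) = emeasure lborel (B \<inter> f ` Reg)"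
  proof -
    have "emeasure lborel (f ` T) = (\<integral>\<^sup>+x. ennreal ((cmod (det (A x)))\<^sup>2) * indicator T x \<partial>lborel)"
    proof (rule emeasure_holomorphic_image[OF T])
      show "(f has_derivative (*v) (A x)) (at x)" if "x \<in> T" for x
        using that der_f by (auto simp: T_def)
      show "inj_on f T" using S(3) by (auto simp: T_def inj_on_def)
      show "(\<lambda>x. indicator T x * det (A x)) \<in> borel_measurable borel"
      proof -
        have "(\<lambda>x. indicator T x * (indicator D x *\<^sub>R J x)) \<in> borel_measurable borel"
          using measurable_J T by measurable
        moreover have "(\<lambda>x. indicator T x * (indicator D x *\<^sub>R J x)) = (\<lambda>x. indicator T x * det (A x))"
          by (auto simp: T_def fun_eq_iff indicator_def jacobian_det_eq)
        ultimately show ?thesis by simp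
      qed
      show "f ` T \<in> sets borel" unfolding fT using B open_f_Reg by auto
      show "bounded (f ` T)"
        by (rule bounded_subset[OF bounded_E]) (use f_in_E in \<open>auto simp: T_def\<close>)
    qed
    then show ?thesis by (simp add: k_def jacobian_det_eq fT)
  qed
  finally show ?thesis .
qed

lemma distr_f:
  "distr (density lborel (\<lambda>x. ennreal ((cmod (indicator D x *\<^sub>R J x))\<^sup>2))) borel (\<lambda>x. indicator D x *\<^sub>R f x)
    = density lborel (\<lambda>y. ennreal (real (card G) * indicator (f ` Reg) y))" (is "?L = ?R")
proof (rule measure_eqI)
  have fm: "(\<lambda>x. indicator D x *\<^sub>R f x) \<in> borel_measurable lborel" using measurable_f by simp
  fix B assume "B \<in> sets ?L"
  then have B: "B \<in> sets borel" by simp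
  have jm: "(\<lambda>x. ennreal ((cmod (indicator D x *\<^sub>R J x))\<^sup>2)) \<in> borel_measurable lborel"
    using measurable_J by measurable
  have vm: "(\<lambda>x. indicator D x *\<^sub>R f x) -` B \<in> sets borel" using measurable_sets[OF measurable_f B] by simp
  have "emeasure ?L B = (\<integral>\<^sup>+x. ennreal ((cmod (indicator D x *\<^sub>R J x))\<^sup>2) * indicator ((\<lambda>x. indicator D x *\<^sub>R f x) -` B) x \<partial>lborel)"
    using fm B vm jm by (subst emeasure_distr) (auto simp: emeasure_density)
  also have "\<dots> = (\<integral>\<^sup>+x. ennreal ((cmod (J x))\<^sup>2) * indicator {x \<in> D. f x \<in> B} x \<partial>lborel)"
    by (intro nn_integral_cong) (auto simp: indicator_def)
  also have "\<dots> = of_nat (card G) * emeasure lborel (B \<inter> f ` Reg)" by (rule emeasure_pushforward[OF B])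
  also have "\<dots> = (\<integral>\<^sup>+y. of_nat (card G) * indicator (B \<inter> f ` Reg) y \<partial>lborel)"
    using B open_f_Reg by (subst nn_integral_cmult_indicator) auto
  also have "\<dots> = (\<integral>\<^sup>+y. ennreal (real (card G) * indicator (f ` Reg) y) * indicator B y \<partial>lborel)"
    by (intro nn_integral_cong) (auto simp: indicator_def ennreal_of_nat_eq_real_of_nat)
  also have "\<dots> = emeasure ?R B"
    using B open_f_Reg by (subst emeasure_density) auto
  finally show "emeasure ?L B = emeasure ?R B" .
qed simp

lemma
  fixes g :: "complex^'n \<Rightarrow> 'b::{banach, second_countable_topology}"
  assumes g: "(\<lambda>y. indicator (f ` Reg) y *\<^sub>R g y) \<in> borel_measurable borel"
  shows pushforward_integrable: "set_integrable lborel D (\<lambda>x. (cmod (J x))\<^sup>2 *\<^sub>R g (f x)) \<longleftrightarrow> set_integrable lborel (f ` Reg) g"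
    and pushforward_integral: "(LINT x:D|lborel. (cmod (J x))\<^sup>2 *\<^sub>R g (f x)) = real (card G) *\<^sub>R (LINT y:f ` Reg|lborel. g y)"
proof -
  define g' where "g' = (\<lambda>y. indicator (f ` Reg) y *\<^sub>R g y)"
  define F where "F = (\<lambda>x. indicator D x *\<^sub>R f x)"
  define w where "w = (\<lambda>x. (cmod (indicator D x *\<^sub>R J x))\<^sup>2)"
  have g'm: "g' \<in> borel_measurable borel" using g by (simp add: g'_def)
  have Fm: "F \<in> borel_measurable lborel" using measurable_f by (simp add: F_def)
  have wm: "w \<in> borel_measurable lborel" unfolding w_def using measurable_J by measurable
  have d: "distr (density lborel (\<lambda>x. ennreal (w x))) borel F = density lborel (\<lambda>y. ennreal (real (card G) * indicator (f ` Reg) y))"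
    using distr_f by (simp add: w_def F_def)
  have nm: "(\<lambda>y. real (card G) * indicator (f ` Reg) y) \<in> borel_measurable lborel"
    using open_f_Reg by auto
  have comp: "(\<lambda>x. w x *\<^sub>R g' (F x)) = (\<lambda>x. indicator D x *\<^sub>R ((cmod (J x))\<^sup>2 *\<^sub>R g (f x)))"
    by (auto simp: fun_eq_iff w_def g'_def F_def indicator_def Reg_def)
  have comp2: "(\<lambda>y. (real (card G) * indicator (f ` Reg) y) *\<^sub>R g' y) = (\<lambda>y. real (card G) *\<^sub>R g' y)"
    by (auto simp: fun_eq_iff g'_def indicator_def)
  have gF: "(\<lambda>x. g' (F x)) \<in> borel_measurable lborel"
    using measurable_compose[OF Fm, of g' borel] g'm by simp
  have "set_integrable lborel D (\<lambda>x. (cmod (J x))\<^sup>2 *\<^sub>R g (f x)) \<longleftrightarrow> integrable lborel (\<lambda>x. w x *\<^sub>R g' (F x))"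
    by (simp only: set_integrable_def comp)
  also have "\<dots> \<longleftrightarrow> integrable (density lborel (\<lambda>x. ennreal (w x))) (\<lambda>x. g' (F x))"
    using wm gF by (subst integrable_density) (auto simp: w_def)
  also have "\<dots> \<longleftrightarrow> integrable (distr (density lborel (\<lambda>x. ennreal (w x))) borel F) g'"
    using Fm g'm by (subst integrable_distr_eq) auto
  also have "\<dots> \<longleftrightarrow> integrable lborel (\<lambda>y. (real (card G) * indicator (f ` Reg) y) *\<^sub>R g' y)"
    unfolding d using nm g'm by (subst integrable_density) auto
  also have "\<dots> \<longleftrightarrow> integrable lborel g'"
  proof
    assume "integrable lborel (\<lambda>y. (real (card G) * indicator (f ` Reg) y) *\<^sub>R g' y)"
    then have "integrable lborel (\<lambda>y. real (card G) *\<^sub>R g' y)" by (simp only: comp2)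
    then have "integrable lborel (\<lambda>y. (1 / real (card G)) *\<^sub>R (real (card G) *\<^sub>R g' y))"
      by (rule integrable_scaleR_right)
    moreover have "(\<lambda>y. (1 / real (card G)) *\<^sub>R (real (card G) *\<^sub>R g' y)) = g'"
      using card_G by (simp add: fun_eq_iff)
    ultimately show "integrable lborel g'" by (simp only:)
  next
    assume "integrable lborel g'"
    then show "integrable lborel (\<lambda>y. (real (card G) * indicator (f ` Reg) y) *\<^sub>R g' y)"
      unfolding comp2 by (rule integrable_scaleR_right)
  qed
  also have "\<dots> \<longleftrightarrow> set_integrable lborel (f ` Reg) g"
    by (simp add: set_integrable_def g'_def)
  finally show "set_integrable lborel D (\<lambda>x. (cmod (J x))\<^sup>2 *\<^sub>R g (f x)) \<longleftrightarrow> set_integrable lborel (f ` Reg) g" .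
  have "(LINT x:D|lborel. (cmod (J x))\<^sup>2 *\<^sub>R g (f x)) = (LINT x|lborel. w x *\<^sub>R g' (F x))"
    by (simp only: set_lebesgue_integral_def comp)
  also have "\<dots> = (LINT x|density lborel (\<lambda>x. ennreal (w x)). g' (F x))"
    using wm gF by (subst integral_density) (auto simp: w_def)
  also have "\<dots> = (LINT y|distr (density lborel (\<lambda>x. ennreal (w x))) borel F. g' y)"
    using Fm g'm by (subst integral_distr) auto
  also have "\<dots> = (LINT y|lborel. (real (card G) * indicator (f ` Reg) y) *\<^sub>R g' y)"
    unfolding d using nm g'm by (subst integral_density) auto
  also have "\<dots> = real (card G) *\<^sub>R (LINT y|lborel. g' y)"
    unfolding comp2 by (rule integral_scaleR_right)
  also have "\<dots> = real (card G) *\<^sub>R (LINT y:f ` Reg|lborel. g y)"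
    by (simp add: set_lebesgue_integral_def g'_def)
  finally show "(LINT x:D|lborel. (cmod (J x))\<^sup>2 *\<^sub>R g (f x)) = real (card G) *\<^sub>R (LINT y:f ` Reg|lborel. g y)" .
qed

end

section \<open>The null Lagrangian identity\<close>

text \<open>
  The terms of the Leibniz formula without their factor from row \<open>j\<close>: replacing row \<open>j\<close> of the
  Jacobian matrix by \<open>s\<close> gives a matrix whose determinant is the sum over \<open>\<pi>\<close> of
  \<open>sign \<pi> * s $ \<pi> j * cofactor_monomial a j \<pi> x\<close>.
\<close>

definition cofactor_monomial :: "(complex^'n \<Rightarrow> complex^'n) \<Rightarrow> 'n \<Rightarrow> ('n \<Rightarrow> 'n) \<Rightarrow> complex^'n \<Rightarrow> complex"
  where "cofactor_monomial a j \<pi> x = (\<Prod>m\<in>UNIV - {j}. jacobian a x $ m $ \<pi> m)"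

lemma holomorphic_fun_jacobian_entry:
  assumes "holomorphic_map a D" "open D"
  shows "holomorphic_fun (\<lambda>x. jacobian a x $ m $ k) D"
  using assms by (simp add: jacobian_def holomorphic_map_def holomorphic_fun_dderiv)

lemma holomorphic_fun_cofactor_monomial:
  assumes "holomorphic_map a D" "open D"
  shows "holomorphic_fun (cofactor_monomial a j \<pi>) D"
  unfolding cofactor_monomial_def
  by (intro holomorphic_fun_prod holomorphic_fun_jacobian_entry assms)

lemma det_replace_row:
  fixes B :: "complex^'n^'n"
  shows "det (\<chi> i. if i = j then s else B $ i)
    = (\<Sum>\<pi> | \<pi> permutes UNIV. of_int (sign \<pi>) * (s $ \<pi> j * (\<Prod>m\<in>UNIV - {j}. B $ m $ \<pi> m)))"
  unfolding det_def
proof (intro sum.cong refl arg_cong2[where f = "(*)"])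
  fix \<pi> :: "'n \<Rightarrow> 'n"
  have "(\<Prod>i\<in>UNIV. (\<chi> i. if i = j then s else B $ i) $ i $ \<pi> i)
    = (\<chi> i. if i = j then s else B $ i) $ j $ \<pi> j * (\<Prod>i\<in>UNIV - {j}. (\<chi> i. if i = j then s else B $ i) $ i $ \<pi> i)"
    by (rule prod.remove) auto
  also have "\<dots> = s $ \<pi> j * (\<Prod>m\<in>UNIV - {j}. B $ m $ \<pi> m)"
    by simp
  finally show "(\<Prod>i\<in>UNIV. (\<chi> i. if i = j then s else B $ i) $ i $ \<pi> i) = s $ \<pi> j * (\<Prod>m\<in>UNIV - {j}. B $ m $ \<pi> m)" .
qed

text \<open>
  Rows of cofactors are divergence free. After the product rule, each term contains one mixed second
  derivative of a component \<open>a\<^sub>m\<close> in the directions \<open>\<pi> j\<close> and \<open>\<pi> m\<close>. Composing \<open>\<pi>\<close> with the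
  transposition of \<open>j\<close> and \<open>m\<close> keeps the term, by symmetry of second derivatives, and reverses the sign.
\<close>

lemma piola_identity:
  fixes a :: "complex^'n::finite \<Rightarrow> complex^'n"
  assumes a: "holomorphic_map a D" and D: "open D" and x: "x \<in> D"
  shows "(\<Sum>\<pi> | \<pi> permutes UNIV. of_int (sign \<pi>) * dderiv (axis (\<pi> j) 1) (cofactor_monomial a j \<pi>) x) = 0"
proof -
  define h where "h m k l = dderiv (axis k 1) (dderiv (axis l 1) (\<lambda>z. a z $ m)) x" for m k l
  have ha: "holomorphic_fun (\<lambda>z. a z $ m) D" for m using a by (simp add: holomorphic_map_def)
  have sym: "h m k l = h m l k" for m k l
    unfolding h_def by (rule dderiv_commute[OF ha D x])
  define R where "R m \<pi> = (\<Prod>l\<in>UNIV - {j} - {m}. jacobian a x $ l $ \<pi> l)" for m \<pi>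
  have der: "dderiv (axis k 1) (cofactor_monomial a j \<pi>) x = (\<Sum>m\<in>UNIV - {j}. h m k (\<pi> m) * R m \<pi>)" for k \<pi>
  proof -
    have "(cofactor_monomial a j \<pi> has_derivative
        (\<lambda>v. \<Sum>m\<in>UNIV - {j}. dderiv v (\<lambda>x. jacobian a x $ m $ \<pi> m) x * R m \<pi>)) (at x)"
      unfolding cofactor_monomial_def R_def
      by (intro has_derivative_prod holomorphic_fun_has_derivative[OF holomorphic_fun_jacobian_entry[OF a D] D x])
    moreover have "(cofactor_monomial a j \<pi> has_derivative (\<lambda>v. dderiv v (cofactor_monomial a j \<pi>) x)) (at x)"
      by (rule holomorphic_fun_has_derivative[OF holomorphic_fun_cofactor_monomial[OF a D] D x])
    ultimately have "(\<lambda>v. dderiv v (cofactor_monomial a j \<pi>) x) = (\<lambda>v. \<Sum>m\<in>UNIV - {j}. dderiv v (\<lambda>x. jacobian a x $ m $ \<pi> m) x * R m \<pi>)"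
      by (rule has_derivative_unique[symmetric])
    from fun_cong[OF this, of "axis k 1"] show ?thesis
      by (simp add: jacobian_def h_def)
  qed
  define t where "t m \<pi> = of_int (sign \<pi>) * (h m (\<pi> j) (\<pi> m) * R m \<pi>)" for m \<pi>
  have zero: "(\<Sum>\<pi> | \<pi> permutes UNIV. t m \<pi>) = 0" if m: "m \<noteq> j" for m
  proof -
    let ?\<tau> = "Transposition.transpose j m"
    have \<tau>: "?\<tau> permutes UNIV" by (rule permutes_swap_id) auto
    have "(\<Sum>\<pi> | \<pi> permutes UNIV. t m \<pi>) = (\<Sum>\<pi> | \<pi> permutes UNIV. t m (\<pi> \<circ> ?\<tau>))"
      by (rule sum_permutations_compose_right[OF \<tau>])
    also have "\<dots> = (\<Sum>\<pi> | \<pi> permutes UNIV. - t m \<pi>)"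
    proof (intro sum.cong refl)
      fix \<pi> :: "'n \<Rightarrow> 'n" assume "\<pi> \<in> {\<pi>. \<pi> permutes UNIV}"
      then have "permutation \<pi>" "permutation ?\<tau>"
        using \<tau> permutes_imp_permutation[OF finite] by auto
      then have "sign (\<pi> \<circ> ?\<tau>) = - sign \<pi>" using m by (simp add: sign_compose sign_swap_id)
      moreover have "R m (\<pi> \<circ> ?\<tau>) = R m \<pi>"
        unfolding R_def by (intro prod.cong) (auto simp: transpose_def)
      moreover have "(\<pi> \<circ> ?\<tau>) j = \<pi> m" "(\<pi> \<circ> ?\<tau>) m = \<pi> j" by auto
      ultimately show "t m (\<pi> \<circ> ?\<tau>) = - t m \<pi>" by (simp add: t_def sym[of m "\<pi> m" "\<pi> j"])
    qed
    also have "\<dots> = - (\<Sum>\<pi> | \<pi> permutes UNIV. t m \<pi>)" by (rule sum_negf)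
    finally show ?thesis by simp
  qed
  have "(\<Sum>\<pi> | \<pi> permutes UNIV. of_int (sign \<pi>) * dderiv (axis (\<pi> j) 1) (cofactor_monomial a j \<pi>) x)
      = (\<Sum>\<pi> | \<pi> permutes UNIV. \<Sum>m\<in>UNIV - {j}. t m \<pi>)"
    by (simp add: der t_def sum_distrib_left)
  also have "\<dots> = (\<Sum>m\<in>UNIV - {j}. \<Sum>\<pi> | \<pi> permutes UNIV. t m \<pi>)" by (rule sum.swap)
  also have "\<dots> = 0" using zero by (intro sum.neutral) auto
  finally show ?thesis .
qed

lemma positive_part_square_taylor:
  fixes s t :: real
  shows "\<bar>(max 0 t)\<^sup>2 - (max 0 s)\<^sup>2 - 2 * max 0 s * (t - s)\<bar> \<le> (t - s)\<^sup>2"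
proof -
  consider "s \<ge> 0" "t \<ge> 0" | "s \<ge> 0" "t < 0" | "s < 0" "t \<ge> 0" | "s < 0" "t < 0" by linarith
  then show ?thesis
  proof cases
    case 1
    have "t\<^sup>2 - s\<^sup>2 - 2 * s * (t - s) = (t - s)\<^sup>2" by (simp add: power2_eq_square algebra_simps)
    then show ?thesis using 1 by (simp add: max_absorb2)
  next
    case 2
    then have "s * t \<le> 0" by (simp add: mult_nonneg_nonpos)
    moreover have "- s\<^sup>2 - 2 * s * (t - s) = s\<^sup>2 - 2 * (s * t)" "(t - s)\<^sup>2 = t\<^sup>2 - 2 * (s * t) + s\<^sup>2"
      by (simp_all add: power2_eq_square algebra_simps)
    ultimately have "\<bar>- s\<^sup>2 - 2 * s * (t - s)\<bar> \<le> (t - s)\<^sup>2"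
      using zero_le_power2[of s] zero_le_power2[of t] by linarith
    then show ?thesis using 2 by (simp add: max_def)
  next
    case 3
    then have "s * t \<le> 0" by (simp add: mult_nonpos_nonneg)
    moreover have "s * s \<ge> 0" by simp
    moreover have "(t - s) * (t - s) = t * t - 2 * (s * t) + s * s" by (simp add: algebra_simps)
    ultimately have "t * t \<le> (t - s) * (t - s)" by linarith
    then show ?thesis using 3 by (simp add: max_def power2_eq_square)
  qed (simp add: max_def)
qed

lemma positive_part_square_derivative:
  "((\<lambda>t::real. (max 0 t)\<^sup>2) has_real_derivative 2 * max 0 s) (at s)"
  unfolding DERIV_def
proof -
  have "((\<lambda>h. ((max 0 (s + h))\<^sup>2 - (max 0 s)\<^sup>2) / h - 2 * max 0 s) \<longlongrightarrow> 0) (at 0)"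
  proof (rule Lim_null_comparison)
    show "((\<lambda>h::real. \<bar>h\<bar>) \<longlongrightarrow> 0) (at 0)" by (rule tendsto_eq_intros refl)+ simp
    show "\<forall>\<^sub>F h in at 0. norm (((max 0 (s + h))\<^sup>2 - (max 0 s)\<^sup>2) / h - 2 * max 0 s) \<le> \<bar>h\<bar>"
      using eventually_neq_at_within[of "0::real"]
    proof eventually_elim
      case (elim h)
      have "((max 0 (s + h))\<^sup>2 - (max 0 s)\<^sup>2) / h - 2 * max 0 s
          = ((max 0 (s + h))\<^sup>2 - (max 0 s)\<^sup>2 - 2 * max 0 s * h) / h"
        using elim by (simp add: field_simps)
      also have "norm \<dots> \<le> h\<^sup>2 / \<bar>h\<bar>"
        using positive_part_square_taylor[of "s + h" s] by (auto simp: intro!: divide_right_mono)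
      also have "\<dots> = \<bar>h\<bar>" using elim by (simp add: power2_eq_square abs_if)
      finally show ?case .
    qed
  qed
  then show "((\<lambda>y. ((max 0 (s + y))\<^sup>2 - (max 0 s)\<^sup>2) / y) \<longlongrightarrow> 2 * max 0 s) (at 0)"
    by (rule LIM_zero_cancel)
qed

lemma has_derivative_truncation:
  fixes a :: "complex^'n::finite \<Rightarrow> complex^'m::finite"
  assumes "(a has_derivative a') (at x)"
  shows "((\<lambda>x. (max 0 (\<epsilon>\<^sup>2 - (norm (a x))\<^sup>2))\<^sup>2) has_derivative
    (\<lambda>v. - 4 * max 0 (\<epsilon>\<^sup>2 - (norm (a x))\<^sup>2) * (a x \<bullet> a' v))) (at x)"
proof -
  have "((\<lambda>x. \<epsilon>\<^sup>2 - a x \<bullet> a x) has_derivative (\<lambda>v. - 2 * (a x \<bullet> a' v))) (at x)"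
    using assms by (auto intro!: derivative_eq_intros simp: inner_commute)
  then have 1: "((\<lambda>x. \<epsilon>\<^sup>2 - (norm (a x))\<^sup>2) has_derivative (\<lambda>v. - 2 * (a x \<bullet> a' v))) (at x)"
    by (simp add: power2_norm_eq_inner)
  have 2: "((\<lambda>t::real. (max 0 t)\<^sup>2) has_derivative (*) (2 * max 0 (\<epsilon>\<^sup>2 - (norm (a x))\<^sup>2))) (at (\<epsilon>\<^sup>2 - (norm (a x))\<^sup>2))"
    using positive_part_square_derivative by (simp add: has_field_derivative_def)
  from diff_chain_at[OF 1 2] show ?thesis by (simp add: o_def mult_ac)
qed

text \<open>
  The left-hand side is twice the Wirtinger derivative \<open>\<partial>\<close> of a real linear function of \<open>c\<close>,
  evaluated from its values at \<open>c\<close> and \<open>\<i> *s c\<close>. The Wirtinger derivatives below are formed in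
  this way.
\<close>

lemma inner_wirtinger:
  fixes a c :: "complex^'m::finite"
  shows "complex_of_real (a \<bullet> c) - \<i> * complex_of_real (a \<bullet> (\<i> *s c)) = (\<Sum>i\<in>UNIV. cnj (a $ i) * c $ i)"
proof -
  have "complex_of_real (a $ i \<bullet> c $ i) - \<i> * complex_of_real (a $ i \<bullet> (\<i> * c $ i)) = cnj (a $ i) * c $ i" for i
    by (simp add: complex_eq_iff inner_complex_def)
  then show ?thesis
    by (simp add: inner_vec_def sum_distrib_left flip: sum_subtractf)
qed

text \<open>
  Let \<open>\<theta> = (max 0 (\<epsilon>^2 - \<bar>a\<bar>^2))^2\<close>, which has compact support in \<open>D\<close>. Its Wirtinger gradient is
  \<open>- 2 * max 0 (\<epsilon>^2 - \<bar>a\<bar>^2) * (\<Sum>i. cnj a\<^sub>i * \<partial>a\<^sub>i)\<close>. Replacing row \<open>j\<close> of the Jacobian matrix of \<open>a\<close>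
  by it yields a matrix with determinant \<open>- 2 * max 0 (\<epsilon>^2 - \<bar>a\<bar>^2) * cnj a\<^sub>j * det\<close>, the integrand up
  to \<open>cnj H\<close> and a constant. Expanding the determinant along row \<open>j\<close> and integrating by parts, no
  boundary terms appear, \<open>cnj H\<close> is annihilated by \<open>\<partial>\<close>, and the derivatives of the cofactors cancel
  by the Piola identity.
\<close>

lemma null_lagrangian_integral:
  fixes a :: "complex^'n::finite \<Rightarrow> complex^'n"
  assumes a: "holomorphic_map a D" and D: "open D" and H: "holomorphic_fun H D"
    and K: "compact {x \<in> D. norm (a x) \<le> \<epsilon>}" and \<epsilon>: "\<epsilon> \<ge> 0"
  shows "(LINT x:D|lborel. cnj (H x) * det (jacobian a x) * cnj (a x $ j) * of_real (max 0 (\<epsilon>\<^sup>2 - (norm (a x))\<^sup>2))) = 0"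
proof -
  define K where "K = {x \<in> D. norm (a x) \<le> \<epsilon>}"
  define u where "u x = max 0 (\<epsilon>\<^sup>2 - (norm (a x))\<^sup>2)" for x
  have u0: "u x = 0" if "x \<in> D" "x \<notin> K" for x
  proof -
    have "norm (a x) \<ge> \<epsilon>" using that by (simp add: K_def)
    then have "(norm (a x))\<^sup>2 \<ge> \<epsilon>\<^sup>2" using \<epsilon> by (intro power_mono)
    then show ?thesis by (simp add: u_def)
  qed
  have cK: "compact K" using K by (simp add: K_def)
  have oK: "open (- K)" using cK by (simp add: compact_imp_closed open_Compl)
  have KD: "K \<subseteq> D" by (auto simp: K_def)
  have un: "D \<union> - K = UNIV" using KD by auto
  let ?P = "cofactor_monomial a j"
  have ca: "continuous_on D a" by (rule holomorphic_map_imp_continuous_on[OF a])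
  have cH: "continuous_on D H" by (rule holomorphic_fun_imp_continuous_on[OF H])
  have holP: "holomorphic_fun (?P \<pi>) D" for \<pi> by (rule holomorphic_fun_cofactor_monomial[OF a D])
  have cP: "continuous_on D (?P \<pi>)" for \<pi> by (rule holomorphic_fun_imp_continuous_on[OF holP])
  have cu: "continuous_on D u" unfolding u_def by (intro continuous_intros ca)
  have cA: "continuous_on D (\<lambda>x. jacobian a x *v v)" for v
  proof -
    have "continuous_on D (\<lambda>x. \<chi> i. \<Sum>k\<in>UNIV. jacobian a x $ i $ k * v $ k)"
      by (intro continuous_on_vec_lambda continuous_intros
          holomorphic_fun_imp_continuous_on[OF holomorphic_fun_jacobian_entry[OF a D]])
    then show ?thesis by (simp add: matrix_vector_mult_def)
  qed
  have cd: "continuous_on D (dderiv v g)" if "holomorphic_fun g D" for v g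
    by (rule holomorphic_fun_imp_continuous_on[OF holomorphic_fun_dderiv[OF that D]])
  define \<psi> where "\<psi> \<pi> x = (if x \<in> D then cnj (H x) * of_real ((u x)\<^sup>2) * ?P \<pi> x else 0)" for \<pi> x
  define \<psi>' where "\<psi>' \<pi> x v = (if x \<in> D then
      cnj (H x) * of_real ((u x)\<^sup>2) * dderiv v (?P \<pi>) x
      + (cnj (H x) * of_real (- 4 * u x * (a x \<bullet> (jacobian a x *v v))) + cnj (dderiv v H x) * of_real ((u x)\<^sup>2)) * ?P \<pi> x
    else 0)" for \<pi> x v
  have der: "(\<psi> \<pi> has_derivative \<psi>' \<pi> x) (at x)" for \<pi> x
  proof (cases "x \<in> D")
    case True
    have "((\<lambda>x. (cnj (H x) * of_real ((u x)\<^sup>2)) * ?P \<pi> x) has_derivative \<psi>' \<pi> x) (at x)"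
      unfolding \<psi>'_def if_P[OF True]
      by (intro has_derivative_mult has_derivative_cnj has_derivative_of_real holomorphic_fun_has_derivative[OF H D True]
          holomorphic_fun_has_derivative[OF holP D True]
          has_derivative_truncation[OF holomorphic_map_has_derivative[OF a D True], of \<epsilon>, folded u_def])
    then show ?thesis
      by (rule has_derivative_transform_within_open[OF _ D True]) (simp add: \<psi>_def)
  next
    case False
    then have xK: "x \<in> - K" using KD by auto
    have "((\<lambda>x. 0) has_derivative (\<lambda>v. 0 :: complex)) (at x)" by simp
    then have "(\<psi> \<pi> has_derivative (\<lambda>v. 0)) (at x)"
      by (rule has_derivative_transform_within_open[OF _ oK xK]) (simp add: \<psi>_def u0)
    moreover have "\<psi>' \<pi> x = (\<lambda>v. 0)" using False by (simp add: \<psi>'_def fun_eq_iff)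
    ultimately show ?thesis by simp
  qed
  have cont: "continuous_on UNIV (\<lambda>x. \<psi>' \<pi> x v)" for \<pi> v
  proof -
    have "continuous_on D (\<lambda>x. cnj (H x) * of_real ((u x)\<^sup>2) * dderiv v (?P \<pi>) x
      + (cnj (H x) * of_real (- 4 * u x * (a x \<bullet> (jacobian a x *v v))) + cnj (dderiv v H x) * of_real ((u x)\<^sup>2)) * ?P \<pi> x)"
      by (intro continuous_intros cH cu cP cA ca cd H holP)
    then have 1: "continuous_on D (\<lambda>x. \<psi>' \<pi> x v)"
      by (rule continuous_on_eq) (simp add: \<psi>'_def)
    have "continuous_on (- K) (\<lambda>x. 0 :: complex)" by simp
    then have 2: "continuous_on (- K) (\<lambda>x. \<psi>' \<pi> x v)"
      by (rule continuous_on_eq) (auto simp: \<psi>'_def u0)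
    show ?thesis using continuous_on_open_Un[OF D oK 1 2] un by simp
  qed
  have supp: "\<psi> \<pi> x = 0" if "x \<notin> K" for \<pi> x using that by (simp add: \<psi>_def u0)
  \<comment> \<open>Twice the Wirtinger derivative of \<open>\<psi> \<pi>\<close> in direction \<open>\<pi> j\<close>.\<close>
  define W where "W \<pi> x = \<psi>' \<pi> x (axis (\<pi> j) 1) - \<i> * \<psi>' \<pi> x (axis (\<pi> j) \<i>)" for \<pi> x
  note zero = integral_directional_derivative_eq_0[OF der cont cK supp]
  have Wi: "integrable lborel (W \<pi>)" for \<pi>
    unfolding W_def by (intro Bochner_Integration.integrable_diff integrable_mult_right zero)
  have W0: "(LINT x|lborel. W \<pi> x) = 0" for \<pi>
    unfolding W_def by (simp add: zero)
  have "(LINT x|lborel. (\<Sum>\<pi> | \<pi> permutes UNIV. of_int (sign \<pi>) * W \<pi> x))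
      = (\<Sum>\<pi> | \<pi> permutes UNIV. of_int (sign \<pi>) * (LINT x|lborel. W \<pi> x))"
    using Wi by (subst Bochner_Integration.integral_sum) auto
  then have total: "(LINT x|lborel. (\<Sum>\<pi> | \<pi> permutes UNIV. of_int (sign \<pi>) * W \<pi> x)) = 0"
    by (simp add: W0)
  have "(\<Sum>\<pi> | \<pi> permutes UNIV. of_int (sign \<pi>) * W \<pi> x)
      = (- 4) * (indicator D x *\<^sub>R (cnj (H x) * det (jacobian a x) * cnj (a x $ j) * of_real (u x)))" for x
  proof (cases "x \<in> D")
    case True
    define S where "S = (\<Sum>i\<in>UNIV. cnj (a x $ i) *s row i (jacobian a x))"
    have Sk: "S $ k = (\<Sum>i\<in>UNIV. cnj (a x $ i) * jacobian a x $ i $ k)" for k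
      by (simp add: S_def row_def)
    have Wf: "W \<pi> x = 2 * (cnj (H x) * of_real ((u x)\<^sup>2)) * dderiv (axis (\<pi> j) 1) (?P \<pi>) x
        + (- 4) * (cnj (H x) * of_real (u x)) * (S $ \<pi> j * ?P \<pi> x)" for \<pi>
    proof -
      let ?e = "axis (\<pi> j) 1 :: complex^'n"
      have ie: "axis (\<pi> j) \<i> = \<i> *s ?e" by (simp add: vec_eq_iff axis_def)
      have dP: "dderiv (\<i> *s ?e) (?P \<pi>) x = \<i> * dderiv ?e (?P \<pi>) x"
        by (rule holomorphic_fun_dderiv_scale[OF holP D True])
      have dH: "dderiv (\<i> *s ?e) H x = \<i> * dderiv ?e H x"
        by (rule holomorphic_fun_dderiv_scale[OF H D True])
      have "(jacobian a x *v ?e) $ i = jacobian a x $ i $ \<pi> j" for i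
        by (simp add: matrix_vector_mult_def axis_def if_distrib[of "\<lambda>c. _ * c"] cong: if_cong)
      then have wi: "of_real (a x \<bullet> (jacobian a x *v ?e)) - \<i> * of_real (a x \<bullet> (jacobian a x *v (\<i> *s ?e))) = S $ \<pi> j"
        unfolding Sk vec.scale by (subst inner_wirtinger) simp
      have "W \<pi> x = 2 * (cnj (H x) * of_real ((u x)\<^sup>2)) * dderiv ?e (?P \<pi>) x
        + (- 4) * (cnj (H x) * of_real (u x)) * ((of_real (a x \<bullet> (jacobian a x *v ?e)) - \<i> * of_real (a x \<bullet> (jacobian a x *v (\<i> *s ?e)))) * ?P \<pi> x)"
        unfolding W_def \<psi>'_def if_P[OF True] ie dP dH
        by (simp add: algebra_simps)
      then show ?thesis unfolding wi .
    qed
    have d: "(\<Sum>\<pi> | \<pi> permutes UNIV. of_int (sign \<pi>) * (S $ \<pi> j * ?P \<pi> x)) = cnj (a x $ j) * det (jacobian a x)"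
    proof -
      have "(\<Sum>\<pi> | \<pi> permutes UNIV. of_int (sign \<pi>) * (S $ \<pi> j * ?P \<pi> x)) = det (\<chi> i. if i = j then S else jacobian a x $ i)"
        by (simp add: det_replace_row cofactor_monomial_def)
      also have "(\<chi> i. if i = j then S else jacobian a x $ i)
          = (\<chi> i. if i = j then (\<Sum>i\<in>UNIV. (\<chi> i. cnj (a x $ i)) $ i *s row i (jacobian a x)) else row i (jacobian a x))"
        by (simp add: S_def vec_eq_iff row_def)
      also have "det \<dots> = cnj (a x $ j) * det (jacobian a x)"
        by (subst cramer_lemma_transpose) simp
      finally show ?thesis .
    qed
    have "(\<Sum>\<pi> | \<pi> permutes UNIV. of_int (sign \<pi>) * W \<pi> x)
      = 2 * (cnj (H x) * of_real ((u x)\<^sup>2)) * (\<Sum>\<pi> | \<pi> permutes UNIV. of_int (sign \<pi>) * dderiv (axis (\<pi> j) 1) (?P \<pi>) x)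
       + (- 4) * (cnj (H x) * of_real (u x)) * (\<Sum>\<pi> | \<pi> permutes UNIV. of_int (sign \<pi>) * (S $ \<pi> j * ?P \<pi> x))"
      unfolding Wf sum_distrib_left sum.distrib[symmetric]
      by (intro sum.cong refl) (simp add: algebra_simps)
    also have "\<dots> = (- 4) * (cnj (H x) * of_real (u x)) * (cnj (a x $ j) * det (jacobian a x))"
      unfolding d piola_identity[OF a D True] by simp
    finally show ?thesis using True by (simp add: mult_ac)
  next
    case False
    then show ?thesis by (simp add: W_def \<psi>'_def)
  qed
  with total have "(LINT x|lborel. (- 4) * (indicator D x *\<^sub>R (cnj (H x) * det (jacobian a x) * cnj (a x $ j) * of_real (u x)))) = 0"
    by simp
  then show ?thesis
    unfolding set_lebesgue_integral_def u_def by (subst (asm) integral_mult_right_zero) simp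
qed

section \<open>Regularity of weakly holomorphic functions\<close>

text \<open>
  The square of this function is the mollifier. It is continuously differentiable, with
  antiholomorphic derivatives \<open>- 2 * bump \<epsilon> y * y $ j\<close>: a weak Cauchy-Riemann equation needs to be
  known for these functions only.
\<close>

definition bump :: "real \<Rightarrow> complex^'n::finite \<Rightarrow> real"
  where "bump \<epsilon> y = max 0 (\<epsilon>\<^sup>2 - (norm y)\<^sup>2)"

lemma bump_nonneg: "bump \<epsilon> y \<ge> 0" by (simp add: bump_def)
lemma bump_le: "bump \<epsilon> y \<le> \<epsilon>\<^sup>2" by (simp add: bump_def)
lemma bump_outside: "\<epsilon> \<ge> 0 \<Longrightarrow> \<epsilon> \<le> norm y \<Longrightarrow> bump \<epsilon> y = 0"
  using power_mono[of \<epsilon> "norm y" 2] by (simp add: bump_def)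

lemma continuous_on_bump [continuous_intros]:
  "continuous_on S g \<Longrightarrow> continuous_on S (\<lambda>x. bump \<epsilon> (g x))"
  unfolding bump_def by (intro continuous_intros)

text \<open>
  The first-order Taylor expansion of the mollifier with an explicit constant, which allows
  differentiation under the integral without a limit theorem.
\<close>

lemma bump_taylor:
  assumes y: "norm y \<le> M" and w: "norm w \<le> 1"
  shows "\<bar>(bump \<epsilon> (y - w))\<^sup>2 - (bump \<epsilon> y)\<^sup>2 - 4 * bump \<epsilon> y * (y \<bullet> w)\<bar> \<le> ((2 * M + 1)\<^sup>2 + 2 * \<epsilon>\<^sup>2) * (norm w)\<^sup>2"
proof -
  define a where "a = \<epsilon>\<^sup>2 - (norm y)\<^sup>2"
  define b where "b = \<epsilon>\<^sup>2 - (norm (y - w))\<^sup>2"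
  have ba: "b - a = 2 * (y \<bullet> w) - (norm w)\<^sup>2"
    by (simp add: a_def b_def power2_norm_eq_inner inner_diff_left inner_diff_right inner_commute)
  have "\<bar>y \<bullet> w\<bar> \<le> M * norm w"
    using Cauchy_Schwarz_ineq2[of y w] mult_right_mono[OF y norm_ge_zero[of w]] by linarith
  moreover have "(norm w)\<^sup>2 \<le> norm w" using w by (simp add: power2_eq_square mult_left_le)
  ultimately have "\<bar>b - a\<bar> \<le> 2 * (M * norm w) + norm w"
    unfolding ba using zero_le_power2[of "norm w"] by linarith
  then have "\<bar>b - a\<bar> \<le> (2 * M + 1) * norm w" by (simp add: algebra_simps)
  then have sq: "(b - a)\<^sup>2 \<le> (2 * M + 1)\<^sup>2 * (norm w)\<^sup>2"
    using power_mono[of "\<bar>b - a\<bar>" "(2 * M + 1) * norm w" 2] by (simp add: power_mult_distrib)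
  have "(bump \<epsilon> (y - w))\<^sup>2 - (bump \<epsilon> y)\<^sup>2 - 4 * bump \<epsilon> y * (y \<bullet> w)
      = ((max 0 b)\<^sup>2 - (max 0 a)\<^sup>2 - 2 * max 0 a * (b - a)) - 2 * bump \<epsilon> y * (norm w)\<^sup>2"
    unfolding ba by (simp add: bump_def a_def b_def algebra_simps)
  moreover have "\<bar>(max 0 b)\<^sup>2 - (max 0 a)\<^sup>2 - 2 * max 0 a * (b - a)\<bar> \<le> (2 * M + 1)\<^sup>2 * (norm w)\<^sup>2"
    using positive_part_square_taylor[of b a] sq by linarith
  moreover have "0 \<le> 2 * bump \<epsilon> y * (norm w)\<^sup>2" "2 * bump \<epsilon> y * (norm w)\<^sup>2 \<le> 2 * \<epsilon>\<^sup>2 * (norm w)\<^sup>2"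
    using bump_nonneg[of \<epsilon> y] bump_le[of \<epsilon> y] by (auto intro!: mult_right_mono)
  ultimately show ?thesis unfolding distrib_right by linarith
qed

lemma set_integrable_mult_continuous:
  fixes h \<phi> :: "'a::euclidean_space \<Rightarrow> complex"
  assumes h: "set_integrable lborel B h" and B: "compact B" and \<phi>: "continuous_on UNIV \<phi>"
  shows "set_integrable lborel B (\<lambda>x. h x * \<phi> x)"
proof -
  have "bounded (\<phi> ` B)"
    by (intro compact_imp_bounded compact_continuous_image B continuous_on_subset[OF \<phi>]) auto
  then obtain c where c: "c > 0" "\<And>x. x \<in> B \<Longrightarrow> cmod (\<phi> x) \<le> c" by (auto simp: bounded_pos)
  have \<phi>m: "\<phi> \<in> borel_measurable lborel" using borel_measurable_continuous_onI[OF \<phi>] by simp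
  have "integrable lborel (\<lambda>x. (indicator B x *\<^sub>R h x) * \<phi> x)"
  proof (rule Bochner_Integration.integrable_bound)
    show "integrable lborel (\<lambda>x. c *\<^sub>R (indicator B x *\<^sub>R h x))"
      using h unfolding set_integrable_def by (rule integrable_scaleR_right)
    show "(\<lambda>x. (indicator B x *\<^sub>R h x) * \<phi> x) \<in> borel_measurable lborel"
      using h \<phi>m unfolding set_integrable_def by (intro borel_measurable_times) auto
    show "AE x in lborel. norm ((indicator B x *\<^sub>R h x) * \<phi> x) \<le> norm (c *\<^sub>R (indicator B x *\<^sub>R h x))"
    proof (rule AE_I2)
      fix x
      have "x \<in> B \<Longrightarrow> cmod (h x) * cmod (\<phi> x) \<le> cmod (h x) * c" using c by (intro mult_left_mono) auto
      then show "norm ((indicator B x *\<^sub>R h x) * \<phi> x) \<le> norm (c *\<^sub>R (indicator B x *\<^sub>R h x))"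
        using c(1) by (auto simp: norm_mult indicator_def mult.commute)
    qed
  qed
  then show ?thesis by (simp add: set_integrable_def)
qed

definition mollify :: "(complex^'n::finite) set \<Rightarrow> (complex^'n \<Rightarrow> complex) \<Rightarrow> real \<Rightarrow> complex^'n \<Rightarrow> complex"
  where "mollify B h \<epsilon> p = (LINT x:B|lborel. h x * of_real ((bump \<epsilon> (x - p))\<^sup>2))"

lemma two_inner_complex_vec:
  fixes y w :: "complex^'n::finite"
  shows "complex_of_real (2 * (y \<bullet> w)) = (\<Sum>j\<in>UNIV. cnj (y $ j) * w $ j) + (\<Sum>j\<in>UNIV. y $ j * cnj (w $ j))"
proof -
  have "complex_of_real (2 * (y $ j \<bullet> w $ j)) = cnj (y $ j) * w $ j + y $ j * cnj (w $ j)" for j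
    by (simp add: complex_eq_iff inner_complex_def)
  then show ?thesis
    by (simp add: inner_vec_def sum_distrib_left flip: sum.distrib)
qed

text \<open>
  The real derivative of the mollification in direction \<open>w\<close> is the integral of \<open>h\<close> against a
  multiple of \<open>bump \<epsilon> y * 2 * (y \<bullet> w)\<close> with \<open>y = x - p\<close>, and \<open>2 * (y \<bullet> w)\<close> splits into a part linear in \<open>w\<close> and a part
  linear in the conjugates of its components. The weak equations make the second part vanish.
\<close>

lemma mollify_has_complex_derivative:
  fixes h :: "complex^'n::finite \<Rightarrow> complex"
  assumes h: "set_integrable lborel B h" and B: "compact B" and p: "cball p \<epsilon> \<subseteq> B" and \<epsilon>: "\<epsilon> > 0"
    and weak: "\<And>j. (LINT x:cball p \<epsilon>|lborel. h x * (x - p) $ j * of_real (bump \<epsilon> (x - p))) = 0"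
  obtains \<beta> :: "complex^'n" where "(mollify B h \<epsilon> has_derivative (\<lambda>w. \<Sum>j\<in>UNIV. \<beta> $ j * w $ j)) (at p)"
proof -
  note intg = set_integrable_mult_continuous[OF h B]
  have ccoord: "continuous_on UNIV (\<lambda>x :: complex^'n. (x - p) $ j)" for j
    by (intro continuous_intros linear_continuous_on bounded_linear_vec_nth)
  obtain M0 where M0: "\<And>x. x \<in> B \<Longrightarrow> norm x \<le> M0"
    using compact_imp_bounded[OF B] by (auto simp: bounded_iff)
  define M where "M = M0 + norm p"
  have M: "norm (x - p) \<le> M" if "x \<in> B" for x
    using M0[OF that] norm_triangle_ineq4[of x p] by (simp add: M_def)
  define C where "C = (2 * M + 1)\<^sup>2 + 2 * \<epsilon>\<^sup>2"
  define N where "N = (LINT x:B|lborel. cmod (h x))"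
  define \<beta> :: "complex^'n" where "\<beta> = (\<chi> j. LINT x:B|lborel. h x * (of_real (2 * bump \<epsilon> (x - p)) * cnj ((x - p) $ j)))"
  have i1: "set_integrable lborel B (\<lambda>x. h x * (of_real (2 * bump \<epsilon> (x - p)) * cnj ((x - p) $ j)))" for j
    by (intro intg continuous_intros ccoord)
  have i2: "set_integrable lborel B (\<lambda>x. h x * (of_real (2 * bump \<epsilon> (x - p)) * (x - p) $ j))" for j
    by (intro intg continuous_intros ccoord)
  have i3: "set_integrable lborel B (\<lambda>x. h x * of_real ((bump \<epsilon> (x - q))\<^sup>2))" for q
    by (intro intg continuous_intros)
  have i4: "set_integrable lborel B (\<lambda>x. h x * of_real (4 * bump \<epsilon> (x - p) * ((x - p) \<bullet> w)))" for w
    by (intro intg continuous_intros)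
  have \<gamma>: "(LINT x:B|lborel. h x * (of_real (2 * bump \<epsilon> (x - p)) * (x - p) $ j)) = 0" for j
  proof -
    have eq: "(\<lambda>x. indicator B x *\<^sub>R (h x * (of_real (2 * bump \<epsilon> (x - p)) * (x - p) $ j)))
        = (\<lambda>x. 2 * (indicator (cball p \<epsilon>) x *\<^sub>R (h x * (x - p) $ j * of_real (bump \<epsilon> (x - p)))))"
    proof (rule ext)
      fix x
      show "indicator B x *\<^sub>R (h x * (of_real (2 * bump \<epsilon> (x - p)) * (x - p) $ j))
        = 2 * (indicator (cball p \<epsilon>) x *\<^sub>R (h x * (x - p) $ j * of_real (bump \<epsilon> (x - p))))"
      proof (cases "x \<in> cball p \<epsilon>")
        case True
        then have "x \<in> B" using p by blast
        with True show ?thesis by (simp add: mult_ac)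
      next
        case False
        then have "bump \<epsilon> (x - p) = 0" using \<epsilon> by (intro bump_outside) (auto simp: dist_norm norm_minus_commute)
        then show ?thesis by simp
      qed
    qed
    show ?thesis
      using weak[of j] unfolding set_lebesgue_integral_def eq
      by (simp only: integral_mult_right_zero mult_zero_right)
  qed
  have L: "(LINT x:B|lborel. h x * of_real (4 * bump \<epsilon> (x - p) * ((x - p) \<bullet> w))) = (\<Sum>j\<in>UNIV. \<beta> $ j * w $ j)" for w
  proof -
    have "h x * of_real (4 * bump \<epsilon> (x - p) * ((x - p) \<bullet> w))
        = (\<Sum>j\<in>UNIV. h x * (of_real (2 * bump \<epsilon> (x - p)) * cnj ((x - p) $ j)) * w $ j)
        + (\<Sum>j\<in>UNIV. h x * (of_real (2 * bump \<epsilon> (x - p)) * (x - p) $ j) * cnj (w $ j))" for x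
    proof -
      have "h x * of_real (4 * bump \<epsilon> (x - p) * ((x - p) \<bullet> w))
        = h x * of_real (2 * bump \<epsilon> (x - p)) * of_real (2 * ((x - p) \<bullet> w))" by simp
      also have "\<dots> = h x * of_real (2 * bump \<epsilon> (x - p)) *
          ((\<Sum>j\<in>UNIV. cnj ((x - p) $ j) * w $ j) + (\<Sum>j\<in>UNIV. (x - p) $ j * cnj (w $ j)))"
        by (simp only: two_inner_complex_vec)
      finally show ?thesis by (simp only: distrib_left sum_distrib_left mult_ac)
    qed
    then have "(LINT x:B|lborel. h x * of_real (4 * bump \<epsilon> (x - p) * ((x - p) \<bullet> w)))
        = (LINT x:B|lborel. (\<Sum>j\<in>UNIV. h x * (of_real (2 * bump \<epsilon> (x - p)) * cnj ((x - p) $ j)) * w $ j)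
        + (\<Sum>j\<in>UNIV. h x * (of_real (2 * bump \<epsilon> (x - p)) * (x - p) $ j) * cnj (w $ j)))" by simp
    also have "\<dots> = (\<Sum>j\<in>UNIV. (LINT x:B|lborel. h x * (of_real (2 * bump \<epsilon> (x - p)) * cnj ((x - p) $ j))) * w $ j)
        + (\<Sum>j\<in>UNIV. (LINT x:B|lborel. h x * (of_real (2 * bump \<epsilon> (x - p)) * (x - p) $ j)) * cnj (w $ j))"
      using i1 i2 unfolding set_integrable_def set_lebesgue_integral_def
      by (simp add: scaleR_add_right scaleR_sum_right flip: mult_scaleR_left)
    finally show ?thesis unfolding \<gamma> \<beta>_def vec_lambda_beta by simp
  qed
  have est: "cmod (mollify B h \<epsilon> (p + w) - mollify B h \<epsilon> p - (\<Sum>j\<in>UNIV. \<beta> $ j * w $ j)) \<le> (C * N) * (norm w)\<^sup>2"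
    if w: "norm w \<le> 1" for w
  proof -
    let ?d = "\<lambda>x. (bump \<epsilon> (x - p - w))\<^sup>2 - (bump \<epsilon> (x - p))\<^sup>2 - 4 * bump \<epsilon> (x - p) * ((x - p) \<bullet> w)"
    have i5: "set_integrable lborel B (\<lambda>x. h x * of_real (?d x))"
      by (intro intg continuous_intros)
    have "mollify B h \<epsilon> (p + w) - mollify B h \<epsilon> p - (\<Sum>j\<in>UNIV. \<beta> $ j * w $ j)
        = (LINT x:B|lborel. h x * of_real ((bump \<epsilon> (x - (p + w)))\<^sup>2) - h x * of_real ((bump \<epsilon> (x - p))\<^sup>2)
             - h x * of_real (4 * bump \<epsilon> (x - p) * ((x - p) \<bullet> w)))"
      unfolding mollify_def L[symmetric]
      using set_integral_diff(2)[OF set_integral_diff(1)[OF i3[of "p + w"] i3[of p]] i4[of w]]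
        set_integral_diff(2)[OF i3[of "p + w"] i3[of p]] by (simp only:)
    also have "\<dots> = (LINT x:B|lborel. h x * of_real (?d x))"
      by (simp add: algebra_simps diff_diff_eq)
    also have "cmod \<dots> \<le> (LINT x:B|lborel. C * (norm w)\<^sup>2 * cmod (h x))"
      unfolding set_lebesgue_integral_def
    proof (rule order_trans[OF integral_norm_bound integral_mono])
      show "integrable lborel (\<lambda>x. norm (indicat_real B x *\<^sub>R (h x * complex_of_real (?d x))))"
        by (rule integrable_norm[OF i5[unfolded set_integrable_def]])
      show "integrable lborel (\<lambda>x. indicat_real B x *\<^sub>R (C * (norm w)\<^sup>2 * cmod (h x)))"
        using set_integrable_norm[OF h] by (simp add: set_integrable_def mult.left_commute[of "indicat_real B _"])
      fix x
      show "norm (indicat_real B x *\<^sub>R (h x * complex_of_real (?d x))) \<le> indicat_real B x *\<^sub>R (C * (norm w)\<^sup>2 * cmod (h x))"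
      proof (cases "x \<in> B")
        case True
        have "\<bar>?d x\<bar> \<le> C * (norm w)\<^sup>2" unfolding C_def by (rule bump_taylor[OF M[OF True] w])
        then have "cmod (h x) * \<bar>?d x\<bar> \<le> cmod (h x) * (C * (norm w)\<^sup>2)" by (intro mult_left_mono) auto
        then show ?thesis using True by (simp only: indicator_simps scaleR_one norm_mult norm_of_real) (simp add: mult_ac)
      qed simp
    qed
    also have "\<dots> = (C * N) * (norm w)\<^sup>2"
      by (simp add: N_def mult_ac)
    finally show ?thesis .
  qed
  have "(mollify B h \<epsilon> has_derivative (\<lambda>w. \<Sum>j\<in>UNIV. \<beta> $ j * w $ j)) (at p)"
    unfolding has_derivative_at
  proof
    show "bounded_linear (\<lambda>w. \<Sum>j\<in>UNIV. \<beta> $ j * w $ j)"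
      by (intro bounded_linear_sum bounded_linear_const_mult bounded_linear_vec_nth)
    show "((\<lambda>w. norm (mollify B h \<epsilon> (p + w) - mollify B h \<epsilon> p - (\<Sum>j\<in>UNIV. \<beta> $ j * w $ j)) / norm w) \<longlongrightarrow> 0) (at 0)"
    proof (rule Lim_null_comparison)
      show "((\<lambda>w :: complex^'n. C * N * norm w) \<longlongrightarrow> 0) (at 0)"
        by (rule tendsto_eq_intros refl)+ simp
      have "\<forall>\<^sub>F w :: complex^'n in at 0. norm w < 1"
        using order_tendstoD(2)[OF tendsto_norm[OF tendsto_ident_at], of "0 :: complex^'n" 1 UNIV] by simp
      then show "\<forall>\<^sub>F w in at 0. norm (norm (mollify B h \<epsilon> (p + w) - mollify B h \<epsilon> p - (\<Sum>j\<in>UNIV. \<beta> $ j * w $ j)) / norm w) \<le> C * N * norm w"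
        using eventually_neq_at_within[of 0]
      proof eventually_elim
        case (elim w)
        have "norm (mollify B h \<epsilon> (p + w) - mollify B h \<epsilon> p - (\<Sum>j\<in>UNIV. \<beta> $ j * w $ j)) / norm w \<le> ((C * N) * (norm w)\<^sup>2) / norm w"
          using elim by (intro divide_right_mono est) auto
        then show ?case using elim by (simp add: power2_eq_square)
      qed
    qed
  qed
  then show ?thesis by (rule that)
qed

definition bump_mass :: "'n::finite itself \<Rightarrow> real \<Rightarrow> real"
  where "bump_mass _ \<epsilon> = (LINT x:cball (0::complex^'n) \<epsilon>|lborel. (bump \<epsilon> x)\<^sup>2)"

lemma bump_mass_pos:
  assumes "\<epsilon> > 0" shows "bump_mass TYPE('n::finite) \<epsilon> > 0"
proof -
  let ?B = "cball (0::complex^'n) \<epsilon>" and ?B' = "cball (0::complex^'n) (\<epsilon> / 2)"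
  have "0 < (\<epsilon>\<^sup>2 / 2)\<^sup>2 * measure lborel ?B'"
    using assms by (simp add: content_cball_pos)
  also have "\<dots> = (LINT x|lborel. indicator ?B' x *\<^sub>R (\<epsilon>\<^sup>2 / 2)\<^sup>2)"
    by (subst integral_scaleR_left) (auto intro!: integrable_real_indicator emeasure_lborel_cball_finite)
  also have "\<dots> \<le> (LINT x|lborel. indicator ?B x *\<^sub>R (bump \<epsilon> x)\<^sup>2)"
  proof (rule integral_mono)
    show "integrable lborel (\<lambda>x. indicat_real ?B' x *\<^sub>R (\<epsilon>\<^sup>2 / 2)\<^sup>2)"
      by (intro borel_integrable_compact compact_cball continuous_intros)
    show "integrable lborel (\<lambda>x. indicat_real ?B x *\<^sub>R (bump \<epsilon> x)\<^sup>2)"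
      by (intro borel_integrable_compact compact_cball continuous_intros)
    fix x :: "complex^'n"
    show "indicat_real ?B' x *\<^sub>R (\<epsilon>\<^sup>2 / 2)\<^sup>2 \<le> indicat_real ?B x *\<^sub>R (bump \<epsilon> x)\<^sup>2"
    proof (cases "x \<in> ?B'")
      case True
      then have "(norm x)\<^sup>2 \<le> (\<epsilon> / 2)\<^sup>2" by (intro power_mono) auto
      moreover have "(\<epsilon> / 2)\<^sup>2 = \<epsilon>\<^sup>2 / 4" by (simp add: power_divide)
      ultimately have "\<epsilon>\<^sup>2 / 2 \<le> \<epsilon>\<^sup>2 - (norm x)\<^sup>2"
        using zero_le_power2[of \<epsilon>] by linarith
      also have "\<dots> \<le> bump \<epsilon> x" by (simp add: bump_def)
      finally have "\<epsilon>\<^sup>2 / 2 \<le> bump \<epsilon> x" .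
      then have "(\<epsilon>\<^sup>2 / 2)\<^sup>2 \<le> (bump \<epsilon> x)\<^sup>2" by (intro power_mono) auto
      moreover have "x \<in> ?B" using True assms by auto
      ultimately show ?thesis using True by simp
    qed simp
  qed
  finally show ?thesis by (simp add: bump_mass_def set_lebesgue_integral_def)
qed

lemma mollify_eq_of_holomorphic:
  fixes h :: "complex^'n::finite \<Rightarrow> complex"
  assumes h: "holomorphic_fun h E0" "open E0" and q: "cball q \<epsilon> \<subseteq> E0" "cball q \<epsilon> \<subseteq> B" and \<epsilon>: "\<epsilon> > 0"
  shows "mollify B h \<epsilon> q = h q * of_real (bump_mass TYPE('n) \<epsilon>)"
proof -
  have "mollify B h \<epsilon> q = (LINT x:cball q \<epsilon>|lborel. h x * of_real ((bump \<epsilon> (x - q))\<^sup>2))"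
    unfolding mollify_def set_lebesgue_integral_def
  proof (rule Bochner_Integration.integral_cong[OF refl])
    fix x
    show "indicat_real B x *\<^sub>R (h x * complex_of_real ((bump \<epsilon> (x - q))\<^sup>2)) =
         indicat_real (cball q \<epsilon>) x *\<^sub>R (h x * complex_of_real ((bump \<epsilon> (x - q))\<^sup>2))"
    proof (cases "x \<in> cball q \<epsilon>")
      case True
      then have "x \<in> B" using q by blast
      with True show ?thesis by simp
    next
      case False
      then have "bump \<epsilon> (x - q) = 0" using \<epsilon> by (intro bump_outside) (auto simp: dist_norm norm_minus_commute)
      then show ?thesis by simp
    qed
  qed
  also have "\<dots> = h q * of_real (LINT x:cball (0::complex^'n) \<epsilon>|lborel. (max 0 (\<epsilon>\<^sup>2 - (norm x)\<^sup>2))\<^sup>2)"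
    unfolding bump_def by (rule radial_mean_value[OF h q(1)]) (intro continuous_intros)
  finally show ?thesis by (simp add: bump_mass_def bump_def)
qed

lemma dense_of_negligible_complement:
  fixes E E0 U :: "'a::euclidean_space set"
  assumes "negligible (E - E0)" "open U" "U \<noteq> {}" "U \<subseteq> E"
  obtains x where "x \<in> U" "x \<in> E0"
proof -
  have "\<not> negligible U" using assms open_not_negligible by blast
  then have "\<not> U \<subseteq> E - E0" using assms(1) negligible_subset by blast
  with assms(4) show ?thesis using that by blast
qed

text \<open>
  A version of Weyl's lemma for a function that is known to be holomorphic off a closed null set.
  Near a point of \<open>E\<close>, all mollifications of small radius are holomorphic. They are multiples of
  \<open>h\<close> on balls contained in \<open>E0\<close>, so after normalisation they coincide with each other by the
  identity theorem, and their common value extends \<open>h\<close>.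
\<close>

context
  fixes E E0 :: "(complex^'n::finite) set" and h :: "complex^'n \<Rightarrow> complex"
  assumes E: "open E" and E0: "open E0" "E0 \<subseteq> E" "negligible (E - E0)" and h: "holomorphic_fun h E0"
    and int: "\<And>p \<epsilon>. \<epsilon> > 0 \<Longrightarrow> cball p \<epsilon> \<subseteq> E \<Longrightarrow> set_integrable lborel (cball p \<epsilon>) h"
    and weak: "\<And>p \<epsilon> j. \<epsilon> > 0 \<Longrightarrow> cball p \<epsilon> \<subseteq> E \<Longrightarrow>
      (LINT x:cball p \<epsilon>|lborel. h x * (x - p) $ j * of_real (bump \<epsilon> (x - p))) = 0"
begin

lemma weakly_holomorphic_local_extension:
  assumes p0: "p0 \<in> E"
  shows "\<exists>R>0. \<exists>k. ball p0 R \<subseteq> E \<and> holomorphic_fun k (ball p0 R) \<and> (\<forall>x\<in>E0 \<inter> ball p0 R. k x = h x)"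
proof -
  obtain e where e: "e > 0" "cball p0 e \<subseteq> E" using E p0 open_contains_cball by blast
  define R where "R = e / 2"
  have R: "R > 0" using e by (simp add: R_def)
  define B where "B = cball p0 e"
  have B: "compact B" "B \<subseteq> E" using e by (auto simp: B_def)
  have hB: "set_integrable lborel B h" unfolding B_def by (rule int[OF e])
  have ballE: "ball p0 R \<subseteq> E"
  proof -
    have "ball p0 R \<subseteq> cball p0 e" using R by (auto simp: R_def)
    then show ?thesis using e by blast
  qed
  have sub: "cball p \<epsilon> \<subseteq> B" if "p \<in> ball p0 R" "\<epsilon> \<le> R" for p \<epsilon>
  proof
    fix x assume "x \<in> cball p \<epsilon>"
    then show "x \<in> B" using that dist_triangle[of p0 x p] by (simp add: B_def R_def)
  qed
  define m where "m \<epsilon> p = (1 / of_real (bump_mass TYPE('n) \<epsilon>)) * mollify B h \<epsilon> p" for \<epsilon> p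
  have mass: "bump_mass TYPE('n) \<epsilon> \<noteq> 0" if "\<epsilon> > 0" for \<epsilon> using bump_mass_pos[OF that, where 'n = 'n] by simp
  have hol: "holomorphic_fun (m \<epsilon>) (ball p0 R)" if \<epsilon>: "0 < \<epsilon>" "\<epsilon> \<le> R" for \<epsilon>
    unfolding m_def
  proof (intro holomorphic_fun_cmult, subst holomorphic_fun_iff[OF open_ball], intro ballI)
    fix p assume p: "p \<in> ball p0 R"
    have pB: "cball p \<epsilon> \<subseteq> B" by (rule sub[OF p \<epsilon>(2)])
    have pE: "cball p \<epsilon> \<subseteq> E" using pB B by blast
    obtain \<beta> :: "complex^'n" where "(mollify B h \<epsilon> has_derivative (\<lambda>w. \<Sum>j\<in>UNIV. \<beta> $ j * w $ j)) (at p)"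
      by (rule mollify_has_complex_derivative[OF hB B(1) pB \<epsilon>(1) weak[OF \<epsilon>(1) pE]]) (rule that)
    then show "\<exists>a :: complex^'n. (mollify B h \<epsilon> has_derivative (\<lambda>v. \<Sum>k\<in>UNIV. a $ k * v $ k)) (at p)" by blast
  qed
  have meq: "m \<epsilon> q = h q" if "0 < \<epsilon>" "\<epsilon> \<le> R" "q \<in> ball p0 R" "cball q \<epsilon> \<subseteq> E0" for \<epsilon> q
    using mollify_eq_of_holomorphic[OF h E0(1) that(4) sub[OF that(3,2)] that(1)] mass[OF that(1)]
    by (simp add: m_def)
  obtain q0 where q0: "q0 \<in> ball p0 R" "q0 \<in> E0"
    by (rule dense_of_negligible_complement[OF E0(3), of "ball p0 R"]) (use R ballE that in auto)
  obtain d where d: "d > 0" "ball q0 d \<subseteq> E0" using E0(1) q0(2) open_contains_ball by blast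
  define \<epsilon>0 where "\<epsilon>0 = min R (d / 2)"
  have \<epsilon>0: "0 < \<epsilon>0" "\<epsilon>0 \<le> R" "2 * \<epsilon>0 \<le> d" using R d by (auto simp: \<epsilon>0_def)
  \<comment> \<open>A single ball on which all small radii \<open>\<epsilon>\<close> reproduce \<open>h\<close>, from which the identity theorem starts.\<close>
  have near: "m \<epsilon> q = h q" if "0 < \<epsilon>" "\<epsilon> \<le> \<epsilon>0" "q \<in> ball q0 \<epsilon>0" "q \<in> ball p0 R" for \<epsilon> q
  proof (rule meq)
    have "cball q \<epsilon> \<subseteq> ball q0 d"
    proof
      fix x assume "x \<in> cball q \<epsilon>"
      then show "x \<in> ball q0 d" using that \<epsilon>0 dist_triangle[of q0 x q] by simp
    qed
    then show "cball q \<epsilon> \<subseteq> E0" using d by blast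
  qed (use that \<epsilon>0 in auto)
  have same: "m \<epsilon> x = m \<epsilon>0 x" if "0 < \<epsilon>" "\<epsilon> \<le> \<epsilon>0" "x \<in> ball p0 R" for \<epsilon> x
  proof (rule holomorphic_fun_identity_ball[OF hol hol \<epsilon>0(1) q0(1) _ that(3)])
    show "m \<epsilon> y = m \<epsilon>0 y" if "y \<in> ball q0 \<epsilon>0" "y \<in> ball p0 R" for y
      using near[of \<epsilon> y] near[of \<epsilon>0 y] that \<open>0 < \<epsilon>\<close> \<open>\<epsilon> \<le> \<epsilon>0\<close> \<epsilon>0 by simp
  qed (use that \<epsilon>0 in auto)
  have "m \<epsilon>0 x = h x" if x: "x \<in> E0" "x \<in> ball p0 R" for x
  proof -
    obtain r where r: "r > 0" "cball x r \<subseteq> E0" using E0(1) x(1) open_contains_cball by blast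
    define \<epsilon> where "\<epsilon> = min r \<epsilon>0"
    have \<epsilon>: "0 < \<epsilon>" "\<epsilon> \<le> \<epsilon>0" "\<epsilon> \<le> r" using r \<epsilon>0 by (auto simp: \<epsilon>_def)
    have "cball x \<epsilon> \<subseteq> E0" using r(2) subset_cball[OF \<epsilon>(3)] by blast
    then have "m \<epsilon> x = h x" using \<epsilon> \<epsilon>0 x by (intro meq) auto
    then show ?thesis using same[OF \<epsilon>(1,2) x(2)] by simp
  qed
  then show ?thesis using R ballE hol[OF \<epsilon>0(1,2)] by (intro exI[of _ R] conjI exI[of _ "m \<epsilon>0"]) auto
qed

lemma weakly_holomorphic_extension:
  obtains k where "holomorphic_fun k E" "\<And>x. x \<in> E0 \<Longrightarrow> k x = h x"
proof -
  have "\<forall>p\<in>E. \<exists>R k. R > 0 \<and> ball p R \<subseteq> E \<and> holomorphic_fun k (ball p R) \<and> (\<forall>x\<in>E0 \<inter> ball p R. k x = h x)"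
    using weakly_holomorphic_local_extension by blast
  from bchoice[OF this] obtain R where
    "\<forall>p\<in>E. \<exists>k. R p > 0 \<and> ball p (R p) \<subseteq> E \<and> holomorphic_fun k (ball p (R p)) \<and> (\<forall>x\<in>E0 \<inter> ball p (R p). k x = h x)"
    by blast
  from bchoice[OF this] obtain K where
    "\<forall>p\<in>E. R p > 0 \<and> ball p (R p) \<subseteq> E \<and> holomorphic_fun (K p) (ball p (R p)) \<and> (\<forall>x\<in>E0 \<inter> ball p (R p). K p x = h x)"
    by blast
  then have RK: "\<And>p. p \<in> E \<Longrightarrow> R p > 0" "\<And>p. p \<in> E \<Longrightarrow> ball p (R p) \<subseteq> E"
    "\<And>p. p \<in> E \<Longrightarrow> holomorphic_fun (K p) (ball p (R p))"
    "\<And>p x. p \<in> E \<Longrightarrow> x \<in> E0 \<Longrightarrow> x \<in> ball p (R p) \<Longrightarrow> K p x = h x"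
    by auto
  define k where "k p = K p p" for p
  have keq: "k q = K p q" if p: "p \<in> E" and q: "q \<in> ball p (R p)" for p q
  proof (rule ccontr)
    assume "k q \<noteq> K p q"
    have qE: "q \<in> E" using RK(2)[OF p] q by blast
    define W where "W = ball p (R p) \<inter> ball q (R q)"
    have "open W" "q \<in> W" using q RK(1)[OF qE] by (auto simp: W_def)
    have "continuous_on W (\<lambda>x. K q x - K p x)"
      unfolding W_def
      by (intro continuous_intros continuous_on_subset[OF holomorphic_fun_imp_continuous_on[OF RK(3)]] p qE) auto
    then have "open (W \<inter> (\<lambda>x. K q x - K p x) -` (- {0}))"
      by (intro continuous_open_preimage \<open>open W\<close>) auto
    moreover have "q \<in> W \<inter> (\<lambda>x. K q x - K p x) -` (- {0})"
      using \<open>k q \<noteq> K p q\<close> \<open>q \<in> W\<close> by (simp add: k_def)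
    moreover have "W \<subseteq> E" using RK(2)[OF p] by (auto simp: W_def)
    ultimately obtain x where x: "x \<in> W \<inter> (\<lambda>x. K q x - K p x) -` (- {0})" "x \<in> E0"
      using dense_of_negligible_complement[OF E0(3)] by (metis (no_types, lifting) empty_iff le_infI1)
    then show False using RK(4)[OF p, of x] RK(4)[OF qE, of x] by (auto simp: W_def)
  qed
  show ?thesis
  proof (rule that)
    show "holomorphic_fun k E"
    proof (rule holomorphic_fun_local)
      fix p assume p: "p \<in> E"
      have "holomorphic_fun k (ball p (R p))"
        by (rule holomorphic_fun_cong[OF RK(3)[OF p]]) (simp add: keq[OF p])
      then show "\<exists>r>0. holomorphic_fun k (ball p r)" using RK(1)[OF p] by blast
    qed
    show "k x = h x" if "x \<in> E0" for x
    proof -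
      have xE: "x \<in> E" using that E0(2) by blast
      show ?thesis unfolding k_def by (rule RK(4)[OF xE that]) (use RK(1)[OF xE] in simp)
    qed
  qed
qed

end

section \<open>Equivariant functions are pull-backs\<close>

lemma holomorphic_fun_inverse:
  assumes "holomorphic_fun g D" "\<And>z. z \<in> D \<Longrightarrow> g z \<noteq> 0"
  shows "holomorphic_fun (\<lambda>z. inverse (g z)) D"
  unfolding holomorphic_fun_def
proof
  fix z assume z: "z \<in> D"
  then obtain g' where g': "(g has_derivative g') (at z within D)" "\<And>c v. g' (c *s v) = c * g' v"
    using assms(1) unfolding holomorphic_fun_def by metis
  show "\<exists>h'. ((\<lambda>z. inverse (g z)) has_derivative h') (at z within D) \<and> (\<forall>c v. h' (c *s v) = c * h' v)"
    by (intro exI[of _ "\<lambda>v. - (inverse (g z) * g' v * inverse (g z))"] conjI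
        Deriv.has_derivative_inverse[OF assms(2)[OF z] g'(1)]) (simp add: g'(2))
qed

context deck_map
begin

lemma compact_preimage: "cball p \<epsilon> \<subseteq> E \<Longrightarrow> compact {x \<in> D. f x \<in> cball p \<epsilon>}"
  using compactin_proper_map_preimage[OF proper_f, of "cball p \<epsilon>"]
  by (simp add: compactin_subtopology)

lemma open_noncritical_values: "open (E - f ` Crit)"
  and negligible_critical_complement: "negligible (E - (E - f ` Crit))"
proof -
  have "openin (top_of_set E) (E - f ` Crit)"
    by (rule openin_diff[OF _ closedin_f_Crit]) simp
  then show "open (E - f ` Crit)" using open_E openin_open_eq by blast
  show "negligible (E - (E - f ` Crit))" by (rule negligible_subset[OF negligible_f_Crit]) auto
qed

lemma continuous_eq_on_D:
  fixes g k :: "complex^'n \<Rightarrow> complex"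
  assumes "continuous_on D g" "continuous_on D k" "\<And>x. x \<in> Reg \<Longrightarrow> g x = k x" "z \<in> D"
  shows "g z = k z"
proof (rule ccontr)
  assume "g z \<noteq> k z"
  have "open (D \<inter> (\<lambda>x. g x - k x) -` (- {0}))"
    by (intro continuous_open_preimage continuous_intros assms open_D)
  moreover have "z \<in> D \<inter> (\<lambda>x. g x - k x) -` (- {0})" using assms(4) \<open>g z \<noteq> k z\<close> by simp
  ultimately obtain x where "x \<in> D \<inter> (\<lambda>x. g x - k x) -` (- {0})" "J x \<noteq> 0"
    using J_nonzero_dense by (metis (no_types, lifting) empty_iff inf_le1)
  with assms(3) show False by (auto simp: Reg_def)
qed

lemma jacobian_diff_const: "x \<in> D \<Longrightarrow> jacobian (\<lambda>x. f x - p) x = A x"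
  and holomorphic_map_diff_const: "holomorphic_map (\<lambda>x. f x - p) D"
proof -
  have d: "((\<lambda>x. f x - p) has_derivative (*v) (A x)) (at x)" if "x \<in> D" for x
    using has_derivative_diff[OF der_f[OF that] has_derivative_const[of p]] by simp
  show hm: "holomorphic_map (\<lambda>x. f x - p) D" by (rule holomorphic_mapI[OF d])
  show "x \<in> D \<Longrightarrow> jacobian (\<lambda>x. f x - p) x = A x"
    by (rule jacobian_unique[OF open_D _ d hm])
qed

text \<open>
  The quotient \<open>H / J\<close> as a function on \<open>E\<close>, for equivariant \<open>H\<close>. The value \<open>0\<close> elsewhere matters on
  the complement of the image of \<open>f\<close>, where it lets the weak equations detect that \<open>f\<close> is onto.
\<close>

definition descend :: "(complex^'n \<Rightarrow> complex) \<Rightarrow> complex^'n \<Rightarrow> complex"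
  where "descend H y = (if y \<in> f ` Reg then H (inv_into Reg f y) / J (inv_into Reg f y) else 0)"

context
  fixes H :: "complex^'n \<Rightarrow> complex"
  assumes hol_H: "holomorphic_fun H D" and equi: "\<And>\<sigma> z. \<sigma> \<in> G \<Longrightarrow> z \<in> D \<Longrightarrow> H (\<sigma> *v z) * det \<sigma> = H z"
begin

lemma descend_f: assumes "z \<in> Reg" shows "descend H (f z) = H z / J z"
proof -
  define x where "x = inv_into Reg f (f z)"
  have x: "x \<in> Reg" "f x = f z" using assms by (auto simp: x_def inv_into_into f_inv_into_f)
  then obtain \<sigma> where \<sigma>: "\<sigma> \<in> G" "x = \<sigma> *v z" using fibre[of z x] assms Reg_subset by blast
  have zD: "z \<in> D" using assms Reg_subset by blast
  have "H z / J z = (H x * det \<sigma>) / (J x * det \<sigma>)"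
    unfolding \<sigma>(2) equi[OF \<sigma>(1) zD] J_equivariant[OF \<sigma>(1) zD] ..
  then show ?thesis using assms det_G_nonzero[OF \<sigma>(1)] by (simp add: descend_def x_def)
qed

lemma descend_outside: "y \<notin> f ` Reg \<Longrightarrow> descend H y = 0" by (simp add: descend_def)

lemma descend_holomorphic_f_Reg: "holomorphic_fun (descend H) (f ` Reg)"
proof (rule holomorphic_fun_local)
  fix y0 assume "y0 \<in> f ` Reg"
  then obtain z0 where z0: "z0 \<in> Reg" "y0 = f z0" by blast
  obtain r where r: "r > 0" "ball z0 r \<subseteq> Reg" "inj_on f (ball z0 r)"
    by (rule Reg_locally_injective[OF z0(1)]) (rule that)
  let ?U = "ball z0 r"
  define g where "g = the_inv_into ?U f"
  have gf: "g (f x) = x" if "x \<in> ?U" for x unfolding g_def by (rule the_inv_into_f_f[OF r(3) that])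
  have UD: "?U \<subseteq> D" using r(2) Reg_subset by blast
  have cf: "continuous_on ?U f" using continuous_on_subset[OF cont_f UD] .
  have oV: "open (f ` ?U)" by (rule invariance_of_domain[OF cf open_ball r(3)])
  have "holomorphic_map g (f ` ?U)"
  proof (rule holomorphic_mapI)
    fix y assume "y \<in> f ` ?U"
    then obtain x where x: "x \<in> ?U" "y = f x" by blast
    have "J x \<noteq> 0" using x r by (auto simp: Reg_def)
    then have inv: "invertible (A x)" by (simp add: jacobian_det_eq invertible_det_nz)
    have "(g has_derivative (*v) (matrix_inv (A x))) (at (f x))"
    proof (rule has_derivative_inverse_strong[OF open_ball x(1) cf gf])
      show "(f has_derivative (*v) (A x)) (at x)" using der_f x UD by blast
      show "(*v) (A x) \<circ> (*v) (matrix_inv (A x)) = id"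
        by (simp add: fun_eq_iff matrix_vector_mul_assoc matrix_inv_mult[OF inv])
    qed auto
    then show "(g has_derivative (*v) (matrix_inv (A (g y)))) (at y)" using x gf by simp
  qed
  moreover have "holomorphic_fun (\<lambda>z. H z * inverse (J z)) Reg"
    by (intro holomorphic_fun_mult holomorphic_fun_inverse holomorphic_fun_subset[OF hol_H Reg_subset]
        holomorphic_fun_subset[OF hol_J Reg_subset]) (simp add: Reg_def)
  ultimately have "holomorphic_fun (\<lambda>y. H (g y) * inverse (J (g y))) (f ` ?U)"
    using gf r(2) by (intro holomorphic_fun_compose[OF _ _ oV open_Reg]) auto
  then have "holomorphic_fun (descend H) (f ` ?U)"
    by (rule holomorphic_fun_cong) (use gf r(2) in \<open>auto simp: descend_f subset_iff divide_inverse\<close>)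
  moreover obtain s where "s > 0" "ball y0 s \<subseteq> f ` ?U"
    using oV z0(2) r(1) open_contains_ball by (metis centre_in_ball imageI)
  ultimately show "\<exists>r>0. holomorphic_fun (descend H) (ball y0 r)"
    using holomorphic_fun_subset by blast
qed

lemma descend_holomorphic: "holomorphic_fun (descend H) (E - f ` Crit)"
proof (rule holomorphic_fun_local)
  fix y assume y: "y \<in> E - f ` Crit"
  show "\<exists>r>0. holomorphic_fun (descend H) (ball y r)"
  proof (cases "y \<in> f ` Reg")
    case True
    then obtain r where "r > 0" "ball y r \<subseteq> f ` Reg" using open_f_Reg open_contains_ball by blast
    then show ?thesis using holomorphic_fun_subset[OF descend_holomorphic_f_Reg] by blast
  next
    case False
    have "openin (top_of_set E) (E - f ` D)"
      by (rule openin_diff[OF _ closed_map_f]) simp_all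
    then have "open (E - f ` D)" using open_E openin_open_eq by blast
    moreover have "y \<in> E - f ` D" using y False by (auto simp: f_D_split)
    ultimately obtain r where r: "r > 0" "ball y r \<subseteq> E - f ` D" using open_contains_ball by blast
    have "holomorphic_fun (descend H) (ball y r)"
      by (rule holomorphic_fun_cong[OF holomorphic_fun_const[of 0]])
         (use r(2) f_D_split descend_outside in \<open>metis DiffD2 UnI1 subsetD\<close>)
    then show ?thesis using r(1) by blast
  qed
qed

lemma
  fixes \<phi> :: "complex^'n \<Rightarrow> complex"
  assumes p: "cball p \<epsilon> \<subseteq> E" and \<phi>: "continuous_on UNIV \<phi>"
  shows descend_integrable: "set_integrable lborel (cball p \<epsilon>) (\<lambda>y. descend H y * \<phi> y)"
    and descend_integral: "real (card G) *\<^sub>R (LINT y:cball p \<epsilon>|lborel. descend H y * \<phi> y)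
      = (LINT x:{x \<in> D. f x \<in> cball p \<epsilon>}|lborel. cnj (J x) * H x * \<phi> (f x))"
proof -
  define K where "K = {x \<in> D. f x \<in> cball p \<epsilon>}"
  define g where "g y = indicator (cball p \<epsilon>) y *\<^sub>R (descend H y * \<phi> y)" for y
  have KD: "K \<subseteq> D" by (auto simp: K_def)
  have gm: "(\<lambda>y. indicator (f ` Reg) y *\<^sub>R g y) \<in> borel_measurable borel"
  proof -
    have "(\<lambda>y. indicator (f ` Reg) y *\<^sub>R (descend H y * \<phi> y)) \<in> borel_measurable borel"
      using open_f_Reg
      by (intro borel_measurable_continuous_on_indicator continuous_intros
          holomorphic_fun_imp_continuous_on[OF descend_holomorphic_f_Reg] continuous_on_subset[OF \<phi>]) auto
    then have "(\<lambda>y. indicat_real (cball p \<epsilon>) y *\<^sub>R (indicat_real (f ` Reg) y *\<^sub>R (descend H y * \<phi> y))) \<in> borel_measurable borel"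
      by (rule borel_measurable_scaleR[OF borel_measurable_indicator, rotated]) simp
    then show ?thesis by (simp add: g_def mult.commute)
  qed
  have eq1: "(\<lambda>x. indicator D x *\<^sub>R ((cmod (J x))\<^sup>2 *\<^sub>R g (f x))) = (\<lambda>x. indicator K x *\<^sub>R (cnj (J x) * H x * \<phi> (f x)))"
  proof (rule ext)
    fix x
    show "indicator D x *\<^sub>R ((cmod (J x))\<^sup>2 *\<^sub>R g (f x)) = indicator K x *\<^sub>R (cnj (J x) * H x * \<phi> (f x))"
    proof (cases "x \<in> Reg")
      case True
      then have nz: "J x \<noteq> 0" and xD: "x \<in> D" by (auto simp: Reg_def)
      have "complex_of_real ((cmod (J x))\<^sup>2) * (H x / J x) = cnj (J x) * H x"
        unfolding complex_norm_square using nz by simp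
      then have "(cmod (J x))\<^sup>2 *\<^sub>R (descend H (f x) * \<phi> (f x)) = cnj (J x) * H x * \<phi> (f x)"
        unfolding descend_f[OF True] scaleR_conv_of_real by (simp only: mult.assoc[symmetric])
      then show ?thesis using xD by (auto simp: g_def K_def indicator_def)
    next
      case False
      then have "x \<notin> D \<or> J x = 0" by (auto simp: Reg_def)
      then show ?thesis using KD by (auto simp: indicator_def)
    qed
  qed
  have eq2: "(\<lambda>y. indicator (f ` Reg) y *\<^sub>R g y) = (\<lambda>y. indicator (cball p \<epsilon>) y *\<^sub>R (descend H y * \<phi> y))"
    by (auto simp: fun_eq_iff g_def indicator_def descend_outside)
  have "compact K" unfolding K_def by (rule compact_preimage[OF p])
  then have "integrable lborel (\<lambda>x. indicator K x *\<^sub>R (cnj (J x) * H x * \<phi> (f x)))"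
    using KD
    by (intro borel_integrable_compact continuous_intros continuous_on_subset[OF cont_J]
        continuous_on_subset[OF holomorphic_fun_imp_continuous_on[OF hol_H]]
        continuous_on_compose2[OF \<phi> continuous_on_subset[OF cont_f]]) auto
  then show "set_integrable lborel (cball p \<epsilon>) (\<lambda>y. descend H y * \<phi> y)"
    using pushforward_integrable[OF gm] unfolding set_integrable_def eq1 eq2 by blast
  show "real (card G) *\<^sub>R (LINT y:cball p \<epsilon>|lborel. descend H y * \<phi> y)
      = (LINT x:{x \<in> D. f x \<in> cball p \<epsilon>}|lborel. cnj (J x) * H x * \<phi> (f x))"
    using pushforward_integral[OF gm] unfolding set_lebesgue_integral_def eq1 eq2 K_def by simp
qed

text \<open>
  Multiplying \<open>H / J\<close> by \<open>\<bar>J\<bar>^2\<close> leaves \<open>H * cnj J\<close>, so the pulled back integral is the conjugate of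
  the null Lagrangian integral for \<open>a = f - p\<close>. Properness of \<open>f\<close> provides the compact support.
\<close>

lemma descend_weakly_holomorphic:
  assumes \<epsilon>: "\<epsilon> > 0" and p: "cball p \<epsilon> \<subseteq> E"
  shows "(LINT y:cball p \<epsilon>|lborel. descend H y * (y - p) $ j * of_real (bump \<epsilon> (y - p))) = 0"
proof -
  let ?\<phi> = "\<lambda>y. (y - p) $ j * complex_of_real (bump \<epsilon> (y - p))"
  have c: "continuous_on UNIV ?\<phi>"
    by (intro continuous_intros linear_continuous_on bounded_linear_vec_nth)
  have K: "{x \<in> D. f x \<in> cball p \<epsilon>} = {x \<in> D. norm (f x - p) \<le> \<epsilon>}"
    by (auto simp: dist_norm norm_minus_commute)
  have "(\<lambda>x. indicator {x \<in> D. f x \<in> cball p \<epsilon>} x *\<^sub>R (cnj (J x) * H x * ?\<phi> (f x)))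
      = (\<lambda>x. cnj (indicator D x *\<^sub>R (cnj (H x) * det (jacobian (\<lambda>x. f x - p) x) * cnj ((f x - p) $ j)
            * of_real (max 0 (\<epsilon>\<^sup>2 - (norm (f x - p))\<^sup>2)))))"
  proof (rule ext)
    fix x
    show "indicator {x \<in> D. f x \<in> cball p \<epsilon>} x *\<^sub>R (cnj (J x) * H x * ?\<phi> (f x))
      = cnj (indicator D x *\<^sub>R (cnj (H x) * det (jacobian (\<lambda>x. f x - p) x) * cnj ((f x - p) $ j)
            * of_real (max 0 (\<epsilon>\<^sup>2 - (norm (f x - p))\<^sup>2))))"
    proof (cases "x \<in> D")
      case True
      have "bump \<epsilon> (f x - p) = 0" if "f x \<notin> cball p \<epsilon>"
        using that \<epsilon> by (intro bump_outside) (auto simp: dist_norm norm_minus_commute)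
      then show ?thesis using True
        by (auto simp: indicator_def jacobian_diff_const jacobian_det_eq bump_def[symmetric])
    qed simp
  qed
  then have "(LINT x:{x \<in> D. f x \<in> cball p \<epsilon>}|lborel. cnj (J x) * H x * ?\<phi> (f x))
    = cnj (LINT x:D|lborel. cnj (H x) * det (jacobian (\<lambda>x. f x - p) x) * cnj ((f x - p) $ j)
            * of_real (max 0 (\<epsilon>\<^sup>2 - (norm (f x - p))\<^sup>2)))"
    unfolding set_lebesgue_integral_def by (simp only: Bochner_Integration.integral_cnj)
  also have "\<dots> = 0"
    using null_lagrangian_integral[OF holomorphic_map_diff_const open_D hol_H, of p \<epsilon> j]
      compact_preimage[OF p] \<epsilon> unfolding K by simp
  finally have "real (card G) *\<^sub>R (LINT y:cball p \<epsilon>|lborel. descend H y * ?\<phi> y) = 0"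
    by (simp only: descend_integral[OF p c])
  then show ?thesis using card_G by (simp add: mult.assoc)
qed

lemma equivariant_factorization:
  obtains k where "holomorphic_fun k E" "\<And>z. z \<in> D \<Longrightarrow> H z = J z * k (f z)"
    "\<And>y. y \<in> E - f ` D \<Longrightarrow> k y = 0"
proof -
  obtain k where k: "holomorphic_fun k E" "\<And>y. y \<in> E - f ` Crit \<Longrightarrow> k y = descend H y"
  proof (rule weakly_holomorphic_extension[OF open_E open_noncritical_values _ negligible_critical_complement descend_holomorphic])
    show "set_integrable lborel (cball p \<epsilon>) (descend H)" if "\<epsilon> > 0" "cball p \<epsilon> \<subseteq> E" for p \<epsilon>
      using descend_integrable[OF that(2), of "\<lambda>_. 1"] by simp
    show "(LINT x:cball p \<epsilon>|lborel. descend H x * (x - p) $ j * of_real (bump \<epsilon> (x - p))) = 0"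
      if "\<epsilon> > 0" "cball p \<epsilon> \<subseteq> E" for p \<epsilon> j
      by (rule descend_weakly_holomorphic[OF that])
  qed (auto intro: that)
  show ?thesis
  proof (rule that[OF k(1)])
    fix z assume z: "z \<in> D"
    show "H z = J z * k (f z)"
    proof (rule continuous_eq_on_D[OF _ _ _ z])
      show "continuous_on D H" by (rule holomorphic_fun_imp_continuous_on[OF hol_H])
      show "continuous_on D (\<lambda>z. J z * k (f z))"
        using f_in_E
        by (intro continuous_intros cont_J continuous_on_compose2[OF holomorphic_fun_imp_continuous_on[OF k(1)] cont_f]) auto
      fix x assume x: "x \<in> Reg"
      then have "f x \<in> E - f ` Crit" using f_in_E Reg_subset f_Reg_disjoint_f_Crit by blast
      then show "H x = J x * k (f x)" using k(2) descend_f[OF x] x by (simp add: Reg_def)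
    qed
  next
    fix y assume "y \<in> E - f ` D"
    then show "k y = 0" using k(2)[of y] descend_outside[of y] by (auto simp: f_D_split)
  qed
qed

end

text \<open>
  For \<open>H = J\<close> the factor \<open>k\<close> is holomorphic, equal to \<open>1\<close> on the image of \<open>f\<close> and to \<open>0\<close> on its
  complement. Hence the image is open and closed in the connected set \<open>E\<close>.
\<close>

lemma f_surjective: "f ` D = E"
proof -
  obtain k where k: "holomorphic_fun k E" "\<And>z. z \<in> D \<Longrightarrow> J z = J z * k (f z)"
    "\<And>y. y \<in> E - f ` D \<Longrightarrow> k y = 0"
    by (rule equivariant_factorization[OF hol_J J_equivariant]) (assumption | rule that)+
  have ck: "continuous_on E k" by (rule holomorphic_fun_imp_continuous_on[OF k(1)])
  have one: "k (f z) = 1" if z: "z \<in> D" for z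
  proof (rule continuous_eq_on_D[of "\<lambda>z. k (f z)" "\<lambda>_. 1", OF _ _ _ z])
    show "continuous_on D (\<lambda>z. k (f z))"
      using f_in_E by (intro continuous_on_compose2[OF ck cont_f]) auto
    show "k (f x) = 1" if "x \<in> Reg" for x using k(2)[of x] that by (auto simp: Reg_def)
  qed simp
  have "f ` D = E \<inter> k -` (- {0})"
    using one k(3) f_in_E by (auto simp: image_iff)
  then have "openin (top_of_set E) (f ` D)"
    using continuous_openin_preimage_gen[OF ck, of "- {0}"] by auto
  moreover have "closedin (top_of_set E) (f ` D)" by (rule closed_map_f) simp
  ultimately show ?thesis using connected_E D_nonempty unfolding connected_clopen by blast
qed

lemma
  fixes g :: "complex^'n \<Rightarrow> 'b::{banach, second_countable_topology}"
  assumes g: "continuous_on E g"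
  shows pullback_integrable: "set_integrable lborel D (\<lambda>x. (cmod (J x))\<^sup>2 *\<^sub>R g (f x)) \<longleftrightarrow> set_integrable lborel E g"
    and pullback_integral: "(LINT x:D|lborel. (cmod (J x))\<^sup>2 *\<^sub>R g (f x)) = real (card G) *\<^sub>R (LINT y:E|lborel. g y)"
proof -
  have sub: "f ` Reg \<subseteq> E" using f_in_E Reg_subset by auto
  have m1: "(\<lambda>y. indicator (f ` Reg) y *\<^sub>R g y) \<in> borel_measurable borel"
    using open_f_Reg by (intro borel_measurable_continuous_on_indicator continuous_on_subset[OF g sub]) auto
  have m2: "(\<lambda>y. indicator E y *\<^sub>R g y) \<in> borel_measurable borel"
    using open_E by (intro borel_measurable_continuous_on_indicator g) auto
  have "E - f ` Reg \<subseteq> f ` Crit" using f_surjective f_D_split by blast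
  then have "negligible (E - f ` Reg)" by (rule negligible_subset[OF negligible_f_Crit])
  moreover have "E - f ` Reg \<in> sets borel" using open_E open_f_Reg by auto
  ultimately have "E - f ` Reg \<in> null_sets lborel"
    by (simp add: negligible_iff_null_sets null_sets_completion_iff)
  then have "AE y in lborel. y \<notin> E - f ` Reg" by (rule AE_not_in)
  then have ae: "AE y in lborel. indicator (f ` Reg) y *\<^sub>R g y = indicator E y *\<^sub>R g y"
    by eventually_elim (use sub in \<open>auto simp: indicator_def\<close>)
  have "set_integrable lborel (f ` Reg) g \<longleftrightarrow> set_integrable lborel E g"
    unfolding set_integrable_def using m1 m2 ae by (intro integrable_cong_AE) auto
  then show "set_integrable lborel D (\<lambda>x. (cmod (J x))\<^sup>2 *\<^sub>R g (f x)) \<longleftrightarrow> set_integrable lborel E g"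
    using pushforward_integrable[OF m1] by simp
  have "(LINT y:f ` Reg|lborel. g y) = (LINT y:E|lborel. g y)"
    unfolding set_lebesgue_integral_def using m1 m2 ae by (intro integral_cong_AE) auto
  then show "(LINT x:D|lborel. (cmod (J x))\<^sup>2 *\<^sub>R g (f x)) = real (card G) *\<^sub>R (LINT y:E|lborel. g y)"
    using pushforward_integral[OF m1] by simp
qed

lemma
  fixes g :: "complex^'n \<Rightarrow> 'b::{banach, second_countable_topology}"
  assumes \<sigma>: "\<sigma> \<in> G" and g: "continuous_on D g"
  shows G_set_integrable: "set_integrable lborel D (\<lambda>z. g (\<sigma> *v z)) \<longleftrightarrow> set_integrable lborel D g"
    and G_set_integral: "(LINT z:D|lborel. g (\<sigma> *v z)) = (LINT z:D|lborel. g z)"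
proof -
  have m: "(\<lambda>z. indicator D z *\<^sub>R g z) \<in> borel_measurable borel"
    using open_D by (intro borel_measurable_continuous_on_indicator g) auto
  have d: "distr lborel borel ((*v) \<sigma>) = lborel" by (rule lborel_distr_unimodular[OF cmod_det_G[OF \<sigma>]])
  have eq: "(\<lambda>z. indicator D (\<sigma> *v z) *\<^sub>R g (\<sigma> *v z)) = (\<lambda>z. indicator D z *\<^sub>R g (\<sigma> *v z))"
    using G_invariant_iff[OF \<sigma>] by (auto simp: indicator_def)
  show "set_integrable lborel D (\<lambda>z. g (\<sigma> *v z)) \<longleftrightarrow> set_integrable lborel D g"
    using integrable_distr_eq[of "(*v) \<sigma>" lborel borel "\<lambda>z. indicator D z *\<^sub>R g z"] m
    by (simp add: set_integrable_def d eq)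
  show "(LINT z:D|lborel. g (\<sigma> *v z)) = (LINT z:D|lborel. g z)"
    using integral_distr[of "(*v) \<sigma>" lborel borel "\<lambda>z. indicator D z *\<^sub>R g z"] m
    by (simp add: set_lebesgue_integral_def d eq)
qed

lemma holomorphic_map_G: "holomorphic_map ((*v) \<sigma>) D"
  by (rule holomorphic_mapI[where A = "\<lambda>_. \<sigma>"])
     (rule bounded_linear_imp_has_derivative[OF bounded_linear_matrix_vector_complex])

lemma det_matrix_inv_G: "\<sigma> \<in> G \<Longrightarrow> det \<sigma> * det (matrix_inv \<sigma>) = 1"
  using matrix_inv_mult(1)[OF G_invertible] by (metis det_I det_mul)

end

section \<open>The transformation rule\<close>

text \<open>
  The constant \<open>c\<close> is the density of the reference measure with respect to Lebesgue measure, the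
  same on both domains.
\<close>

locale weighted_deck_map = deck_map D E f G
  for D E :: "(complex^'n::finite) set" and f G +
  fixes \<omega> \<omega>' :: "complex^'n \<Rightarrow> real" and c :: real
  assumes cont_\<omega>: "continuous_on D \<omega>" and pos_\<omega>: "\<And>z. z \<in> D \<Longrightarrow> \<omega> z > 0"
    and cont_\<omega>': "continuous_on E \<omega>'" and pos_\<omega>': "\<And>z. z \<in> E \<Longrightarrow> \<omega>' z > 0"
    and weight_eq: "\<And>z. z \<in> D \<Longrightarrow> \<omega> z = \<omega>' (f z)" and c_pos: "c > 0"
begin

sublocale W1: weighted_domain D \<omega>
  by unfold_locales (auto intro: open_D cont_\<omega> pos_\<omega>)

sublocale W2: weighted_domain E \<omega>'
  by unfold_locales (auto intro: open_E cont_\<omega>' pos_\<omega>')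

definition V :: "(complex^'n) measure" where "V = density lborel (\<lambda>_. ennreal c)"

abbreviation "B1 \<equiv> bergman_kernel V D \<omega>"
abbreviation "B2 \<equiv> bergman_kernel V E \<omega>'"

lemmas B1_in_A2 = W1.bergman_kernel_in_A2[OF V_def c_pos]
lemmas B2_in_A2 = W2.bergman_kernel_in_A2[OF V_def c_pos]
lemmas B1_ip = W1.bergman_kernel_ip[OF V_def c_pos]
lemmas B2_ip = W2.bergman_kernel_ip[OF V_def c_pos]

lemma weight_invariant: "\<sigma> \<in> G \<Longrightarrow> z \<in> D \<Longrightarrow> \<omega> (\<sigma> *v z) = \<omega> z"
  by (simp add: weight_eq f_invariant G_invariant)

lemma pullback_A2_iff:
  assumes k: "holomorphic_fun k E"
  shows "(\<lambda>z. J z * k (f z)) \<in> W1.A2 \<longleftrightarrow> k \<in> W2.A2"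
proof -
  have "holomorphic_fun (\<lambda>z. J z * k (f z)) D"
    using f_in_E by (intro holomorphic_fun_mult hol_J holomorphic_fun_compose[OF k hol_f open_D open_E]) auto
  moreover have "set_integrable lborel D (\<lambda>z. (cmod (J z * k (f z)))\<^sup>2 * \<omega> z)
      \<longleftrightarrow> set_integrable lborel E (\<lambda>y. (cmod (k y))\<^sup>2 * \<omega>' y)"
  proof -
    have "continuous_on E (\<lambda>y. (cmod (k y))\<^sup>2 * \<omega>' y)"
      by (intro continuous_intros holomorphic_fun_imp_continuous_on[OF k] cont_\<omega>')
    from pullback_integrable[OF this]
    have "set_integrable lborel D (\<lambda>z. (cmod (J z))\<^sup>2 * ((cmod (k (f z)))\<^sup>2 * \<omega>' (f z)))
      \<longleftrightarrow> set_integrable lborel E (\<lambda>y. (cmod (k y))\<^sup>2 * \<omega>' y)" by simp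
    moreover have "set_integrable lborel D (\<lambda>z. (cmod (J z))\<^sup>2 * ((cmod (k (f z)))\<^sup>2 * \<omega>' (f z)))
      \<longleftrightarrow> set_integrable lborel D (\<lambda>z. (cmod (J z * k (f z)))\<^sup>2 * \<omega> z)"
      unfolding set_integrable_def
      by (intro Bochner_Integration.integrable_cong) (auto simp: indicator_def weight_eq norm_mult power_mult_distrib)
    ultimately show ?thesis by simp
  qed
  ultimately show ?thesis using k by (simp add: W1.A2_def W2.A2_def)
qed

lemma pullback_ip:
  assumes "g \<in> W2.A2" "k \<in> W2.A2"
  shows "W1.ip (\<lambda>z. J z * g (f z)) (\<lambda>z. J z * k (f z)) = of_nat (card G) * W2.ip g k"
proof -
  have "continuous_on E (\<lambda>y. g y * cnj (k y) * complex_of_real (\<omega>' y))"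
    by (intro continuous_intros W2.A2_continuous assms cont_\<omega>')
  from pullback_integral[OF this]
  have "(LINT z:D|lborel. (cmod (J z))\<^sup>2 *\<^sub>R (g (f z) * cnj (k (f z)) * complex_of_real (\<omega>' (f z))))
    = of_nat (card G) * W2.ip g k" by (simp add: W2.ip_def scaleR_conv_of_real)
  moreover have "W1.ip (\<lambda>z. J z * g (f z)) (\<lambda>z. J z * k (f z))
    = (LINT z:D|lborel. (cmod (J z))\<^sup>2 *\<^sub>R (g (f z) * cnj (k (f z)) * complex_of_real (\<omega>' (f z))))"
    unfolding W1.ip_def using open_D
    by (intro set_lebesgue_integral_cong)
       (auto simp: weight_eq scaleR_conv_of_real complex_norm_square mult_ac simp del: of_real_power)
  ultimately show ?thesis by simp
qed

lemma G_A2: assumes "h \<in> W1.A2" "\<sigma> \<in> G" shows "(\<lambda>z. h (\<sigma> *v z)) \<in> W1.A2"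
proof -
  have "holomorphic_fun (\<lambda>z. h (\<sigma> *v z)) D"
    using G_invariant[OF assms(2)]
    by (intro holomorphic_fun_compose[OF W1.A2_holomorphic[OF assms(1)] holomorphic_map_G open_D open_D]) auto
  moreover have "set_integrable lborel D (\<lambda>z. (cmod (h (\<sigma> *v z)))\<^sup>2 * \<omega> z)"
  proof -
    have "continuous_on D (\<lambda>z. (cmod (h z))\<^sup>2 * \<omega> z)"
      by (intro continuous_intros W1.A2_continuous[OF assms(1)] cont_\<omega>)
    then have "set_integrable lborel D (\<lambda>z. (cmod (h (\<sigma> *v z)))\<^sup>2 * \<omega> (\<sigma> *v z))"
      using G_set_integrable[OF assms(2)] W1.A2_integrable[OF assms(1)] by blast
    moreover have "set_integrable lborel D (\<lambda>z. (cmod (h (\<sigma> *v z)))\<^sup>2 * \<omega> (\<sigma> *v z))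
      \<longleftrightarrow> set_integrable lborel D (\<lambda>z. (cmod (h (\<sigma> *v z)))\<^sup>2 * \<omega> z)"
      unfolding set_integrable_def
      by (intro Bochner_Integration.integrable_cong) (auto simp: indicator_def weight_invariant assms(2))
    ultimately show ?thesis by simp
  qed
  ultimately show ?thesis by (simp add: W1.A2_def)
qed

lemma G_ip:
  assumes "g \<in> W1.A2" "h \<in> W1.A2" "\<sigma> \<in> G"
  shows "W1.ip g (\<lambda>z. h (\<sigma> *v z)) = W1.ip (\<lambda>z. g (matrix_inv \<sigma> *v z)) h"
proof -
  let ?k = "\<lambda>z. g (matrix_inv \<sigma> *v z) * cnj (h z) * complex_of_real (\<omega> z)"
  have "continuous_on D ?k"
    by (intro continuous_intros W1.A2_continuous assms G_A2 G_inv cont_\<omega>)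
  from G_set_integral[OF assms(3) this]
  have "(LINT z:D|lborel. g z * cnj (h (\<sigma> *v z)) * complex_of_real (\<omega> (\<sigma> *v z))) = W1.ip (\<lambda>z. g (matrix_inv \<sigma> *v z)) h"
    by (simp add: W1.ip_def G_inv_mult(1)[OF assms(3)])
  moreover have "W1.ip g (\<lambda>z. h (\<sigma> *v z)) = (LINT z:D|lborel. g z * cnj (h (\<sigma> *v z)) * complex_of_real (\<omega> (\<sigma> *v z)))"
    unfolding W1.ip_def using open_D
    by (intro set_lebesgue_integral_cong) (auto simp: weight_invariant assms(3))
  ultimately show ?thesis by simp
qed

text \<open>
  The left-hand side \<open>F\<close> is equivariant, hence \<open>F = J * (k \<circ> f)\<close>. For \<open>g\<close> in the Bergman space of
  \<open>E\<close>, each of the \<open>card G\<close> summands of \<open>F\<close> has the same inner product with \<open>J * (g \<circ> f)\<close>: the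
  factor \<open>cnj (det \<sigma>)\<close> cancels the factor \<open>det \<sigma>\<close> of \<open>J\<close> at the translate of \<open>w\<close>. Thus \<open>k\<close> and
  \<open>cnj (J w) * B2 (-) (f w)\<close> have the same inner products with the Bergman space.
\<close>

lemma kernel_transformation:
  assumes w: "w \<in> D" and z: "z \<in> D"
  shows "(\<Sum>\<sigma>\<in>G. det \<sigma> * B1 (\<sigma> *v z) w) = J z * cnj (J w) * B2 (f z) (f w)"
proof -
  let ?b = "\<lambda>z. B1 z w"
  define F where "F z = (\<Sum>\<sigma>\<in>G. det \<sigma> * B1 (\<sigma> *v z) w)" for z
  have summand: "(\<lambda>z. det \<sigma> * B1 (\<sigma> *v z) w) \<in> W1.A2" if "\<sigma> \<in> G" for \<sigma>
    using W1.A2_cmult[OF G_A2[OF B1_in_A2[OF w] that]] .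
  have F: "F \<in> W1.A2" unfolding F_def by (rule W1.A2_sum[OF summand])
  have equi: "F (\<tau> *v x) * det \<tau> = F x" if \<tau>: "\<tau> \<in> G" for \<tau> x
  proof -
    have bij: "bij_betw (\<lambda>\<sigma>. \<sigma> ** \<tau>) G G"
    proof (rule bij_betwI[where g = "\<lambda>\<sigma>. \<sigma> ** matrix_inv \<tau>"])
      show "\<And>\<sigma>. \<sigma> \<in> G \<Longrightarrow> \<sigma> ** \<tau> ** matrix_inv \<tau> = \<sigma>"
        by (simp add: matrix_inv_mult[OF G_invertible[OF \<tau>]] flip: matrix_mul_assoc)
      show "\<And>\<sigma>. \<sigma> \<in> G \<Longrightarrow> \<sigma> ** matrix_inv \<tau> ** \<tau> = \<sigma>"
        by (simp add: matrix_inv_mult[OF G_invertible[OF \<tau>]] flip: matrix_mul_assoc)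
    qed (auto intro: G_mult G_inv \<tau>)
    have "F (\<tau> *v x) * det \<tau> = (\<Sum>\<sigma>\<in>G. det (\<sigma> ** \<tau>) * B1 ((\<sigma> ** \<tau>) *v x) w)"
      unfolding F_def sum_distrib_right
      by (intro sum.cong refl) (simp add: det_mul matrix_vector_mul_assoc)
    also have "\<dots> = F x" unfolding F_def by (rule sum.reindex_bij_betw[OF bij])
    finally show ?thesis .
  qed
  obtain k where k: "holomorphic_fun k E" "\<And>z. z \<in> D \<Longrightarrow> F z = J z * k (f z)"
    by (rule equivariant_factorization[OF W1.A2_holomorphic[OF F] equi]) (assumption | rule that)+
  have kA: "k \<in> W2.A2"
    using pullback_A2_iff[OF k(1)] W1.A2_cong[OF F k(2)] by blast
  have kip: "W2.ip g k = W2.ip g (\<lambda>y. cnj (J w) * B2 y (f w))" if g: "g \<in> W2.A2" for g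
  proof -
    let ?g = "\<lambda>z. J z * g (f z)"
    have gA: "?g \<in> W1.A2" using pullback_A2_iff[OF W2.A2_holomorphic[OF g]] g by blast
    have each: "of_real c * W1.ip ?g (\<lambda>z. det \<sigma> * B1 (\<sigma> *v z) w) = J w * g (f w)" if \<sigma>: "\<sigma> \<in> G" for \<sigma>
    proof -
      let ?\<tau> = "matrix_inv \<sigma>"
      have \<tau>: "?\<tau> \<in> G" by (rule G_inv[OF \<sigma>])
      have "of_real c * W1.ip ?g (\<lambda>z. det \<sigma> * B1 (\<sigma> *v z) w)
          = cnj (det \<sigma>) * (of_real c * W1.ip (\<lambda>z. ?g (?\<tau> *v z)) ?b)"
        unfolding W1.ip_cmult_right G_ip[OF gA B1_in_A2[OF w] \<sigma>] by (simp add: mult_ac)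
      also have "\<dots> = cnj (det \<sigma>) * (J (?\<tau> *v w) * g (f (?\<tau> *v w)))"
        using B1_ip[OF w G_A2[OF gA \<tau>]] by simp
      also have "f (?\<tau> *v w) = f w" by (rule f_invariant[OF \<tau> w])
      also have "J (?\<tau> *v w) = det \<sigma> * J w"
        using J_equivariant[OF \<tau> w] det_matrix_inv_G[OF \<sigma>] by (metis mult.commute mult.left_commute mult.right_neutral)
      also have "cnj (det \<sigma>) * (det \<sigma> * J w * g (f w)) = (det \<sigma> * cnj (det \<sigma>)) * (J w * g (f w))"
        by (simp add: mult_ac)
      also have "det \<sigma> * cnj (det \<sigma>) = 1"
        by (simp add: complex_norm_square[symmetric] cmod_det_G[OF \<sigma>])
      finally show ?thesis by simp
    qed
    have "of_nat (card G) * (of_real c * W2.ip g k) = of_real c * W1.ip ?g (\<lambda>z. J z * k (f z))"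
      by (simp add: pullback_ip[OF g kA])
    also have "W1.ip ?g (\<lambda>z. J z * k (f z)) = W1.ip ?g F"
      by (rule W1.ip_cong) (simp_all add: k(2))
    also have "\<dots> = (\<Sum>\<sigma>\<in>G. W1.ip ?g (\<lambda>z. det \<sigma> * B1 (\<sigma> *v z) w))"
      unfolding F_def by (rule W1.ip_sum_right[OF gA summand])
    also have "of_real c * \<dots> = of_nat (card G) * (J w * g (f w))"
      by (simp add: sum_distrib_left each)
    finally have "of_real c * W2.ip g k = J w * g (f w)" using card_G by simp
    also have "\<dots> = of_real c * W2.ip g (\<lambda>y. cnj (J w) * B2 y (f w))"
      unfolding W2.ip_cmult_right using B2_ip[OF f_in_E[OF w] g] by (simp add: mult.left_commute)
    finally show ?thesis using c_pos by simp
  qed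
  have "k (f z) = cnj (J w) * B2 (f z) (f w)"
    by (rule W2.reproducing_unique[OF kA W2.A2_cmult[OF B2_in_A2[OF f_in_E[OF w]]] kip f_in_E[OF z]])
  then show ?thesis using k(2)[OF z] by (simp add: F_def)
qed

lemma sesquiholomorphic_extension_kernel:
  defines "q \<equiv> (\<lambda>z w. 1 / (J z * cnj (J w)) * (\<Sum>\<sigma>\<in>G. det \<sigma> * B1 (act (matrix_inv \<sigma>) z) w))"
  shows "sesquiholomorphic_extension D J q (\<lambda>z w. B2 (f z) (f w))"
    and "sesquiholomorphic_extension D J q Q \<Longrightarrow> z \<in> D \<Longrightarrow> w \<in> D \<Longrightarrow> B2 (f z) (f w) = Q z w"
proof -
  have fE: "f ` D \<subseteq> E" using f_in_E by blast
  have h1: "holomorphic_fun (\<lambda>z. B2 (f z) (f w)) D" if "w \<in> D" for w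
    by (rule holomorphic_fun_compose[OF W2.A2_holomorphic[OF B2_in_A2[OF f_in_E[OF that]]] hol_f open_D open_E fE])
  have h2: "holomorphic_fun (\<lambda>w. cnj (B2 (f z) (f w))) D" if z: "z \<in> D" for z
    by (rule holomorphic_fun_cong[OF h1[OF z]])
       (simp add: W2.bergman_kernel_hermitian[OF V_def c_pos f_in_E f_in_E[OF z]])
  have q: "B2 (f z) (f w) = q z w" if "z \<in> D" "w \<in> D" "J z \<noteq> 0" "J w \<noteq> 0" for z w
  proof -
    have "(\<Sum>\<sigma>\<in>G. det \<sigma> * B1 (act (matrix_inv \<sigma>) z) w) = J z * cnj (J w) * B2 (f z) (f w)"
      using kernel_transformation[OF that(2,1)] by (simp add: act_inv)
    then show ?thesis using that by (simp add: q_def)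
  qed
  show "sesquiholomorphic_extension D J q (\<lambda>z w. B2 (f z) (f w))"
    unfolding sesquiholomorphic_extension_def using h1 h2 q by blast
  assume Q: "sesquiholomorphic_extension D J q Q" and z: "z \<in> D" and w: "w \<in> D"
  have Q1: "continuous_on D (\<lambda>z. Q z w)" if "w \<in> D" for w
    using Q that holomorphic_fun_imp_continuous_on unfolding sesquiholomorphic_extension_def by blast
  have Q2: "continuous_on D (\<lambda>w. cnj (Q z w))" if "z \<in> D" for z
    using Q that holomorphic_fun_imp_continuous_on unfolding sesquiholomorphic_extension_def by blast
  have Qq: "Q z w = q z w" if "z \<in> Reg" "w \<in> Reg" for z w
    using Q that unfolding sesquiholomorphic_extension_def Reg_def by blast
  have step: "B2 (f z) (f w) = Q z w" if z: "z \<in> D" and w: "w \<in> Reg" for z w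
  proof -
    have wD: "w \<in> D" using w Reg_subset by blast
    show ?thesis
      by (rule continuous_eq_on_D[OF holomorphic_fun_imp_continuous_on[OF h1[OF wD]] Q1[OF wD] _ z])
         (use Qq q w in \<open>auto simp: Reg_def\<close>)
  qed
  have "cnj (B2 (f z) (f w)) = cnj (Q z w)"
    by (rule continuous_eq_on_D[OF holomorphic_fun_imp_continuous_on[OF h2[OF z]] Q2[OF z] _ w])
       (simp add: step[OF z])
  then show "B2 (f z) (f w) = Q z w" by simp
qed

end

theorem theorem4p1:
  fixes G :: "(complex^'n^'n) set"
    and \<Omega>\<^sub>1 \<Omega>\<^sub>2 :: "(complex^'n) set"
    and f :: "complex^'n \<Rightarrow> complex^'n"
    and \<omega> \<omega>' :: "complex^'n \<Rightarrow> real"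
  assumes "finite_complex_reflection_group G"
    and "open \<Omega>\<^sub>1" "connected \<Omega>\<^sub>1" "\<Omega>\<^sub>1 \<noteq> {}" "bounded \<Omega>\<^sub>1"
    and "open \<Omega>\<^sub>2" "connected \<Omega>\<^sub>2" "\<Omega>\<^sub>2 \<noteq> {}" "bounded \<Omega>\<^sub>2"
    and "proper_holomorphic f \<Omega>\<^sub>1 \<Omega>\<^sub>2"
    and "has_deck_group f \<Omega>\<^sub>1 G"
    and "continuous_on \<Omega>\<^sub>1 \<omega>" "\<forall>z\<in>\<Omega>\<^sub>1. \<omega> z > 0"
    and "continuous_on \<Omega>\<^sub>2 \<omega>'" "\<forall>z\<in>\<Omega>\<^sub>2. \<omega>' z > 0"
    and "\<forall>z\<in>\<Omega>\<^sub>1. \<omega> z = \<omega>' (f z)"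
  shows "let V = normalized_lebesgue \<Omega>\<^sub>1;
             J = jacobian_det f;
             B\<^sub>1 = bergman_kernel V \<Omega>\<^sub>1 \<omega>;
             B\<^sub>2 = bergman_kernel V \<Omega>\<^sub>2 \<omega>';
             q = (\<lambda>z w. 1 / (J z * cnj (J w)) *
                    (\<Sum>\<sigma>\<in>G. det \<sigma> * B\<^sub>1 (act (matrix_inv \<sigma>) z) w))
         in (\<exists>Q. sesquiholomorphic_extension \<Omega>\<^sub>1 J q Q) \<and>
            (\<forall>Q. sesquiholomorphic_extension \<Omega>\<^sub>1 J q Q \<longrightarrow>
               (\<forall>z\<in>\<Omega>\<^sub>1. \<forall>w\<in>\<Omega>\<^sub>1. B\<^sub>2 (f z) (f w) = Q z w))"
proof -
  define c where "c = 1 / measure lborel \<Omega>\<^sub>1"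
  have "measure lborel \<Omega>\<^sub>1 \<noteq> 0"
  proof
    assume "measure lborel \<Omega>\<^sub>1 = 0"
    then have "emeasure lborel \<Omega>\<^sub>1 = 0"
      using emeasure_bounded_finite[OF assms(5)] by (auto simp: measure_def enn2real_eq_0_iff)
    then have "\<Omega>\<^sub>1 \<in> null_sets lborel" using assms(2) by (simp add: null_sets_def)
    then have "negligible \<Omega>\<^sub>1"
      using assms(2) by (simp add: negligible_iff_null_sets null_sets_completion_iff)
    then show False using open_not_negligible assms by blast
  qed
  then have "c > 0" by (simp add: c_def zero_less_measure_iff)
  have "finite G" "subgroup G GL"
    using assms(1) unfolding finite_complex_reflection_group_def by blast+
  then interpret weighted_deck_map \<Omega>\<^sub>1 \<Omega>\<^sub>2 f G \<omega> \<omega>' c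
    using assms \<open>c > 0\<close>
    by (intro weighted_deck_map.intro weighted_deck_map_axioms.intro deck_map.intro) blast+
  have V: "normalized_lebesgue \<Omega>\<^sub>1 = V" unfolding V_def normalized_lebesgue_def by (simp add: c_def)
  show ?thesis
    unfolding Let_def V using sesquiholomorphic_extension_kernel by blast
qed

end
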